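(* Let $m\ge 2$ and let $\Omega\subset\mathbb{R}^m$ be a p-convex bounded domain with $\partial\Omega\in C^{2,\alpha}$, where $0<\alpha<1$. Let $\varphi\in C^{2,\alpha}(\bar\Omega)$. Suppose the vector field $\vec F=(F_1,\dots,F_m)\in C^{1,\alpha}(\bar\Omega)$ satisfies $$\partial_K F_I=\partial_I f_K\quad\text{in }\Omega,\qquad I,K=1,\dots,m,$$ for some $C^{1,\alpha}$-smooth and bounded functions $f_1,\dots,f_m$ in $\Omega$. Then there exists a Lipschitz continuous minimizer $u\in C^{0,1}(\bar\Omega)$ for the functional $\mathcal{F}(u)=\int_\Omega|\nabla u+\vec F|$ such that $u=\varphi$ on $\partial\Omega$.
   Context: Integrals are with respect to Lebesgue measure. A function $u\in W^{1,1}(\Omega)$ is called a minimizer for $\mathcal{F}(u)=\int_\Omega|\nabla u+\vec F|$ (where $\vec F\in L^1(\Omega)$) if $\mathcal{F}(u)\le\mathcal{F}(u+\psi)$ for every $\psi\in W^{1,1}_0(\Omega)$. A coordinate system on $\mathbb{R}^m$ is called orthonormal if it is obtained by a translation and a rotation from the standard coordinates $x_1,\dots,x_m$. A domain $\Omega\subset\mathbb{R}^m$ is called parabolically convex (p-convex) if there is a constant $a>0$ such that for every $p\in\partial\Omega$ there exists an orthonormal coordinate system $(\tilde x_1,\dots,\tilde x_m)$ with origin at $p$ and $\Omega\subset\{a\tilde x_1^2-\tilde x_2<0\}$ ($a$ is independent of $p$). *)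

theory Defs
  imports "HOL-Analysis.Analysis"
begin

definition is_domain :: "'a::topological_space set \<Rightarrow> bool" where
  "is_domain \<Omega> \<longleftrightarrow> open \<Omega> \<and> connected \<Omega> \<and> \<Omega> \<noteq> {}"


section \<open>Classical differentiability and Hoelder classes\<close>

definition partial :: "'m::finite \<Rightarrow> (real^'m \<Rightarrow> 'b::real_normed_vector) \<Rightarrow> real^'m \<Rightarrow> 'b" where
  "partial i f x = frechet_derivative f (at x) (axis i 1)"

text \<open>Iterated partial derivatives; the last index of the list is differentiated first.\<close>

definition partials :: "'m::finite list \<Rightarrow> (real^'m \<Rightarrow> 'b::real_normed_vector) \<Rightarrow> real^'m \<Rightarrow> 'b" where
  "partials ks f = foldr partial ks f"

text \<open>For open \<open>\<Omega>\<close>. Differentiability is required because \<^const>\<open>frechet_derivative\<close> has an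
  unspecified value where the derivative does not exist.\<close>

definition C_k :: "nat \<Rightarrow> (real^'m::finite) set \<Rightarrow> (real^'m \<Rightarrow> 'b::real_normed_vector) \<Rightarrow> bool" where
  "C_k k \<Omega> f \<longleftrightarrow>
     (\<forall>ks. length ks < k \<longrightarrow> (\<forall>x\<in>\<Omega>. partials ks f differentiable (at x))) \<and>
     (\<forall>ks. length ks \<le> k \<longrightarrow> continuous_on \<Omega> (partials ks f))"

text \<open>Functions on the closure of \<open>\<Omega>\<close> all of whose derivatives in \<open>\<Omega>\<close> up to order \<open>k\<close> extend
  continuously to the closure. The function itself has to agree with its own extension, hence
  the last conjunct.\<close>

definition C_k_closure :: "nat \<Rightarrow> (real^'m::finite) set \<Rightarrow> (real^'m \<Rightarrow> 'b::real_normed_vector) \<Rightarrow> bool" where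
  "C_k_closure k \<Omega> f \<longleftrightarrow>
     C_k k \<Omega> f \<and>
     (\<forall>ks. length ks \<le> k \<longrightarrow>
        (\<exists>g. continuous_on (closure \<Omega>) g \<and> (\<forall>x\<in>\<Omega>. g x = partials ks f x))) \<and>
     continuous_on (closure \<Omega>) f"

definition holder_on :: "real \<Rightarrow> 'a::metric_space set \<Rightarrow> ('a \<Rightarrow> 'b::metric_space) \<Rightarrow> bool" where
  "holder_on \<alpha> S f \<longleftrightarrow> (\<exists>C. \<forall>x\<in>S. \<forall>y\<in>S. dist (f x) (f y) \<le> C * dist x y powr \<alpha>)"

text \<open>The spaces \<open>C\<^sup>k\<^sup>,\<^sup>\<alpha>(\<Omega>)\<close> (derivatives of order \<open>k\<close> locally Hoelder) and
  \<open>C\<^sup>k\<^sup>,\<^sup>\<alpha>\<close> on the closure of \<open>\<Omega>\<close> (derivatives of order \<open>k\<close> uniformly Hoelder).\<close>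

definition C_holder :: "nat \<Rightarrow> real \<Rightarrow> (real^'m::finite) set \<Rightarrow> (real^'m \<Rightarrow> 'b::real_normed_vector) \<Rightarrow> bool" where
  "C_holder k \<alpha> \<Omega> f \<longleftrightarrow>
     C_k k \<Omega> f \<and>
     (\<forall>ks S. length ks = k \<longrightarrow> compact S \<longrightarrow> S \<subseteq> \<Omega> \<longrightarrow> holder_on \<alpha> S (partials ks f))"

definition C_holder_closure :: "nat \<Rightarrow> real \<Rightarrow> (real^'m::finite) set \<Rightarrow> (real^'m \<Rightarrow> 'b::real_normed_vector) \<Rightarrow> bool" where
  "C_holder_closure k \<alpha> \<Omega> f \<longleftrightarrow>
     C_k_closure k \<Omega> f \<and> (\<forall>ks. length ks = k \<longrightarrow> holder_on \<alpha> \<Omega> (partials ks f))"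


section \<open>Regularity and shape of the domain\<close>

text \<open>Boundary of class \<open>C\<^sup>k\<^sup>,\<^sup>\<alpha>\<close> in the sense of Gilbarg and Trudinger (Section 6.2): the boundary
  is locally straightened by \<open>C\<^sup>k\<^sup>,\<^sup>\<alpha>\<close> diffeomorphisms with \<open>C\<^sup>k\<^sup>,\<^sup>\<alpha>\<close> inverse. The half space
  is \<open>y $ n > 0\<close> for some index \<open>n\<close>; which one is immaterial, as coordinates may be permuted.\<close>

definition C_holder_boundary :: "nat \<Rightarrow> real \<Rightarrow> (real^'m::finite) set \<Rightarrow> bool" where
  "C_holder_boundary k \<alpha> \<Omega> \<longleftrightarrow>
     (\<forall>p\<in>frontier \<Omega>. \<exists>r>0. \<exists>(D::(real^'m) set) \<Psi> \<Phi> n.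
        open D \<and> homeomorphism (ball p r) D \<Psi> \<Phi> \<and>
        C_holder k \<alpha> (ball p r) \<Psi> \<and> C_holder k \<alpha> D \<Phi> \<and>
        \<Psi> ` (ball p r \<inter> \<Omega>) \<subseteq> {y. y $ n > 0} \<and>
        \<Psi> ` (ball p r \<inter> frontier \<Omega>) \<subseteq> {y. y $ n = 0})"

text \<open>A coordinate system is represented by the map sending a point to its new coordinates.\<close>

definition orthonormal_coordinates :: "(real^'m::finite \<Rightarrow> real^'m) \<Rightarrow> bool" where
  "orthonormal_coordinates T \<longleftrightarrow> (\<exists>R c. rotation_matrix R \<and> T = (\<lambda>x. R *v (x - c)))"

text \<open>The coordinates \<open>1\<close> and \<open>2\<close> are rendered as two distinct indices \<open>i\<close> and \<open>j\<close>: relabelling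
  coordinates is a rotation up to a sign, and the sign of the \<open>i\<close>-th coordinate does not matter.\<close>

definition p_convex :: "(real^'m::finite) set \<Rightarrow> bool" where
  "p_convex \<Omega> \<longleftrightarrow>
     (\<exists>a>0. \<forall>p\<in>frontier \<Omega>. \<exists>T i j.
        orthonormal_coordinates T \<and> T p = 0 \<and> i \<noteq> j \<and>
        \<Omega> \<subseteq> {x. a * (T x $ i)\<^sup>2 - T x $ j < 0})"


section \<open>Sobolev spaces\<close>

text \<open>Elements of \<open>L\<^sup>1(\<Omega>)\<close> and of the Sobolev spaces are represented by functions on the whole
  space; only the values on \<open>\<Omega>\<close>, up to null sets, are relevant.\<close>

definition test_function :: "(real^'m::finite) set \<Rightarrow> (real^'m \<Rightarrow> real) \<Rightarrow> bool" where
  "test_function \<Omega> \<zeta> \<longleftrightarrow>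
     (\<forall>k. C_k k UNIV \<zeta>) \<and> compact (closure {x. \<zeta> x \<noteq> 0}) \<and> closure {x. \<zeta> x \<noteq> 0} \<subseteq> \<Omega>"

definition has_weak_gradient ::
  "(real^'m::finite) set \<Rightarrow> (real^'m \<Rightarrow> real) \<Rightarrow> (real^'m \<Rightarrow> real^'m) \<Rightarrow> bool" where
  "has_weak_gradient \<Omega> u v \<longleftrightarrow>
     (\<forall>\<zeta> i. test_function \<Omega> \<zeta> \<longrightarrow>
        (LINT x:\<Omega>|lebesgue. u x * partial i \<zeta> x) = - (LINT x:\<Omega>|lebesgue. v x $ i * \<zeta> x))"

definition W11 :: "(real^'m::finite) set \<Rightarrow> (real^'m \<Rightarrow> real) set" where
  "W11 \<Omega> = {u. set_integrable lebesgue \<Omega> u \<and>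
                (\<exists>v. set_integrable lebesgue \<Omega> v \<and> has_weak_gradient \<Omega> u v)}"

text \<open>For \<open>u \<in> W11 \<Omega>\<close> the choice is unique up to a null set in \<open>\<Omega>\<close>.\<close>

definition weak_gradient :: "(real^'m::finite) set \<Rightarrow> (real^'m \<Rightarrow> real) \<Rightarrow> real^'m \<Rightarrow> real^'m" where
  "weak_gradient \<Omega> u = (SOME v. set_integrable lebesgue \<Omega> v \<and> has_weak_gradient \<Omega> u v)"

definition W11_norm :: "(real^'m::finite) set \<Rightarrow> (real^'m \<Rightarrow> real) \<Rightarrow> real" where
  "W11_norm \<Omega> u =
     (LINT x:\<Omega>|lebesgue. \<bar>u x\<bar>) + (LINT x:\<Omega>|lebesgue. norm (weak_gradient \<Omega> u x))"

definition W11_0 :: "(real^'m::finite) set \<Rightarrow> (real^'m \<Rightarrow> real) set" where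
  "W11_0 \<Omega> = {\<psi> \<in> W11 \<Omega>. \<exists>\<zeta>. (\<forall>n. test_function \<Omega> (\<zeta> n)) \<and>
                 (\<lambda>n. W11_norm \<Omega> (\<lambda>x. \<psi> x - \<zeta> n x)) \<longlonglongrightarrow> 0}"


section \<open>The functional\<close>

definition functional_F ::
  "(real^'m::finite) set \<Rightarrow> (real^'m \<Rightarrow> real^'m) \<Rightarrow> (real^'m \<Rightarrow> real) \<Rightarrow> real" where
  "functional_F \<Omega> F u = (LINT x:\<Omega>|lebesgue. norm (weak_gradient \<Omega> u x + F x))"

definition is_minimizer ::
  "(real^'m::finite) set \<Rightarrow> (real^'m \<Rightarrow> real^'m) \<Rightarrow> (real^'m \<Rightarrow> real) \<Rightarrow> bool" where
  "is_minimizer \<Omega> F u \<longleftrightarrow>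
     set_integrable lebesgue \<Omega> F \<and> u \<in> W11 \<Omega> \<and>
     (\<forall>\<psi>\<in>W11_0 \<Omega>. functional_F \<Omega> F u \<le> functional_F \<Omega> F (\<lambda>x. u x + \<psi> x))"

end

theory Submission
  imports Defs "HOL-Complex_Analysis.Great_Picard"
begin

text \<open>
  Hilbert-Haar theory replaces elliptic regularity. Put \<open>w = u - \<phi>\<close> and \<open>V w = \<nabla>w + \<nabla>\<phi> + F\<close>, where \<open>w\<close>
  vanishes outside \<open>\<Omega>\<close>. Among the Lipschitz functions \<open>w\<close> with \<open>\<bar>V w\<bar> \<le> L\<close>, first
  minimise \<open>\<integral>\<bar>V w\<bar>\<close> and then, among the minimisers, \<open>\<integral>\<bar>V w\<bar>\<^sup>2\<close>; the second step makes minimising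
  sequences Cauchy and the minimiser unique. It remains to bound its Lipschitz constant
  independently of \<open>L\<close>, for then the constraint is not active in the direction of test functions.

  At a boundary point \<open>p\<close> with \<open>\<Omega> \<subseteq> {a \<xi>\<^sup>2 < \<eta>}\<close> the function \<open>k (\<eta> - a \<xi>\<^sup>2)\<close> is an upper barrier for
  large \<open>k\<close>: the unit field \<open>W/\<bar>W\<bar>\<close> for \<open>W = V (k (\<eta> - a \<xi>\<^sup>2))\<close> has negative divergence and
  calibrates the comparison. So \<open>\<bar>w(x) - w(p)\<bar> \<le> k \<bar>x - p\<bar>\<close>. By the condition on \<open>F\<close>, the difference
  \<open>F(x + h) - F(x)\<close> is the gradient of a function of size \<open>O(\<bar>h\<bar>)\<close>, so a translate of \<open>w\<close> corrected by
  this function is again a minimiser, and comparing the two carries the boundary estimate inside.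
\<close>

subsection \<open>Differentiability of Lipschitz functions on the line\<close>

text \<open>The integrand is convex but not strictly convex, so minimisers are not unique and
  comparing \<open>w\<close> with a corrected translate proves nothing by itself. The two functions
  therefore exchange pieces. This leaves the sum of the energies unchanged for every integrand,
  hence for both energies of the two-step problem; each exchanged function is a second solution of
  that problem, and uniqueness identifies it with \<open>w\<close>. The exchange also explains why
  the constraint is put on \<open>V w\<close>: it carries values of \<open>V w\<close> from
  \<open>x + h\<close> to \<open>x\<close> and keeps such a bound exactly, whereas the correcting
  function changes the gradient.

  The correcting function is the integral over 0 \<le> s \<le> 1 of
  \<open>\<Sum>K\<in>UNIV. h $ K * f K (x + s *\<^sub>R h)\<close>, plus the difference of the
  boundary datum at \<open>x + h\<close> and \<open>x\<close>. The parabolas make \<Omega> convex,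
  which keeps the segment from \<open>x\<close> to \<open>x + h\<close> inside and turns bounds of
  derivatives into Lipschitz constants. Gradients are vectors of partial derivatives that exist
  almost everywhere, so differentiability of Lipschitz functions is established along lines and
  spread over the space by Fubini.\<close>

lemma bilipschitz_indefinite_integral:
  fixes f :: "real \<Rightarrow> real"
  assumes lo: "\<And>x y. x \<le> y \<Longrightarrow> y - x \<le> f y - f x"
    and up: "\<And>x y. x \<le> y \<Longrightarrow> f y - f x \<le> C * (y - x)"
  obtains v where "\<And>a b. a \<le> b \<Longrightarrow> (v has_integral (f b - f a)) {a..b}"
proof -
  have lip: "\<bar>f y - f x\<bar> \<le> C * \<bar>y - x\<bar>" for x y
    using lo[of x y] up[of x y] lo[of y x] up[of y x] by (cases "x \<le> y") auto
  have cont: "continuous_on UNIV f"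
  proof (rule continuous_on_subset[OF lipschitz_on_continuous_on[of "max C 0"]])
    show "(max C 0)-lipschitz_on UNIV f"
      by (rule lipschitz_onI) (auto simp: dist_real_def intro: order_trans[OF lip mult_right_mono])
  qed auto
  have f_less: "f x < f y \<longleftrightarrow> x < y" for x y
    using lo[of x y] lo[of y x] by (cases x y rule: linorder_cases) auto
  have inj: "inj f"
    by (rule injI) (metis f_less less_irrefl linorder_less_linear)
  have surj: "surj f"
  proof -
    have "\<exists>x. f x = y" for y
    proof -
      define r where "r = \<bar>y - f 0\<bar>"
      have "f (- r) \<le> y" "y \<le> f r" using lo[of "-r" 0] lo[of 0 r] unfolding r_def by auto
      then show ?thesis
        using IVT'[of f "-r" y r] cont continuous_on_subset unfolding r_def by force
    qed
    then show ?thesis by (metis surjI)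
  qed
  define g where "g = inv f"
  have fg: "f (g y) = y" "g (f x) = x" for x y
    using surj inj by (simp_all add: g_def surj_f_inv_f)
  have g_mono: "mono g" by (rule monoI) (metis fg(1) f_less not_le)
  have g_meas [measurable]: "g \<in> borel_measurable borel"
    by (rule borel_measurable_mono[OF g_mono])
  \<comment> \<open>The lower slope 1 makes \<open>f\<close> a bijection, and the image of Lebesgue
    measure under its inverse gives \<open>A\<close> the length of the image of \<open>A\<close>
    under \<open>f\<close>. Lipschitz maps keep null sets null, so this measure has a density; on an
    interval its integral is the increment of \<open>f\<close>.\<close>
  define \<nu> where "\<nu> = distr lborel borel g"
  have vimage: "g -` A = f ` A" for A using fg by (auto simp: image_iff) metis
  have emeasure_nu: "emeasure \<nu> A = emeasure lborel (f ` A)" if "A \<in> sets borel" for A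
    using that by (simp add: \<nu>_def emeasure_distr vimage)
  have ac: "absolutely_continuous lborel \<nu>"
    unfolding absolutely_continuous_def
  proof
    fix A :: "real set" assume A: "A \<in> null_sets lborel"
    then have "negligible A" using null_sets_completionI negligible_iff_null_sets by blast
    then have "negligible (f ` A)"
      by (rule negligible_locally_Lipschitz_image[rotated])
        (use lip in \<open>auto simp: dist_real_def intro!: exI[of _ UNIV] exI[of _ C]\<close>)
    moreover have "f ` A \<in> sets borel"
      using measurable_sets[OF g_meas, of A] A vimage by auto
    ultimately show "A \<in> null_sets \<nu>"
      using A emeasure_nu[of A] by (auto simp: \<nu>_def null_sets_def negligible_iff_null_sets)
  qed
  obtain v where v [measurable]: "v \<in> borel_measurable borel" and v_eq: "density lborel v = \<nu>"
    using sigma_finite_measure.Radon_Nikodym[OF sigma_finite_lborel ac] by (auto simp: \<nu>_def)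
  have img: "f ` {a..b} = {f a..f b}" if "a \<le> b" for a b
  proof (intro equalityI subsetI)
    fix y assume "y \<in> {f a..f b}"
    then have "g y \<in> {a..b}" using fg by (metis atLeastAtMost_iff f_less not_le)
    then show "y \<in> f ` {a..b}" using fg(1) by (metis imageI)
  next
    fix y assume "y \<in> f ` {a..b}" then show "y \<in> {f a..f b}" 
      by (auto simp: not_less[symmetric] f_less)
  qed
  have nn: "(\<integral>\<^sup>+x\<in>{a..b}. v x \<partial>lborel) = ennreal (f b - f a)" if "a \<le> b" for a b
  proof -
    have "(\<integral>\<^sup>+x\<in>{a..b}. v x \<partial>lborel) = emeasure \<nu> {a..b}"
      by (simp add: v_eq[symmetric] emeasure_density mult.commute)
    also have "\<dots> = ennreal (f b - f a)"
      using that img lo[of a b] by (simp add: emeasure_nu)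
    finally show ?thesis .
  qed
  have fin: "AE x in lborel. x \<in> {a..b} \<longrightarrow> v x \<noteq> \<infinity>" if "a \<le> b" for a b
  proof -
    have "AE x in lborel. v x * indicator {a..b} x \<noteq> \<infinity>"
      using nn[OF that] by (intro nn_integral_PInf_AE) (auto simp: mult.commute)
    then show ?thesis by eventually_elim (auto split: split_indicator_asm)
  qed
  show ?thesis
  proof
    fix a b :: real assume ab: "a \<le> b"
    show "((\<lambda>x. enn2real (v x)) has_integral (f b - f a)) {a..b}"
    proof -
      have "((\<lambda>x. enn2real (v x) * indicator {a..b} x) has_integral (f b - f a)) UNIV"
      proof (rule nn_integral_has_integral)
        have "(\<integral>\<^sup>+x. ennreal (enn2real (v x) * indicator {a..b} x) \<partial>lborel) = (\<integral>\<^sup>+x\<in>{a..b}. v x \<partial>lborel)"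
          by (rule nn_integral_cong_AE, use fin[OF ab] in eventually_elim)
            (auto split: split_indicator simp: less_top)
        then show "(\<integral>\<^sup>+x. ennreal (enn2real (v x) * indicator {a..b} x) \<partial>lborel) = ennreal (f b - f a)"
          using nn[OF ab] by simp
      qed (use ab lo[of a b] in auto)
      then show ?thesis
        by (subst has_integral_restrict_UNIV[symmetric]) 
          (simp add: indicator_def of_bool_def if_distrib cong: if_cong)
    qed
  qed
qed

text \<open>Lebesgue differentiation on intervals \<open>{x..x + h}\<close> yields the right
  derivative only. The left derivative of \<open>f\<close> at \<open>x\<close> is the right
  derivative at \<open>- x\<close> of the reflected function \<open>- f (- x)\<close>, which is an
  indefinite integral of \<open>v (- x)\<close>.\<close>

lemma has_real_derivative_indefinite_integral_AE:
  fixes f v :: "real \<Rightarrow> real"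
  assumes v: "\<And>a b. a \<le> b \<Longrightarrow> (v has_integral (f b - f a)) {a..b}"
  obtains N where "negligible N" "\<And>x. x \<notin> N \<Longrightarrow> (f has_real_derivative v x) (at x)"
proof -
  have right: "\<exists>N. negligible N \<and> (\<forall>x. x \<notin> N \<longrightarrow> ((\<lambda>h. (f (x + h) - f x) / h) \<longlongrightarrow> v x) (at_right 0))"
    if v: "\<And>a b. a \<le> b \<Longrightarrow> (v has_integral (f b - f a)) {a..b}" for f v :: "real \<Rightarrow> real"
  proof -
    have "v integrable_on cbox a b" for a b
      using v[of a b] by (cases "a \<le> b") (auto simp: integrable_on_def)
    then obtain N where N: "negligible N" and 
      e: "\<And>x e. \<lbrakk>x \<notin> N; 0 < e\<rbrakk> \<Longrightarrow> \<exists>d>0. \<forall>h. 0 < h \<and> h < d \<longrightarrow>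
          norm (integral (cbox x (x + h *\<^sub>R One)) v /\<^sub>R h ^ DIM(real) - v x) < e"
      by (rule integrable_ccontinuous_explicit) blast
    show ?thesis
    proof (intro exI[of _ N] conjI allI impI N tendstoI)
      fix x and e :: real assume "x \<notin> N" "0 < e"
      then obtain d where "d > 0" and d: "\<And>h. 0 < h \<Longrightarrow> h < d \<Longrightarrow> \<bar>integral {x..x + h} v / h - v x\<bar> < e"
        using e[of x e] by (auto simp: divide_inverse mult.commute)
      have "\<bar>(f (x + h) - f x) / h - v x\<bar> < e" if "0 < h" "h < d" for h
        using d[OF that] integral_unique[OF v[of x "x+h"]] that by simp
      then show "\<forall>\<^sub>F h in at_right 0. dist ((f (x + h) - f x) / h) (v x) < e"
        using \<open>d > 0\<close> by (auto simp: eventually_at_right_field dist_real_def)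
    qed
  qed
  obtain N1 where N1: "negligible N1"
    "\<And>x. x \<notin> N1 \<Longrightarrow> ((\<lambda>h. (f (x + h) - f x) / h) \<longlongrightarrow> v x) (at_right 0)"
    using right[OF v] by blast
  have v': "((\<lambda>x. v (- x)) has_integral (- f (- b) - (- f (- a)))) {a..b}" if "a \<le> b" for a b
    using v[of "-b" "-a"] that has_integral_reflect_lemma_real[of v "f (-a) - f (-b)" "-b" "-a"] by simp
  obtain N2 where N2: "negligible N2"
    "\<And>x. x \<notin> N2 \<Longrightarrow> ((\<lambda>h. (- f (- (x + h)) - - f (- x)) / h) \<longlongrightarrow> v (- x)) (at_right 0)"
    using right[OF v'] by blast
  show ?thesis
  proof
    show "negligible (N1 \<union> uminus ` N2)"
      by (intro negligible_Un N1(1) negligible_differentiable_image_negligible N2(1))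
        (auto intro!: derivative_intros)
  next
    fix x assume x: "x \<notin> N1 \<union> uminus ` N2"
    then have "- x \<notin> N2" by (metis UnI2 imageI minus_minus)
    from N2(2)[OF this] have "((\<lambda>h. (f (x + h) - f x) / h) \<longlongrightarrow> v x) (at_left 0)"
      by (subst at_left_minus, simp add: filterlim_filtermap field_simps)
        (simp add: diff_divide_distrib minus_divide_left del: minus_divide_left[symmetric])
    with N1(2) x show "(f has_real_derivative v x) (at x)"
      unfolding DERIV_def by (metis UnI1 filterlim_split_at)
  qed
qed

text \<open>Rademacher's theorem on the line. Adding \<open>(C + 1) * x\<close> moves all slopes
  into the range from 1 to \<open>2 * C + 1\<close> and does not affect differentiability.\<close>

lemma lipschitz_real_differentiable_AE:
  fixes f :: "real \<Rightarrow> real"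
  assumes f: "C-lipschitz_on UNIV f"
  shows "negligible {x. \<not> f differentiable (at x)}"
proof -
  have C: "\<bar>f y - f x\<bar> \<le> C * \<bar>y - x\<bar>" for x y
    using lipschitz_onD[OF f, of y x] by (simp add: dist_real_def)
  define g where "g x = f x + (C + 1) * x" for x
  have lo: "y - x \<le> g y - g x" and up: "g y - g x \<le> (2 * C + 1) * (y - x)" if "x \<le> y" for x y
    using C[of y x] that by (auto simp: g_def algebra_simps)
  obtain v where v: "\<And>a b. a \<le> b \<Longrightarrow> (v has_integral (g b - g a)) {a..b}"
    using bilipschitz_indefinite_integral[OF lo up] by blast
  obtain N where N: "negligible N" "\<And>x. x \<notin> N \<Longrightarrow> (g has_real_derivative v x) (at x)"
    using has_real_derivative_indefinite_integral_AE[OF v] by blast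
  have "f differentiable (at x)" if "x \<notin> N" for x
  proof -
    have "((\<lambda>x. g x - (C + 1) * x) has_real_derivative v x - (C + 1)) (at x)"
      by (auto intro!: derivative_eq_intros N(2) that)
    then show ?thesis
      by (auto simp: g_def real_differentiable_def)
  qed
  then show ?thesis by (intro negligible_subset[OF N(1)]) auto
qed

subsection \<open>Translations\<close>

lemma nn_integral_lborel_translate:
  fixes f :: "'a::euclidean_space \<Rightarrow> ennreal"
  assumes [measurable]: "f \<in> borel_measurable borel"
  shows "(\<integral>\<^sup>+x. f (x + c) \<partial>lborel) = (\<integral>\<^sup>+x. f x \<partial>lborel)"
  by (subst (2) lborel_distr_plus[of c, symmetric], subst nn_integral_distr) (simp_all add: add.commute)

lemma integral_lborel_translate:
  fixes f :: "'a::euclidean_space \<Rightarrow> 'b::{banach, second_countable_topology}"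
  assumes [measurable]: "f \<in> borel_measurable borel"
  shows "(\<integral>x. f (x + c) \<partial>lborel) = (\<integral>x. f x \<partial>lborel)"
  by (subst (2) lborel_distr_plus[of c, symmetric], subst integral_distr) (simp_all add: add.commute)

lemma integrable_lborel_translate:
  fixes f :: "'a::euclidean_space \<Rightarrow> 'b::{banach, second_countable_topology}"
  assumes f: "integrable lborel f"
  shows "integrable lborel (\<lambda>x. f (x + c))"
proof -
  have [measurable]: "f \<in> borel_measurable borel" using borel_measurable_integrable[OF f] by simp
  have "integrable (distr lborel borel ((+) c)) f" using f by (simp add: lborel_distr_plus)
  then show ?thesis by (simp add: integrable_distr_eq add.commute)
qed

lemma AE_lborel_translate:
  fixes c :: "'a::euclidean_space"
  assumes "AE x in lborel. P x"
  shows "AE x in lborel. P (x + c)"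
proof -
  have "AE x in distr lborel borel ((+) c). P x" by (subst lborel_distr_plus) (rule assms)
  from AE_distrD[OF _ this] show ?thesis by (simp add: add.commute)
qed

lemma integrable_bounded_support:
  fixes f :: "'a::euclidean_space \<Rightarrow> real"
  assumes [measurable]: "f \<in> borel_measurable borel" and K: "AE x in lborel. \<bar>f x\<bar> \<le> K"
    and S: "bounded S" "\<And>x. x \<notin> S \<Longrightarrow> f x = 0"
  shows "integrable lborel f"
proof -
  obtain R where R: "S \<subseteq> cball 0 R" using S(1) by (metis bounded_iff mem_cball_0 subsetI)
  show ?thesis
  proof (rule Bochner_Integration.integrable_bound)
    show "integrable lborel (\<lambda>x::'a. K * indicator (cball 0 R) x :: real)"
      using emeasure_bounded_finite[OF bounded_cball, of "0::'a" R]
      by (intro integrable_mult_right integrable_real_indicator) (auto simp: infinity_ennreal_def)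
    show "AE x in lborel. norm (f x) \<le> norm (K * indicator (cball 0 R) x)"
      using K by eventually_elim (use S(2) R in \<open>fastforce split: split_indicator\<close>)
  qed simp
qed

lemma AE_lborel_continuous_zero:
  fixes f :: "'a::euclidean_space \<Rightarrow> real"
  assumes f: "continuous_on UNIV f" and AE: "AE x in lborel. f x = 0"
  shows "f x = 0"
proof (rule ccontr)
  assume x: "f x \<noteq> 0"
  have op: "open {x. f x \<noteq> 0}" using f by (intro open_Collect_neq) auto
  have "AE x in lebesgue. x \<notin> {x. f x \<noteq> 0}" using AE_completion[OF AE] by auto
  then have "negligible {x. f x \<noteq> 0}"
    using op by (subst negligible_iff_null_sets) (simp add: AE_iff_null_sets lborelD)
  then show False using open_not_negligible[OF op] x by auto
qed

subsection \<open>Derivatives along lines\<close>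

text \<open>The quantifier over rational increments makes the exceptional set Borel.\<close>

lemma line_differentiable_iff_rational_cauchy:
  fixes w :: "'a::real_normed_vector \<Rightarrow> real" and e :: 'a
  assumes w: "continuous_on UNIV w"
  defines "q \<equiv> \<lambda>x s. (w (x + s *\<^sub>R e) - w x) / s"
  shows "(\<exists>D. ((\<lambda>t. w (x + t *\<^sub>R e)) has_real_derivative D) (at 0)) \<longleftrightarrow>
    (\<forall>n::nat. \<exists>m::nat. \<forall>s t::rat. s \<noteq> 0 \<and> t \<noteq> 0 \<and> \<bar>real_of_rat s\<bar> < 1 / Suc m \<and> \<bar>real_of_rat t\<bar> < 1 / Suc m \<longrightarrow>
        \<bar>q x (real_of_rat s) - q x (real_of_rat t)\<bar> \<le> 1 / Suc n)" (is "?L \<longleftrightarrow> ?R")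
proof
  assume ?L
  then obtain D where D: "((\<lambda>s. q x s) \<longlongrightarrow> D) (at 0)" by (auto simp: DERIV_def q_def)
  show ?R
  proof
    fix n :: nat
    obtain d where d: "d > 0" "\<And>s. s \<noteq> 0 \<Longrightarrow> \<bar>s\<bar> < d \<Longrightarrow> \<bar>q x s - D\<bar> < 1 / (2 * real (Suc n))"
      using tendstoD[OF D, of "1 / (2 * real (Suc n))"] by (auto simp: eventually_at dist_real_def)
    obtain m where m: "1 / Suc m < d" using d(1) nat_approx_posE by blast
    have "\<bar>q x s - q x t\<bar> \<le> 1 / Suc n" if "s \<noteq> 0" "t \<noteq> 0" "\<bar>s\<bar> < 1 / Suc m" "\<bar>t\<bar> < 1 / Suc m" for s t
    proof -
      define r where "r = 1 / (2 * real (Suc n))"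
      have "\<bar>q x s - D\<bar> < r" "\<bar>q x t - D\<bar> < r"
        using d(2) that m by (auto simp: r_def)
      then have "\<bar>q x s - q x t\<bar> \<le> r + r" by linarith
      also have "r + r = 1 / Suc n" by (simp add: r_def field_simps)
      finally show ?thesis .
    qed
    then show "\<exists>m. \<forall>s t. s \<noteq> 0 \<and> t \<noteq> 0 \<and> \<bar>real_of_rat s\<bar> < 1 / Suc m \<and> \<bar>real_of_rat t\<bar> < 1 / Suc m \<longrightarrow>
        \<bar>q x (real_of_rat s) - q x (real_of_rat t)\<bar> \<le> 1 / Suc n"
      by (intro exI[of _ m]) auto
  qed
next
  assume R: ?R
  have cont: "isCont (q x) s" if "s \<noteq> 0" for s
  proof -
    have "continuous_on UNIV (\<lambda>s. w (x + s *\<^sub>R e))"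
      by (rule continuous_on_compose2[OF w]) (auto intro!: continuous_intros)
    then show ?thesis unfolding q_def using that
      by (auto intro!: continuous_intros simp: continuous_on_eq_continuous_at)
  qed
  \<comment> \<open>Off zero the quotient is continuous in the increment, so the Cauchy condition
    passes from rational to real increments by approximation within the punctured interval.\<close>
  have rat: "\<exists>r. (\<forall>k. real_of_rat (r k) \<noteq> 0 \<and> \<bar>real_of_rat (r k)\<bar> < d) \<and> (\<lambda>k. real_of_rat (r k)) \<longlonglongrightarrow> s"
    if "s \<noteq> 0" "\<bar>s\<bar> < d" for s d :: real
  proof -
    have "open ({-d<..<d} - {0})" by (intro open_Diff) auto
    then have "({-d<..<d} - {0}) \<inter> closure \<rat> \<subseteq> closure (({-d<..<d} - {0}) \<inter> \<rat>)"
      by (rule open_Int_closure_subset)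
    then have "s \<in> closure (({-d<..<d} - {0}) \<inter> \<rat>)" using that by (auto simp: Rats_closure_real abs_less_iff)
    then obtain z where z: "\<forall>k. z k \<in> ({-d<..<d} - {0}) \<inter> \<rat>" "z \<longlonglongrightarrow> s"
      unfolding closure_sequential by blast
    then have "\<forall>k. \<exists>y. z k = real_of_rat y" by (auto simp: Rats_def)
    then obtain r where r: "\<forall>k. z k = real_of_rat (r k)" by metis
    have "real_of_rat (r k) \<noteq> 0 \<and> \<bar>real_of_rat (r k)\<bar> < d" for k
      proof -
      have "- d < z k \<and> z k < d \<and> z k \<noteq> 0" using z(1) by auto
      then have "z k \<noteq> 0 \<and> \<bar>z k\<bar> < d" by (auto simp: abs_real_def)
      then show ?thesis using r by simp
    qed
    moreover have "(\<lambda>k. real_of_rat (r k)) \<longlonglongrightarrow> s" using z(2) r by (simp add: fun_eq_iff[symmetric])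
    ultimately show ?thesis by blast
  qed
  have R': "\<exists>m. \<forall>s t. s \<noteq> 0 \<and> t \<noteq> 0 \<and> \<bar>s\<bar> < 1 / Suc m \<and> \<bar>t\<bar> < 1 / Suc m \<longrightarrow>
        \<bar>q x s - q x t\<bar> \<le> 1 / Suc n" for n
  proof -
    obtain m where m: "\<And>s t. s \<noteq> 0 \<Longrightarrow> t \<noteq> 0 \<Longrightarrow> \<bar>real_of_rat s\<bar> < 1 / Suc m \<Longrightarrow> \<bar>real_of_rat t\<bar> < 1 / Suc m \<Longrightarrow>
        \<bar>q x (real_of_rat s) - q x (real_of_rat t)\<bar> \<le> 1 / Suc n" using R by blast
    have "\<bar>q x s - q x t\<bar> \<le> 1 / Suc n" if st: "s \<noteq> 0" "t \<noteq> 0" "\<bar>s\<bar> < 1 / Suc m" "\<bar>t\<bar> < 1 / Suc m" for s t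
    proof -
      obtain r where r: "\<And>k. real_of_rat (r k) \<noteq> 0" "\<And>k. \<bar>real_of_rat (r k)\<bar> < 1 / Suc m" "(\<lambda>k. real_of_rat (r k)) \<longlonglongrightarrow> s"
        using rat[OF st(1,3)] by blast
      obtain r' where r': "\<And>k. real_of_rat (r' k) \<noteq> 0" "\<And>k. \<bar>real_of_rat (r' k)\<bar> < 1 / Suc m" "(\<lambda>k. real_of_rat (r' k)) \<longlonglongrightarrow> t"
        using rat[OF st(2,4)] by blast
      have "(\<lambda>k. \<bar>q x (real_of_rat (r k)) - q x (real_of_rat (r' k))\<bar>) \<longlonglongrightarrow> \<bar>q x s - q x t\<bar>"
        by (intro tendsto_intros isCont_tendsto_compose[OF cont] r r' st)
      then show ?thesis
        by (rule LIMSEQ_le_const2) (use m r r' in auto)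
    qed
    then show ?thesis by blast
  qed
  have "Cauchy (\<lambda>k. q x (1 / Suc k))"
  proof (rule metric_CauchyI)
    fix \<epsilon> :: real assume "\<epsilon> > 0"
    then obtain n where n: "1 / Suc n < \<epsilon>" using nat_approx_posE by blast
    obtain m where m: "\<And>s t. s \<noteq> 0 \<Longrightarrow> t \<noteq> 0 \<Longrightarrow> \<bar>s\<bar> < 1 / Suc m \<Longrightarrow> \<bar>t\<bar> < 1 / Suc m \<Longrightarrow>
        \<bar>q x s - q x t\<bar> \<le> 1 / Suc n" using R' by blast
    show "\<exists>M. \<forall>k\<ge>M. \<forall>l\<ge>M. dist (q x (1 / Suc k)) (q x (1 / Suc l)) < \<epsilon>"
    proof (intro exI[of _ "Suc m"] allI impI)
      fix k l assume "k \<ge> Suc m" "l \<ge> Suc m"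
      then have "\<bar>q x (1 / Suc k) - q x (1 / Suc l)\<bar> \<le> 1 / Suc n"
        by (intro m) (auto simp: field_simps)
      then show "dist (q x (1 / Suc k)) (q x (1 / Suc l)) < \<epsilon>" using n by (simp add: dist_real_def)
    qed
  qed
  then obtain D where D: "(\<lambda>k. q x (1 / Suc k)) \<longlonglongrightarrow> D" using Cauchy_convergent convergent_def by blast
  have "((\<lambda>s. q x s) \<longlongrightarrow> D) (at 0)"
  proof (rule tendstoI)
    fix \<epsilon> :: real assume "\<epsilon> > 0"
    then obtain n where n: "1 / Suc n < \<epsilon>" using nat_approx_posE by blast
    obtain m where m: "\<And>s t. s \<noteq> 0 \<Longrightarrow> t \<noteq> 0 \<Longrightarrow> \<bar>s\<bar> < 1 / Suc m \<Longrightarrow> \<bar>t\<bar> < 1 / Suc m \<Longrightarrow>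
        \<bar>q x s - q x t\<bar> \<le> 1 / Suc n" using R' by blast
    have "\<bar>q x s - D\<bar> \<le> 1 / Suc n" if "s \<noteq> 0" "\<bar>s\<bar> < 1 / Suc m" for s
    proof (rule LIMSEQ_le_const2)
      show "(\<lambda>k. \<bar>q x s - q x (1 / Suc k)\<bar>) \<longlonglongrightarrow> \<bar>q x s - D\<bar>" by (intro tendsto_intros D)
      show "\<exists>N. \<forall>k\<ge>N. \<bar>q x s - q x (1 / Suc k)\<bar> \<le> 1 / Suc n"
        by (intro exI[of _ "Suc m"] allI impI m that) (auto simp: field_simps)
    qed
    then have "\<forall>s\<in>UNIV. s \<noteq> 0 \<and> dist s 0 < 1 / real (Suc m) \<longrightarrow> dist (q x s) D < \<epsilon>"
      using n by (fastforce simp: dist_real_def)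
    moreover have "1 / real (Suc m) > 0" by simp
    ultimately show "\<forall>\<^sub>F s in at 0. dist (q x s) D < \<epsilon>"
      unfolding eventually_at by blast
  qed
  then show ?L by (auto simp: DERIV_def q_def)
qed

text \<open>Every line in direction \<open>e\<close> meets the exceptional set in a null set of
  parameters. The measure of that set is the average over \<open>t\<close> in \<open>{0..1}\<close>
  of the measures of its translates; by Fubini this average is an integral of such null sections. No
  case distinction on \<open>e\<close> arises, since it is never completed to a basis.\<close>

lemma lipschitz_line_differentiable_AE:
  fixes w :: "'a::euclidean_space \<Rightarrow> real"
  assumes w: "C-lipschitz_on UNIV w"
  shows "AE x in lborel. \<exists>D. ((\<lambda>t. w (x + t *\<^sub>R e)) has_real_derivative D) (at 0)"
proof -
  define P where "P x \<longleftrightarrow> (\<exists>D. ((\<lambda>t. w (x + t *\<^sub>R e)) has_real_derivative D) (at 0))" for x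
  have cont: "continuous_on UNIV w" using w lipschitz_on_continuous_on by blast
  then have [measurable]: "w \<in> borel_measurable borel" by (rule borel_measurable_continuous_onI)
  have meas: "{x. \<not> P x} \<in> sets borel"
    unfolding P_def line_differentiable_iff_rational_cauchy[OF cont] by measurable
  let ?B = "{x. \<not> P x}"
  have [measurable]: "(\<lambda>(x, t::real). indicator ?B (x + t *\<^sub>R e) :: ennreal) \<in> borel_measurable (lborel \<Otimes>\<^sub>M lborel)"
  proof -
    have "(\<lambda>p. fst p + snd p *\<^sub>R e) \<in> borel_measurable (lborel \<Otimes>\<^sub>M (lborel :: real measure))"
      by measurable
    from measurable_compose[OF this borel_measurable_indicator[OF meas]]
    show ?thesis by (simp add: split_beta')
  qed
  have line: "AE t in lborel. x + t *\<^sub>R e \<notin> ?B" for x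
  proof -
    have "(C * norm e)-lipschitz_on UNIV (\<lambda>t. w (x + t *\<^sub>R e))"
    proof (rule lipschitz_onI)
      fix s t :: real
      have "dist (w (x + s *\<^sub>R e)) (w (x + t *\<^sub>R e)) \<le> C * dist (x + s *\<^sub>R e) (x + t *\<^sub>R e)"
        by (rule lipschitz_onD[OF w]) auto
      also have "dist (x + s *\<^sub>R e) (x + t *\<^sub>R e) = norm e * dist s t"
        by (simp add: dist_norm scaleR_diff_left[symmetric])
      finally show "dist (w (x + s *\<^sub>R e)) (w (x + t *\<^sub>R e)) \<le> C * norm e * dist s t" by (simp add: mult.assoc)
    qed (use lipschitz_on_nonneg[OF w] in simp)
    from lipschitz_real_differentiable_AE[OF this]
    have "{t. \<not> (\<lambda>t. w (x + t *\<^sub>R e)) differentiable (at t)} \<in> null_sets lebesgue"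
      by (simp add: negligible_iff_null_sets)
    moreover have "P (x + t *\<^sub>R e)" if dif: "(\<lambda>t. w (x + t *\<^sub>R e)) differentiable (at t)" for t
    proof -
      obtain D where "((\<lambda>t. w (x + t *\<^sub>R e)) has_real_derivative D) (at t)"
        using dif real_differentiable_def by blast
      then have "((\<lambda>s. w (x + (s + t) *\<^sub>R e)) has_real_derivative D) (at 0)"
        using DERIV_shift[of "\<lambda>t. w (x + t *\<^sub>R e)" D 0 t] by simp
      then show ?thesis by (auto simp: P_def algebra_simps)
    qed
    ultimately have "AE t in lebesgue. t \<notin> {t. x + t *\<^sub>R e \<in> ?B}"
      by (intro AE_I'[where N = "{t. \<not> (\<lambda>t. w (x + t *\<^sub>R e)) differentiable (at t)}"]) auto
    then have "AE t in lebesgue. P (x + t *\<^sub>R e)" by simp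
    moreover have "Measurable.pred lborel (\<lambda>t. P (x + t *\<^sub>R e))"
    proof -
      have "(\<lambda>t::real. x + t *\<^sub>R e) -` ?B \<inter> space borel \<in> sets borel"
        by (rule measurable_sets[OF _ meas]) measurable
      then have "UNIV - {t. \<not> P (x + t *\<^sub>R e)} \<in> sets borel"
        by (intro sets.Diff) (auto simp: vimage_def)
      moreover have "UNIV - {t. \<not> P (x + t *\<^sub>R e)} = {t. P (x + t *\<^sub>R e)}" by blast
      ultimately show ?thesis by (simp add: pred_def)
    qed
    ultimately show ?thesis by (subst (asm) AE_completion_iff) (auto simp: pred_def)
  qed
  have "emeasure lborel ?B = (\<integral>\<^sup>+t. indicator {0..1} t * emeasure lborel ?B \<partial>(lborel :: real measure))"
    by (simp add: nn_integral_multc)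
  also have "\<dots> = (\<integral>\<^sup>+t. (\<integral>\<^sup>+x. indicator {0..1} t * indicator ?B (x + t *\<^sub>R e) \<partial>lborel) \<partial>lborel)"
  proof (rule nn_integral_cong)
    fix t :: real
    have "emeasure lborel ?B = (\<integral>\<^sup>+x. indicator ?B (x + t *\<^sub>R e) \<partial>lborel)"
      using meas by (subst nn_integral_lborel_translate) auto
    moreover have "(\<lambda>x. indicator ?B (x + t *\<^sub>R e) :: ennreal) \<in> borel_measurable lborel"
      using meas by measurable
    ultimately show "indicator {0..1} t * emeasure lborel ?B = (\<integral>\<^sup>+x. indicator {0..1} t * indicator ?B (x + t *\<^sub>R e) \<partial>lborel)"
      by (simp add: nn_integral_cmult)
  qed
  also have "\<dots> = (\<integral>\<^sup>+x. (\<integral>\<^sup>+t. indicator {0..1} t * indicator ?B (x + t *\<^sub>R e) \<partial>lborel) \<partial>lborel)"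
    by (rule lborel_pair.Fubini') (auto simp: split_beta')
  also have "\<dots> = (\<integral>\<^sup>+(x::'a). 0 \<partial>lborel)"
  proof (rule nn_integral_cong)
    fix x
    have "AE t in lborel. indicator {0..1} t * indicator ?B (x + t *\<^sub>R e) = (0 :: ennreal)"
      using line[of x] by (rule eventually_mono) (simp add: indicator_def)
    then have "(\<integral>\<^sup>+t. indicator {0..1} t * indicator ?B (x + t *\<^sub>R e) \<partial>lborel) = (\<integral>\<^sup>+(t::real). 0 \<partial>lborel)"
      by (rule nn_integral_cong_AE)
    then show "(\<integral>\<^sup>+t. indicator {0..1} t * indicator ?B (x + t *\<^sub>R e) \<partial>lborel) = 0"
      by simp
  qed
  finally have "emeasure lborel ?B = 0" by simp
  then show ?thesis
    using meas by (intro AE_I[where N = ?B]) (auto simp: P_def)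
qed

definition line_deriv :: "'m::finite \<Rightarrow> (real^'m \<Rightarrow> real) \<Rightarrow> real^'m \<Rightarrow> real \<Rightarrow> bool" where
  "line_deriv i w x D \<longleftrightarrow> ((\<lambda>t. w (x + t *\<^sub>R axis i 1)) has_real_derivative D) (at 0)"

text \<open>Being a limit along a fixed sequence, this version of the partial derivative is Borel
  measurable for every continuous function; it has a meaning only where \<^const>\<open>line_deriv\<close> holds.\<close>

definition pd :: "'m::finite \<Rightarrow> (real^'m \<Rightarrow> real) \<Rightarrow> real^'m \<Rightarrow> real" where
  "pd i w x = lim (\<lambda>n. (w (x + (1 / real (Suc n)) *\<^sub>R axis i 1) - w x) / (1 / real (Suc n)))"

lemma line_deriv_sequentially:
  assumes D: "line_deriv i w x D" and s: "s \<longlonglongrightarrow> 0" "\<And>n. s n \<noteq> 0"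
  shows "(\<lambda>n. (w (x + s n *\<^sub>R axis i 1) - w x) / s n) \<longlonglongrightarrow> D"
proof -
  have "((\<lambda>h. (w (x + h *\<^sub>R axis i 1) - w x) / h) \<longlongrightarrow> D) (at 0)"
    using D by (simp add: line_deriv_def DERIV_def)
  moreover have "filterlim s (at 0) sequentially"
    using s by (auto intro!: filterlim_atI always_eventually)
  ultimately show ?thesis by (rule filterlim_compose)
qed

lemma pd_eq: "line_deriv i w x D \<Longrightarrow> pd i w x = D"
  unfolding pd_def
  by (intro limI line_deriv_sequentially[of i w x D "\<lambda>n. 1 / real (Suc n)"] LIMSEQ_inverse_real_of_nat[unfolded inverse_eq_divide]) auto

lemma line_deriv_const: "line_deriv i (\<lambda>x. c) x 0"
  by (simp add: line_deriv_def)

lemma line_deriv_add: "line_deriv i u x D \<Longrightarrow> line_deriv i v x E \<Longrightarrow> line_deriv i (\<lambda>x. u x + v x) x (D + E)"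
  unfolding line_deriv_def by (rule DERIV_add)

lemma line_deriv_diff: "line_deriv i u x D \<Longrightarrow> line_deriv i v x E \<Longrightarrow> line_deriv i (\<lambda>x. u x - v x) x (D - E)"
  unfolding line_deriv_def by (rule DERIV_diff)

lemma line_deriv_uminus: "line_deriv i u x D \<Longrightarrow> line_deriv i (\<lambda>x. - u x) x (- D)"
  unfolding line_deriv_def by (rule DERIV_minus)

lemma line_deriv_cmult: "line_deriv i u x D \<Longrightarrow> line_deriv i (\<lambda>x. c * u x) x (c * D)"
  unfolding line_deriv_def by (rule DERIV_cmult)

lemma line_deriv_mult:
  "line_deriv i u x D \<Longrightarrow> line_deriv i v x E \<Longrightarrow> line_deriv i (\<lambda>x. u x * v x) x (D * v x + E * u x)"
  unfolding line_deriv_def by (drule (1) DERIV_mult) simp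

lemma line_deriv_translate: "line_deriv i (\<lambda>x. u (x + h)) x D \<longleftrightarrow> line_deriv i u (x + h) D"
  by (simp add: line_deriv_def algebra_simps)

lemma line_deriv_transfer:
  assumes "line_deriv i u x D" "open U" "x \<in> U" "\<And>y. y \<in> U \<Longrightarrow> u y = v y"
  shows "line_deriv i v x D"
proof -
  have "open ((\<lambda>t::real. x + t *\<^sub>R axis i 1) -` U)"
    by (intro open_vimage assms continuous_intros)
  then show ?thesis
    using assms unfolding line_deriv_def
    by (elim has_field_derivative_transform_within_open[of _ _ _ "(\<lambda>t. x + t *\<^sub>R axis i 1) -` U"]) auto
qed

lemma line_deriv_zero_at_min:
  assumes "line_deriv i u x D" "u x = 0" "\<And>y. u y \<ge> 0"
  shows "D = 0"
  using assms by (intro DERIV_local_min[of "\<lambda>t. u (x + t *\<^sub>R axis i 1)" D 0 1]) (auto simp: line_deriv_def)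

lemma line_deriv_abs_le:
  assumes D: "line_deriv i w x D" and C: "\<And>x y. \<bar>w x - w y\<bar> \<le> C * norm (x - y)"
  shows "\<bar>D\<bar> \<le> C"
proof (rule LIMSEQ_le_const2)
  show "(\<lambda>n. \<bar>(w (x + (1 / real (Suc n)) *\<^sub>R axis i 1) - w x) / (1 / real (Suc n))\<bar>) \<longlonglongrightarrow> \<bar>D\<bar>"
    by (intro tendsto_rabs line_deriv_sequentially[OF D] LIMSEQ_inverse_real_of_nat[unfolded inverse_eq_divide]) auto
  show "\<exists>N. \<forall>n\<ge>N. \<bar>(w (x + (1 / real (Suc n)) *\<^sub>R axis i 1) - w x) / (1 / real (Suc n))\<bar> \<le> C"
  proof (intro exI allI impI)
    fix n :: nat
    have "\<bar>w (x + (1 / real (Suc n)) *\<^sub>R axis i 1) - w x\<bar> \<le> C * (1 / real (Suc n))"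
      using C[of "x + (1 / real (Suc n)) *\<^sub>R axis i 1" x] by (simp add: norm_axis_1)
    then show "\<bar>(w (x + (1 / real (Suc n)) *\<^sub>R axis i 1) - w x) / (1 / real (Suc n))\<bar> \<le> C"
      unfolding abs_divide by (subst divide_le_eq) (simp del: of_nat_Suc)
  qed
qed

subsection \<open>Lipschitz functions on the whole space\<close>

definition Lip :: "('a::real_normed_vector \<Rightarrow> real) \<Rightarrow> bool" where
  "Lip w \<longleftrightarrow> (\<exists>C\<ge>0. \<forall>x y. \<bar>w x - w y\<bar> \<le> C * norm (x - y))"

lemma LipE:
  assumes "Lip w" obtains C where "C \<ge> 0" "\<And>x y. \<bar>w x - w y\<bar> \<le> C * norm (x - y)"
  using assms by (auto simp: Lip_def)

lemma LipI:
  assumes "\<And>x y. \<bar>w x - w y\<bar> \<le> C * norm (x - y)"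
  shows "Lip w"
  unfolding Lip_def
  by (rule exI[of _ "max C 0"]) (auto intro: order_trans[OF assms mult_right_mono])

lemma Lip_lipschitz_on: "Lip w \<longleftrightarrow> (\<exists>C. C-lipschitz_on UNIV w)"
  unfolding Lip_def lipschitz_on_def by (auto simp: dist_norm)

lemma Lip_continuous: "Lip w \<Longrightarrow> continuous_on UNIV w"
  using lipschitz_on_continuous_on by (auto simp: Lip_lipschitz_on)

lemma Lip_measurable: "Lip w \<Longrightarrow> w \<in> borel_measurable borel"
  by (intro borel_measurable_continuous_onI Lip_continuous)

lemma Lip_const: "Lip (\<lambda>x. c)" by (rule LipI[of _ 0]) simp

lemma Lip_add:
  assumes "Lip u" "Lip v" shows "Lip (\<lambda>x. u x + v x)"
proof -
  obtain C D where *: "\<And>x y. \<bar>u x - u y\<bar> \<le> C * norm (x - y)" "\<And>x y. \<bar>v x - v y\<bar> \<le> D * norm (x - y)"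
    using assms by (metis LipE)
  show ?thesis
  proof (rule LipI[of _ "C + D"])
    fix x y
    show "\<bar>u x + v x - (u y + v y)\<bar> \<le> (C + D) * norm (x - y)"
      using *(1)[of x y] *(2)[of x y] unfolding distrib_right by linarith
  qed
qed

lemma Lip_cmult:
  assumes "Lip u" shows "Lip (\<lambda>x. c * u x)"
proof -
  obtain C where *: "\<And>x y. \<bar>u x - u y\<bar> \<le> C * norm (x - y)"
    using assms by (metis LipE)
  show ?thesis
  proof (rule LipI[of _ "\<bar>c\<bar> * C"])
    fix x y
    show "\<bar>c * u x - c * u y\<bar> \<le> \<bar>c\<bar> * C * norm (x - y)"
      using mult_left_mono[OF *[of x y], of "\<bar>c\<bar>"]
      by (simp add: abs_mult[symmetric] right_diff_distrib mult.assoc)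
  qed
qed

lemma Lip_uminus: "Lip u \<Longrightarrow> Lip (\<lambda>x. - u x)"
  using Lip_cmult[of u "-1"] by simp

lemma Lip_diff: "Lip u \<Longrightarrow> Lip v \<Longrightarrow> Lip (\<lambda>x. u x - v x)"
  using Lip_add[of u "\<lambda>x. - v x"] Lip_uminus[of v] by simp

lemma Lip_translate: "Lip u \<Longrightarrow> Lip (\<lambda>x. u (x + h))"
proof -
  assume "Lip u"
  then obtain C where C: "\<And>x y. \<bar>u x - u y\<bar> \<le> C * norm (x - y)" by (metis LipE)
  show ?thesis by (rule LipI[of _ C]) (use C[of "x + h" "y + h" for x y] in simp)
qed

lemma Lip_mult:
  assumes "Lip u" "Lip v" and B: "\<And>x. \<bar>u x\<bar> \<le> B" "\<And>x. \<bar>v x\<bar> \<le> B'" shows "Lip (\<lambda>x. u x * v x)"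
proof -
  obtain C D where C: "\<And>x y. \<bar>u x - u y\<bar> \<le> C * norm (x - y)" and D: "\<And>x y. \<bar>v x - v y\<bar> \<le> D * norm (x - y)"
    using assms by (metis LipE)
  show ?thesis
  proof (rule LipI[of _ "C * B' + B * D"])
    fix x y
    have "\<bar>u x * v x - u y * v y\<bar> = \<bar>(u x - u y) * v x + u y * (v x - v y)\<bar>" by (simp add: algebra_simps)
    also have "\<dots> \<le> \<bar>u x - u y\<bar> * \<bar>v x\<bar> + \<bar>u y\<bar> * \<bar>v x - v y\<bar>"
      using abs_triangle_ineq by (simp add: abs_mult[symmetric])
    also have "\<dots> \<le> C * norm (x - y) * B' + B * (D * norm (x - y))"
      using B[of x] B[of y] C[of x y] D[of x y] by (intro add_mono mult_mono) auto
    finally show "\<bar>u x * v x - u y * v y\<bar> \<le> (C * B' + B * D) * norm (x - y)" by (simp add: algebra_simps)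
  qed
qed

text \<open>Meant for functions given by a formula in an open set and by zero elsewhere. The second
  hypothesis, linear decay towards every point of the complement, takes the place of continuity
  across the boundary.\<close>

lemma Lip_extend_zero:
  fixes w :: "'a::real_normed_vector \<Rightarrow> real"
  assumes U: "\<And>x y. x \<in> U \<Longrightarrow> y \<in> U \<Longrightarrow> \<bar>w x - w y\<bar> \<le> C * norm (x - y)"
    and b: "\<And>x y. x \<in> U \<Longrightarrow> y \<notin> U \<Longrightarrow> \<bar>w x\<bar> \<le> C * norm (x - y)"
    and 0: "\<And>y. y \<notin> U \<Longrightarrow> w y = 0"
  shows "Lip w"
proof (rule LipI[of _ "max C 0"])
  fix x y :: 'a
  have le: "C * norm (x - y) \<le> max C 0 * norm (x - y)" by (intro mult_right_mono) auto
  have "\<bar>w x - w y\<bar> \<le> max C 0 * norm (x - y)" if "x \<in> U \<or> y \<in> U"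
    using U[of x y] b[of x y] b[of y x] 0[of x] 0[of y] that le
    by (cases "x \<in> U"; cases "y \<in> U") (auto simp: norm_minus_commute)
  moreover have "\<bar>w x - w y\<bar> \<le> max C 0 * norm (x - y)" if "x \<notin> U" "y \<notin> U"
    using that 0 by simp
  ultimately show "\<bar>w x - w y\<bar> \<le> max C 0 * norm (x - y)" by blast
qed

lemma Lip_line_deriv_AE:
  fixes w :: "real^'m::finite \<Rightarrow> real"
  assumes "Lip w"
  shows "AE x in lborel. \<forall>i. line_deriv i w x (pd i w x)"
proof -
  have "AE x in lborel. line_deriv i w x (pd i w x)" for i
  proof -
    obtain C where "C-lipschitz_on UNIV w" using assms Lip_lipschitz_on by blast
    from lipschitz_line_differentiable_AE[OF this, of "axis i 1"] show ?thesis
    proof eventually_elim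
      case (elim x)
      then obtain D where "line_deriv i w x D" by (auto simp: line_deriv_def)
      then show ?case using pd_eq by metis
    qed
  qed
  then show ?thesis by (intro AE_all_countable[THEN iffD2]) (auto simp: countable_finite)
qed

lemma pd_measurable [measurable]:
  assumes [measurable]: "w \<in> borel_measurable borel"
  shows "pd i w \<in> borel_measurable borel"
proof -
  have "(\<lambda>x. (w (x + (1 / real (Suc n)) *\<^sub>R axis i 1) - w x) / (1 / real (Suc n))) \<in> borel_measurable borel" for n
    by measurable
  then show ?thesis unfolding pd_def[abs_def] by (rule borel_measurable_lim_metric)
qed

subsection \<open>Lipschitz functions of bounded support\<close>

definition LC :: "(real^'m::finite \<Rightarrow> real) \<Rightarrow> bool" where
  "LC w \<longleftrightarrow> Lip w \<and> bounded {x. w x \<noteq> 0}"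

lemma LC_Lip: "LC w \<Longrightarrow> Lip w" by (simp add: LC_def)

lemma LC_diff:
  assumes "LC u" "LC v" shows "LC (\<lambda>x. u x - v x)"
proof -
  have "{x. u x - v x \<noteq> 0} \<subseteq> {x. u x \<noteq> 0} \<union> {x. v x \<noteq> 0}" by auto
  moreover have "bounded ({x. u x \<noteq> 0} \<union> {x. v x \<noteq> 0})" using assms by (simp add: LC_def)
  ultimately have "bounded {x. u x - v x \<noteq> 0}" by (rule bounded_subset[rotated])
  then show ?thesis using Lip_diff[OF assms[THEN LC_Lip]] unfolding LC_def by blast
qed

lemma LC_radius:
  assumes "LC w"
  obtains R where "R > 0" "\<And>x. norm x \<ge> R \<Longrightarrow> w x = 0"
proof -
  obtain R where R: "\<forall>x\<in>{x. w x \<noteq> 0}. norm x \<le> R" using assms by (auto simp: LC_def bounded_iff)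
  show ?thesis by (rule that[of "\<bar>R\<bar> + 1"]) (use R in fastforce)+
qed

lemma LC_bounded:
  assumes "LC w" obtains B where "B \<ge> 0" "\<And>x. \<bar>w x\<bar> \<le> B"
proof -
  obtain R where R: "R > 0" "\<And>x. norm x \<ge> R \<Longrightarrow> w x = 0" using LC_radius[OF assms] by metis
  have "compact (w ` cball 0 R)"
    using assms by (intro compact_continuous_image continuous_on_subset[OF Lip_continuous]) (auto simp: LC_def)
  then obtain B where B: "\<And>x. norm x \<le> R \<Longrightarrow> \<bar>w x\<bar> \<le> B"
    using compact_imp_bounded by (fastforce simp: bounded_iff)
  have "\<bar>w x\<bar> \<le> \<bar>B\<bar>" for x using B[of x] R(2)[of x] by (cases "norm x \<le> R") auto
  then show ?thesis using that[of "\<bar>B\<bar>"] by simp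
qed

text \<open>Dominated convergence. The function \<open>G\<close> is kept general because three cases
  occur: the identity for integration by parts, the absolute value for \<open>L^1\<close> norms, and
  the excess over a constant for Lipschitz bounds.\<close>

lemma LC_diff_quotient_tendsto:
  assumes w: "LC w" and s: "s \<longlonglongrightarrow> 0" "\<And>n. s n > 0"
    and G: "continuous_on UNIV G" "\<And>r. \<bar>G r\<bar> \<le> \<bar>r\<bar>"
  shows "integrable lborel (\<lambda>x. G (pd i w x))"
    "(\<lambda>n. \<integral>x. G ((w (x + s n *\<^sub>R axis i 1) - w x) / s n) \<partial>lborel) \<longlonglongrightarrow> (\<integral>x. G (pd i w x) \<partial>lborel)"
proof -
  obtain C where C: "C \<ge> 0" "\<And>x y. \<bar>w x - w y\<bar> \<le> C * norm (x - y)" using LipE[OF LC_Lip[OF w]] by metis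
  obtain R where R: "R > 0" "\<And>x. norm x \<ge> R \<Longrightarrow> w x = 0" using LC_radius[OF w] by metis
  obtain S where S: "\<And>n. \<bar>s n\<bar> \<le> S"
    using convergent_imp_Bseq[OF convergentI[OF s(1)]] by (auto simp: Bseq_def)
  have [measurable]: "w \<in> borel_measurable borel" using w by (auto simp: LC_def Lip_measurable)
  have [measurable]: "G \<in> borel_measurable borel" by (intro borel_measurable_continuous_onI G)
  \<comment> \<open>The quotients are bounded by the Lipschitz constant, and shifts of length at
    most \<open>S\<close> enlarge the support from radius \<open>R\<close> to at most
    \<open>R + S\<close>.\<close>
  let ?g = "\<lambda>x::real^'a. C * indicator (cball 0 (R + S)) x :: real"
  have g: "integrable lborel ?g"
    by (intro integrable_mult_right integrable_real_indicator emeasure_lborel_cball_finite) simp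
  have lim: "AE x in lborel. (\<lambda>n. G ((w (x + s n *\<^sub>R axis i 1) - w x) / s n)) \<longlonglongrightarrow> G (pd i w x)"
    using Lip_line_deriv_AE[OF LC_Lip[OF w]]
  proof eventually_elim
    case (elim x)
    then have D: "line_deriv i w x (pd i w x)" by blast
    have "s n \<noteq> 0" for n using s(2)[of n] by simp
    note lim = line_deriv_sequentially[OF D s(1) this]
    have "isCont G (pd i w x)"
      using G(1) continuous_on_eq_continuous_at[OF open_UNIV] by blast
    from isCont_tendsto_compose[OF this lim] show ?case .
  qed
  have bd: "\<bar>G ((w (x + s n *\<^sub>R axis i 1) - w x) / s n)\<bar> \<le> ?g x" for n x
  proof -
    have "\<bar>(w (x + s n *\<^sub>R axis i 1) - w x) / s n\<bar> \<le> C"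
      using C(2)[of "x + s n *\<^sub>R axis i 1" x] s(2)[of n] by (simp add: norm_axis_1 divide_le_eq)
    moreover have "w (x + s n *\<^sub>R axis i 1) - w x = 0" if "x \<notin> cball 0 (R + S)"
    proof -
      have "norm x \<le> norm (x + s n *\<^sub>R axis i 1) + norm (s n *\<^sub>R axis i (1::real))"
        using norm_triangle_ineq4[of "x + s n *\<^sub>R axis i 1" "s n *\<^sub>R axis i 1"] by simp
      then have "norm (x + s n *\<^sub>R axis i 1) \<ge> R" "norm x \<ge> R"
        using that S[of n] by (auto simp: norm_axis_1)
      then show ?thesis using R(2) by simp
    qed
    ultimately show ?thesis
      using G(2)[of "(w (x + s n *\<^sub>R axis i 1) - w x) / s n"] by (auto split: split_indicator)
  qed
  show "integrable lborel (\<lambda>x. G (pd i w x))"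
    by (rule integrable_dominated_convergence[OF _ _ g lim]) (use bd in auto)
  show "(\<lambda>n. \<integral>x. G ((w (x + s n *\<^sub>R axis i 1) - w x) / s n) \<partial>lborel) \<longlonglongrightarrow> (\<integral>x. G (pd i w x) \<partial>lborel)"
    by (rule integral_dominated_convergence[OF _ _ g lim]) (use bd in auto)
qed

lemma LC_integrable:
  assumes "LC w" shows "integrable lborel w"
proof -
  obtain B where B: "\<And>x. \<bar>w x\<bar> \<le> B" using LC_bounded[OF assms] by metis
  show ?thesis
  proof (rule integrable_bounded_support)
    show "AE x in lborel. \<bar>w x\<bar> \<le> B" using B by simp
    show "bounded {x. w x \<noteq> 0}" using assms by (simp add: LC_def)
  qed (use Lip_measurable[OF LC_Lip[OF assms]] in auto)
qed

text \<open>Difference quotients have integral zero by translation invariance, and the limit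
  inherits it. Both the calibration of the barrier and the weak gradient rest on this form of the
  divergence theorem.\<close>

lemma LC_pd_integral_zero:
  assumes w: "LC w"
  shows "integrable lborel (pd i w)" "(\<integral>x. pd i w x \<partial>lborel) = 0"
proof -
  have s: "(\<lambda>n. 1 / real (Suc n)) \<longlonglongrightarrow> 0"
    using LIMSEQ_inverse_real_of_nat by (simp add: inverse_eq_divide)
  note lim = LC_diff_quotient_tendsto[OF w s, of "\<lambda>r. r" i, simplified]
  show "integrable lborel (pd i w)" using lim(1) by simp
  have [measurable]: "w \<in> borel_measurable borel" using w by (auto simp: LC_def Lip_measurable)
  have "(\<integral>x. (w (x + t *\<^sub>R axis i 1) - w x) \<partial>lborel) = 0" for t :: real
    using LC_integrable[OF w] integrable_lborel_translate[OF LC_integrable[OF w]]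
    by (simp add: integral_lborel_translate)
  then have "(\<lambda>n. 0) \<longlonglongrightarrow> (\<integral>x. pd i w x \<partial>lborel)" using lim(2) by simp
  then show "(\<integral>x. pd i w x \<partial>lborel) = 0" using LIMSEQ_unique[OF tendsto_const] by metis
qed

text \<open>The left-hand side is subadditive in \<open>t\<close> by translation invariance, so it is at most
  \<open>n\<close> times its value at \<open>t / n\<close>. The case \<open>C = 0\<close> is the contraction property of difference
  quotients in \<open>L\<^sup>1\<close>.\<close>

lemma LC_difference_excess_le:
  assumes w: "LC w" and C: "C \<ge> 0" and t: "t > 0"
  shows "integrable lborel (\<lambda>x. max 0 (\<bar>w (x + t *\<^sub>R axis i 1) - w x\<bar> - C * t))"
    "(\<integral>x. max 0 (\<bar>w (x + t *\<^sub>R axis i 1) - w x\<bar> - C * t) \<partial>lborel) \<le> t * (\<integral>x. max 0 (\<bar>pd i w x\<bar> - C) \<partial>lborel)"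
proof -
  have [measurable]: "w \<in> borel_measurable borel" using w by (auto simp: LC_def Lip_measurable)
  let ?e = "\<lambda>t x. max 0 (\<bar>w (x + t *\<^sub>R axis i 1) - w x\<bar> - C * t)"
  have int: "integrable lborel (?e t)" if "t \<ge> 0" for t
  proof (rule Bochner_Integration.integrable_bound)
    show "integrable lborel (\<lambda>x. \<bar>w (x + t *\<^sub>R axis i 1)\<bar> + \<bar>w x\<bar>)"
      using LC_integrable[OF w] integrable_lborel_translate[OF LC_integrable[OF w]] by simp
    have "0 \<le> C * t" using C that by simp
    then show "AE x in lborel. norm (?e t x) \<le> norm (\<bar>w (x + t *\<^sub>R axis i 1)\<bar> + \<bar>w x\<bar>)"
      by (intro AE_I2) auto
  qed measurable
  define \<Psi> where "\<Psi> t = (\<integral>x. ?e t x \<partial>lborel)" for t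
  have scale: "r * max 0 (\<bar>a / r\<bar> - C) = max 0 (\<bar>a\<bar> - C * r)" if "r > 0" for a r :: real
  proof -
    have "r * max 0 (\<bar>a / r\<bar> - C) = max (r * 0) (r * (\<bar>a / r\<bar> - C))"
      using that by (simp add: max_mult_distrib_left)
    also have "r * (\<bar>a / r\<bar> - C) = \<bar>a\<bar> - C * r"
      using that by (simp add: abs_divide right_diff_distrib)
    finally show ?thesis by simp
  qed
  have sub: "\<Psi> (s + t) \<le> \<Psi> s + \<Psi> t" if st: "s \<ge> 0" "t \<ge> 0" for s t
  proof -
    have "\<Psi> (s + t) \<le> (\<integral>x. ?e s (x + t *\<^sub>R axis i 1) + ?e t x \<partial>lborel)"
      unfolding \<Psi>_def
    proof (rule integral_mono)
      show "integrable lborel (?e (s + t))" using int st by simp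
      show "integrable lborel (\<lambda>x. ?e s (x + t *\<^sub>R axis i 1) + ?e t x)"
        using int st integrable_lborel_translate[OF int[of s]] by simp
      have "max 0 (\<bar>a - c\<bar> - C * (s + t)) \<le> max 0 (\<bar>a - b\<bar> - C * s) + max 0 (\<bar>b - c\<bar> - C * t)" for a b c
        unfolding distrib_left by linarith
      from this[of "w (x + (s + t) *\<^sub>R axis i 1)" "w x" "w (x + t *\<^sub>R axis i 1)" for x]
      show "?e (s + t) x \<le> ?e s (x + t *\<^sub>R axis i 1) + ?e t x" for x
        by (simp add: scaleR_add_left add.assoc add.commute[of "s *\<^sub>R axis i 1"])
    qed
    also have "\<dots> = (\<integral>x. ?e s (x + t *\<^sub>R axis i 1) \<partial>lborel) + \<Psi> t"
      unfolding \<Psi>_def by (intro Bochner_Integration.integral_add integrable_lborel_translate[OF int] int st)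
    also have "(\<integral>x. ?e s (x + t *\<^sub>R axis i 1) \<partial>lborel) = \<Psi> s"
      unfolding \<Psi>_def by (intro integral_lborel_translate) measurable
    finally show ?thesis .
  qed
  have mult: "\<Psi> (real n * s) \<le> real n * \<Psi> s" if "s \<ge> 0" for n s
  proof (induction n)
    case 0 then show ?case by (simp add: \<Psi>_def)
  next
    case (Suc n)
    have "\<Psi> (real (Suc n) * s) = \<Psi> (real n * s + s)" by (simp add: algebra_simps)
    also have "\<dots> \<le> \<Psi> (real n * s) + \<Psi> s" using that by (intro sub) auto
    finally show ?case using Suc by (simp add: algebra_simps)
  qed
  show "integrable lborel (?e t)" using int t by simp
  let ?s = "\<lambda>n. t / real (Suc n)"
  have s: "?s \<longlonglongrightarrow> 0" using tendsto_mult_left[OF LIMSEQ_inverse_real_of_nat, of t] by (simp add: divide_inverse)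
  let ?G = "\<lambda>r. max 0 (\<bar>r\<bar> - C)"
  have G: "\<bar>?G r\<bar> \<le> \<bar>r\<bar>" for r using C by auto
  have "(\<lambda>n. \<integral>x. ?G ((w (x + ?s n *\<^sub>R axis i 1) - w x) / ?s n) \<partial>lborel) \<longlonglongrightarrow> (\<integral>x. ?G (pd i w x) \<partial>lborel)"
    by (rule LC_diff_quotient_tendsto(2)[OF w s]) (use t G in \<open>auto intro!: continuous_intros\<close>)
  from tendsto_mult_left[OF this, of t]
  have "(\<lambda>n. t * (\<integral>x. ?G ((w (x + ?s n *\<^sub>R axis i 1) - w x) / ?s n) \<partial>lborel)) \<longlonglongrightarrow> t * (\<integral>x. ?G (pd i w x) \<partial>lborel)" .
  moreover have "\<Psi> t \<le> t * (\<integral>x. ?G ((w (x + ?s n *\<^sub>R axis i 1) - w x) / ?s n) \<partial>lborel)" for n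
  proof -
    have sn: "?s n > 0" using t by simp
    have "\<Psi> t \<le> real (Suc n) * \<Psi> (?s n)" using mult[of "?s n" "Suc n"] t by simp
    also have "\<Psi> (?s n) = (\<integral>x. ?s n * ?G ((w (x + ?s n *\<^sub>R axis i 1) - w x) / ?s n) \<partial>lborel)"
      unfolding \<Psi>_def
    proof (rule Bochner_Integration.integral_cong[OF refl])
      fix x
      show "?e (?s n) x = ?s n * ?G ((w (x + ?s n *\<^sub>R axis i 1) - w x) / ?s n)"
        using scale[OF sn, of "w (x + ?s n *\<^sub>R axis i 1) - w x"] by simp
    qed
    also have "real (Suc n) * \<dots> = t * (\<integral>x. ?G ((w (x + ?s n *\<^sub>R axis i 1) - w x) / ?s n) \<partial>lborel)"
      by simp
    finally show ?thesis .
  qed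
  ultimately have "\<Psi> t \<le> t * (\<integral>x. ?G (pd i w x) \<partial>lborel)"
    by (intro LIMSEQ_le_const) auto
  then show "(\<integral>x. ?e t x \<partial>lborel) \<le> t * (\<integral>x. ?G (pd i w x) \<partial>lborel)" by (simp add: \<Psi>_def)
qed

text \<open>Where the derivative nowhere exceeds \<open>C\<close>, the integrated excess of the
  increments over \<open>C * t\<close> is zero; being continuous, the excess vanishes at every
  point. Walking from \<open>y\<close> to \<open>x\<close> along the coordinate axes costs the
  factor \<open>CARD('m)\<close>.\<close>

lemma LC_pd_bounded_imp_lipschitz:
  fixes w :: "real^'m::finite \<Rightarrow> real"
  assumes w: "LC w" and C: "AE x in lborel. \<forall>i. \<bar>pd i w x\<bar> \<le> C" and C0: "C \<ge> 0"
  shows "\<bar>w x - w y\<bar> \<le> real CARD('m) * C * norm (x - y)"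
proof -
  have pos: "\<bar>w (x + t *\<^sub>R axis i 1) - w x\<bar> \<le> C * t" if t: "t > 0" for x i t
  proof -
    let ?e = "\<lambda>x. max 0 (\<bar>w (x + t *\<^sub>R axis i 1) - w x\<bar> - C * t)"
    have "AE x in lborel. max 0 (\<bar>pd i w x\<bar> - C) = 0"
      using C
    proof eventually_elim
      case (elim x)
      then have "\<bar>pd i w x\<bar> \<le> C" by blast
      then show ?case by simp
    qed
    then have "(\<integral>x. max 0 (\<bar>pd i w x\<bar> - C) \<partial>lborel) = 0" by (rule integral_eq_zero_AE)
    then have "(\<integral>x. ?e x \<partial>lborel) \<le> 0" using LC_difference_excess_le(2)[OF w C0 t, of i] by simp
    moreover have "(\<integral>x. ?e x \<partial>lborel) \<ge> 0" by (intro integral_nonneg_AE) auto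
    ultimately have "AE x in lborel. ?e x = 0"
      using integral_nonneg_eq_0_iff_AE[OF LC_difference_excess_le(1)[OF w C0 t, of i]] by auto
    moreover have "continuous_on UNIV ?e"
      by (intro continuous_intros Lip_continuous Lip_translate LC_Lip w)
    ultimately have "?e x = 0" by (intro AE_lborel_continuous_zero)
    then show ?thesis by (simp add: max_def split: if_splits)
  qed
  have step: "\<bar>w (x + t *\<^sub>R axis i 1) - w x\<bar> \<le> C * \<bar>t\<bar>" for x i and t :: real
    using pos[of t x i] pos[of "- t" "x + t *\<^sub>R axis i 1" i] by (cases t "0::real" rule: linorder_cases) auto
  have "\<bar>w (x + (\<Sum>i\<in>S. z $ i *\<^sub>R axis i 1)) - w x\<bar> \<le> (\<Sum>i\<in>S. C * \<bar>z $ i\<bar>)" if "finite S" for S and x z :: "real^'m"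
    using that
  proof (induction S)
    case (insert i S)
    have "\<bar>w (x + (\<Sum>i\<in>S. z $ i *\<^sub>R axis i 1) + z $ i *\<^sub>R axis i 1) - w (x + (\<Sum>i\<in>S. z $ i *\<^sub>R axis i 1))\<bar> \<le> C * \<bar>z $ i\<bar>"
      by (rule step)
    then show ?case using insert by (simp add: algebra_simps)
  qed simp
  from this[of UNIV y "x - y"]
  have "\<bar>w x - w y\<bar> \<le> (\<Sum>i\<in>UNIV. C * \<bar>(x - y) $ i\<bar>)"
    using basis_expansion[of "x - y"] by (simp add: scalar_mult_eq_scaleR)
  also have "\<dots> \<le> (\<Sum>i\<in>(UNIV::'m set). C * norm (x - y))"
    by (intro sum_mono mult_left_mono component_le_norm_cart C0)
  finally show ?thesis by simp
qed

subsection \<open>Gradients\<close>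

text \<open>Partial derivatives only, without total differentiability: this is what Fubini provides
  almost everywhere, and it is stable under all operations needed later.\<close>

definition has_grad :: "(real^'m::finite \<Rightarrow> real) \<Rightarrow> real^'m \<Rightarrow> real^'m \<Rightarrow> bool" where
  "has_grad w x D \<longleftrightarrow> (\<forall>i. line_deriv i w x (D $ i))"

definition grad :: "(real^'m::finite \<Rightarrow> real) \<Rightarrow> real^'m \<Rightarrow> real^'m" where
  "grad w x = (\<Sum>i\<in>UNIV. pd i w x *\<^sub>R axis i 1)"

lemma grad_nth [simp]: "grad w x $ i = pd i w x"
  by (simp add: grad_def axis_def if_distrib cong: if_cong)

lemma grad_eq: "has_grad w x D \<Longrightarrow> grad w x = D"
  by (simp add: vec_eq_iff has_grad_def pd_eq)

lemma has_grad_iff: "has_grad w x (grad w x) \<longleftrightarrow> (\<forall>i. line_deriv i w x (pd i w x))"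
  by (simp add: has_grad_def)

lemma Lip_has_grad_AE: "Lip w \<Longrightarrow> AE x in lborel. has_grad w x (grad w x)"
  unfolding has_grad_iff by (rule Lip_line_deriv_AE)

lemma grad_measurable [measurable]:
  assumes [measurable]: "w \<in> borel_measurable borel"
  shows "grad w \<in> borel_measurable borel"
  unfolding grad_def[abs_def] by measurable

lemma has_grad_add: "has_grad u x D \<Longrightarrow> has_grad v x E \<Longrightarrow> has_grad (\<lambda>x. u x + v x) x (D + E)"
  by (simp add: has_grad_def line_deriv_add)

lemma has_grad_diff: "has_grad u x D \<Longrightarrow> has_grad v x E \<Longrightarrow> has_grad (\<lambda>x. u x - v x) x (D - E)"
  by (simp add: has_grad_def line_deriv_diff)

lemma has_grad_cmult: "has_grad u x D \<Longrightarrow> has_grad (\<lambda>x. c * u x) x (c *\<^sub>R D)"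
  by (simp add: has_grad_def line_deriv_cmult)

lemma has_grad_uminus: "has_grad u x D \<Longrightarrow> has_grad (\<lambda>x. - u x) x (- D)"
  by (simp add: has_grad_def line_deriv_uminus)

lemma has_grad_const: "has_grad (\<lambda>x. c) x 0"
  by (simp add: has_grad_def line_deriv_const)

lemma has_grad_translate: "has_grad (\<lambda>x. u (x + h)) x D \<longleftrightarrow> has_grad u (x + h) D"
  by (simp add: has_grad_def line_deriv_translate)

lemma has_grad_transfer:
  "has_grad u x D \<Longrightarrow> open U \<Longrightarrow> x \<in> U \<Longrightarrow> (\<And>y. y \<in> U \<Longrightarrow> u y = v y) \<Longrightarrow> has_grad v x D"
  unfolding has_grad_def using line_deriv_transfer by blast

lemma has_grad_zero_at_min: "has_grad u x D \<Longrightarrow> u x = 0 \<Longrightarrow> (\<And>y. u y \<ge> 0) \<Longrightarrow> D = 0"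
  unfolding has_grad_def vec_eq_iff using line_deriv_zero_at_min by fastforce

text \<open>At a zero of \<open>u\<close> both \<open>\<bar>u\<bar> + u\<close> and
  \<open>\<bar>u\<bar> - u\<close> attain their minimum 0, so \<open>E + D\<close> and
  \<open>E - D\<close> vanish.\<close>

lemma has_grad_zero_if_abs:
  assumes u: "has_grad u x D" and a: "has_grad (\<lambda>y. \<bar>u y\<bar>) x E" and "u x = 0"
  shows "D = 0"
proof -
  have "E + D = 0"
    by (rule has_grad_zero_at_min[OF has_grad_add[OF a u]]) (use assms in auto)
  moreover have "E - D = 0"
    by (rule has_grad_zero_at_min[OF has_grad_diff[OF a u]]) (use assms in auto)
  ultimately have "2 *\<^sub>R D = 0" by (simp add: scaleR_2)
  then show ?thesis by simp
qed

lemma Lip_abs: "Lip u \<Longrightarrow> Lip (\<lambda>x. \<bar>u x\<bar>)"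
  unfolding Lip_def by (meson abs_triangle_ineq3 order_trans)

text \<open>Since \<open>\<bar>u\<bar>\<close> is Lipschitz too, the preceding lemma applies at
  almost every zero of \<open>u\<close>. Gradients of truncated functions can thus be computed
  almost everywhere without any knowledge of the boundary of the truncation set.\<close>

lemma Lip_grad_zero_AE:
  assumes "Lip (u :: real^'m::finite \<Rightarrow> real)"
  shows "AE x in lborel. u x = 0 \<longrightarrow> grad u x = 0"
  using Lip_has_grad_AE[OF assms] Lip_has_grad_AE[OF Lip_abs[OF assms]]
  by eventually_elim (use has_grad_zero_if_abs in blast)

lemma lipschitz_norm_grad_le:
  fixes w :: "real^'m::finite \<Rightarrow> real"
  assumes "has_grad w x D" and C: "\<And>x y. \<bar>w x - w y\<bar> \<le> C * norm (x - y)"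
  shows "norm D \<le> real CARD('m) * C"
proof -
  have "norm D \<le> (\<Sum>i\<in>UNIV. \<bar>D $ i\<bar>)" by (rule norm_le_l1_cart)
  also have "\<dots> \<le> (\<Sum>i\<in>(UNIV::'m set). C)"
    by (intro sum_mono line_deriv_abs_le[OF _ C]) (use assms(1) in \<open>auto simp: has_grad_def\<close>)
  finally show ?thesis by simp
qed

lemma LC_grad_integrable:
  assumes "LC w" shows "integrable lborel (grad w)"
  unfolding grad_def[abs_def]
  by (intro Bochner_Integration.integrable_sum integrable_scaleR_left LC_pd_integral_zero(1) assms)

lemma LC_grad_norm_integrable:
  assumes "LC w" shows "integrable lborel (\<lambda>x. norm (grad w x))"
  using LC_grad_integrable[OF assms] by (rule integrable_norm)

text \<open>The difference has Lipschitz constant 0, and it vanishes far out.\<close>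

lemma LC_eq_if_grad_eq_AE:
  assumes u: "LC u" and v: "LC v" and eq: "AE x in lborel. grad u x = grad v x"
  shows "u x = v x"
proof -
  note uv = LC_diff[OF u v]
  have "AE x in lborel. \<forall>i. \<bar>pd i (\<lambda>x. u x - v x) x\<bar> \<le> 0"
    using eq Lip_has_grad_AE[OF LC_Lip[OF u]] Lip_has_grad_AE[OF LC_Lip[OF v]]
  proof eventually_elim
    case (elim x)
    from grad_eq[OF has_grad_diff[OF elim(2,3)]] elim(1)
    have "grad (\<lambda>x. u x - v x) x = 0" by simp
    then show ?case by (simp add: vec_eq_iff)
  qed
  note const = LC_pd_bounded_imp_lipschitz[OF uv this order_refl, simplified]
  obtain R where R: "R > 0" "\<And>x. norm x \<ge> R \<Longrightarrow> u x - v x = 0" using LC_radius[OF uv] by metis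
  obtain y :: "real^'a" where "norm y = R" using vector_choose_size[of R] R(1) by auto
  then show ?thesis using const[of x y] R(2)[of y] by simp
qed

subsection \<open>Admissible functions\<close>

text \<open>In the application \<open>F\<close> is the given field plus the gradient of the boundary
  datum, which reduces the problem to zero boundary values. One constant \<open>M\<close> serves as
  bound and as Lipschitz constant.\<close>

locale haar =
  fixes \<Omega> :: "(real^'m::finite) set" and F :: "real^'m \<Rightarrow> real^'m" and M :: real
  assumes open_\<Omega>: "open \<Omega>" and bounded_\<Omega>: "bounded \<Omega>"
    and M_pos: "M > 0"
    and F_bound: "x \<in> \<Omega> \<Longrightarrow> norm (F x) \<le> M"
    and F_lip: "x \<in> \<Omega> \<Longrightarrow> y \<in> \<Omega> \<Longrightarrow> norm (F x - F y) \<le> M * norm (x - y)"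
begin

definition V :: "(real^'m \<Rightarrow> real) \<Rightarrow> real^'m \<Rightarrow> real^'m" where
  "V w x = grad w x + F x"

definition energy :: "(real^'m \<Rightarrow> real) \<Rightarrow> (real^'m \<Rightarrow> real) \<Rightarrow> real" where
  "energy G w = (\<integral>x. indicator \<Omega> x * G (V w x) \<partial>lborel)"

text \<open>The class is convex, and the bound on \<open>V w\<close> rather than on
  \<open>grad w\<close> is invariant under the exchange of pieces between \<open>w\<close> and a
  corrected translate.\<close>

definition Adm :: "real \<Rightarrow> (real^'m \<Rightarrow> real) \<Rightarrow> bool" where
  "Adm L w \<longleftrightarrow> Lip w \<and> (\<forall>x. x \<notin> \<Omega> \<longrightarrow> w x = 0) \<and> (AE x in lborel. x \<in> \<Omega> \<longrightarrow> norm (V w x) \<le> L)"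

lemma \<Omega>_sets [measurable]: "\<Omega> \<in> sets borel" using open_\<Omega> by simp

lemma emeasure_\<Omega>: "emeasure lborel \<Omega> < \<infinity>"
  using bounded_\<Omega> by (rule emeasure_bounded_finite)

lemma integrable_const_\<Omega>: "integrable lborel (\<lambda>x. indicator \<Omega> x * c :: real)"
  by (intro integrable_mult_left integrable_real_indicator emeasure_\<Omega>) simp

lemma F_measurable: "(\<lambda>x. indicator \<Omega> x *\<^sub>R F x) \<in> borel_measurable borel"
proof -
  have "M-lipschitz_on \<Omega> F"
    using F_lip M_pos by (intro lipschitz_onI) (auto simp: dist_norm)
  then show ?thesis
    by (intro borel_measurable_continuous_on_indicator lipschitz_on_continuous_on) auto
qed

lemma V_measurable:
  assumes [measurable]: "w \<in> borel_measurable borel" "G \<in> borel_measurable borel"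
  shows "(\<lambda>x. indicator \<Omega> x * G (V w x) :: real) \<in> borel_measurable borel"
proof -
  note [measurable] = F_measurable
  have "(\<lambda>x. indicator \<Omega> x * G (grad w x + indicator \<Omega> x *\<^sub>R F x)) \<in> borel_measurable borel"
    by measurable
  also have "(\<lambda>x. indicator \<Omega> x * G (grad w x + indicator \<Omega> x *\<^sub>R F x)) = (\<lambda>x. indicator \<Omega> x * G (V w x))"
    by (auto simp: V_def fun_eq_iff indicator_def)
  finally show ?thesis .
qed

lemma AdmD:
  assumes "Adm L w"
  shows "Lip w" "x \<notin> \<Omega> \<Longrightarrow> w x = 0" "AE x in lborel. x \<in> \<Omega> \<longrightarrow> norm (V w x) \<le> L" "LC w"
    "w \<in> borel_measurable borel"
proof -
  have "bounded {x. w x \<noteq> 0}"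
    by (rule bounded_subset[OF bounded_\<Omega>]) (use assms in \<open>auto simp: Adm_def\<close>)
  then show "LC w" using assms by (simp add: LC_def Adm_def)
qed (use assms in \<open>auto simp: Adm_def Lip_measurable\<close>)

lemma integrable_energy:
  fixes G :: "real^'m \<Rightarrow> real"
  assumes w: "Adm L w" and [measurable]: "G \<in> borel_measurable borel"
    and B: "\<And>v. norm v \<le> L \<Longrightarrow> \<bar>G v\<bar> \<le> B"
  shows "integrable lborel (\<lambda>x. indicator \<Omega> x * G (V w x))"
proof (rule integrable_bounded_support[OF _ _ bounded_\<Omega>])
  show "(\<lambda>x. indicator \<Omega> x * G (V w x)) \<in> borel_measurable borel"
    using AdmD(5)[OF w] by (intro V_measurable) auto
  show "AE x in lborel. \<bar>indicator \<Omega> x * G (V w x)\<bar> \<le> \<bar>B\<bar>"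
    using AdmD(3)[OF w]
  proof eventually_elim
    case (elim x)
    then show ?case using B[of "V w x"] by (cases "x \<in> \<Omega>") auto
  qed
qed auto

abbreviation sq :: "real^'m \<Rightarrow> real" where "sq v \<equiv> (norm v)\<^sup>2"

lemma integrable_energy_norm: "Adm L w \<Longrightarrow> integrable lborel (\<lambda>x. indicator \<Omega> x * norm (V w x))"
  by (rule integrable_energy[where B = L]) auto

lemma integrable_energy_sq: "Adm L w \<Longrightarrow> integrable lborel (\<lambda>x. indicator \<Omega> x * sq (V w x))"
  by (rule integrable_energy[where B = "L\<^sup>2"]) (auto intro: power_mono)

lemma V_add_AE:
  assumes u: "Lip u" and v: "Lip v" and st: "s + t = 1"
  shows "AE x in lborel. V (\<lambda>x. s * u x + t * v x) x = s *\<^sub>R V u x + t *\<^sub>R V v x"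
  using Lip_has_grad_AE[OF u] Lip_has_grad_AE[OF v]
proof eventually_elim
  case (elim x)
  have "F x = s *\<^sub>R F x + t *\<^sub>R F x" using st by (simp flip: scaleR_add_left)
  moreover have "grad (\<lambda>x. s * u x + t * v x) x = s *\<^sub>R grad u x + t *\<^sub>R grad v x"
    by (intro grad_eq has_grad_add has_grad_cmult elim)
  ultimately show ?case by (simp add: V_def algebra_simps)
qed

lemma Adm_convex:
  assumes u: "Adm L u" and v: "Adm L v" and st: "s \<ge> 0" "t \<ge> 0" "s + t = 1"
  shows "Adm L (\<lambda>x. s * u x + t * v x)"
proof -
  have "AE x in lborel. x \<in> \<Omega> \<longrightarrow> norm (V (\<lambda>x. s * u x + t * v x) x) \<le> L"
    using AdmD(3)[OF u] AdmD(3)[OF v] V_add_AE[OF AdmD(1)[OF u] AdmD(1)[OF v] st(3)]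
  proof eventually_elim
    case (elim x)
    show ?case
    proof
      assume x: "x \<in> \<Omega>"
      have "norm (s *\<^sub>R V u x + t *\<^sub>R V v x) \<le> s * norm (V u x) + t * norm (V v x)"
        using norm_triangle_ineq[of "s *\<^sub>R V u x" "t *\<^sub>R V v x"] st by simp
      also have "\<dots> \<le> s * L + t * L" using elim x st by (intro add_mono mult_left_mono) auto
      also have "\<dots> = L" using st by (simp flip: distrib_right)
      finally show "norm (V (\<lambda>x. s * u x + t * v x) x) \<le> L" using elim by simp
    qed
  qed
  then show ?thesis using u v by (auto simp: Adm_def intro!: Lip_add Lip_cmult)
qed

lemma energy_norm_convex:
  assumes u: "Adm L u" and v: "Adm L v" and st: "s \<ge> 0" "t \<ge> 0" "s + t = 1"
  shows "energy norm (\<lambda>x. s * u x + t * v x) \<le> s * energy norm u + t * energy norm v"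
proof -
  have "energy norm (\<lambda>x. s * u x + t * v x) \<le>
      (\<integral>x. s * (indicator \<Omega> x * norm (V u x)) + t * (indicator \<Omega> x * norm (V v x)) \<partial>lborel)"
    unfolding energy_def
  proof (rule integral_mono_AE)
    show "integrable lborel (\<lambda>x. indicator \<Omega> x * norm (V (\<lambda>x. s * u x + t * v x) x))"
      by (rule integrable_energy_norm[OF Adm_convex[OF u v st]])
    show "integrable lborel (\<lambda>x. s * (indicator \<Omega> x * norm (V u x)) + t * (indicator \<Omega> x * norm (V v x)))"
      by (intro Bochner_Integration.integrable_add integrable_mult_right integrable_energy_norm[OF u] integrable_energy_norm[OF v])
    show "AE x in lborel. indicator \<Omega> x * norm (V (\<lambda>x. s * u x + t * v x) x)
      \<le> s * (indicator \<Omega> x * norm (V u x)) + t * (indicator \<Omega> x * norm (V v x))"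
      using V_add_AE[OF AdmD(1)[OF u] AdmD(1)[OF v] st(3)]
    proof eventually_elim
      case (elim x)
      have "norm (s *\<^sub>R V u x + t *\<^sub>R V v x) \<le> s * norm (V u x) + t * norm (V v x)"
        using norm_triangle_ineq[of "s *\<^sub>R V u x" "t *\<^sub>R V v x"] st by simp
      then show ?case using elim by (cases "x \<in> \<Omega>") auto
    qed
  qed
  also have "\<dots> = s * energy norm u + t * energy norm v"
    unfolding energy_def using integrable_energy_norm[OF u] integrable_energy_norm[OF v] by simp
  finally show ?thesis .
qed

lemma V_diff: "V u x - V v x = grad u x - grad v x"
  by (simp add: V_def)

text \<open>The parallelogram law for \<open>V u\<close> and \<open>V v\<close>, in whose difference
  \<open>F\<close> cancels. It controls the distance of the gradients once the midpoint cannot have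
  much smaller energy than \<open>u\<close> and \<open>v\<close>.\<close>

lemma energy_sq_parallelogram:
  assumes u: "Adm L u" and v: "Adm L v"
  shows "integrable lborel (\<lambda>x. indicator \<Omega> x * sq (grad u x - grad v x))"
    "(\<integral>x. indicator \<Omega> x * sq (grad u x - grad v x) \<partial>lborel) =
      2 * energy sq u + 2 * energy sq v - 4 * energy sq (\<lambda>x. 1/2 * u x + 1/2 * v x)"
proof -
  let ?m = "\<lambda>x. 1/2 * u x + 1/2 * v x"
  have m: "Adm L ?m" by (rule Adm_convex[OF u v]) auto
  let ?f = "\<lambda>x. 2 * (indicator \<Omega> x * sq (V u x)) + 2 * (indicator \<Omega> x * sq (V v x)) - 4 * (indicator \<Omega> x * sq (V ?m x))"
  have eq: "AE x in lborel. ?f x = indicator \<Omega> x * sq (grad u x - grad v x)"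
    using V_add_AE[OF AdmD(1)[OF u] AdmD(1)[OF v], of "1/2" "1/2", simplified]
  proof eventually_elim
    case (elim x)
    have par: "sq (a - b) = 2 * sq a + 2 * sq b - 4 * sq ((1/2) *\<^sub>R a + (1/2) *\<^sub>R b)" for a b :: "real^'m"
      by (simp add: power2_norm_eq_inner inner_simps inner_commute field_simps)
    from elim have "V ?m x = (1/2) *\<^sub>R V u x + (1/2) *\<^sub>R V v x" by simp
    then show ?case using par[of "V u x" "V v x"] by (cases "x \<in> \<Omega>") (simp_all add: V_diff)
  qed
  have int: "integrable lborel ?f"
    by (intro Bochner_Integration.integrable_diff Bochner_Integration.integrable_add integrable_mult_right
       integrable_energy_sq[OF u] integrable_energy_sq[OF v] integrable_energy_sq[OF m])
  have [measurable]: "u \<in> borel_measurable borel" "v \<in> borel_measurable borel"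
    using AdmD(5)[OF u] AdmD(5)[OF v] by auto
  have meas: "(\<lambda>x. indicator \<Omega> x * sq (grad u x - grad v x)) \<in> borel_measurable lborel" by measurable
  show "integrable lborel (\<lambda>x. indicator \<Omega> x * sq (grad u x - grad v x))"
    by (rule integrable_cong_AE_imp[OF int meas]) (use eq in eventually_elim, simp)
  have "(\<integral>x. indicator \<Omega> x * sq (grad u x - grad v x) \<partial>lborel) = (\<integral>x. ?f x \<partial>lborel)"
    by (rule integral_cong_AE) (use eq int meas in auto)
  also have "\<dots> = 2 * energy sq u + 2 * energy sq v - 4 * energy sq ?m"
    unfolding energy_def
    using integrable_energy_sq[OF u] integrable_energy_sq[OF v] integrable_energy_sq[OF m] by simp
  finally show "(\<integral>x. indicator \<Omega> x * sq (grad u x - grad v x) \<partial>lborel) = 2 * energy sq u + 2 * energy sq v - 4 * energy sq ?m" .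
qed

text \<open>The minimisers of the total variation \<open>energy norm\<close> need not be unique, but one with the
  least \<open>L\<^sup>2\<close>-energy is.\<close>

definition lex_min :: "real \<Rightarrow> (real^'m \<Rightarrow> real) \<Rightarrow> bool" where
  "lex_min L w \<longleftrightarrow> Adm L w \<and> (\<forall>v. Adm L v \<longrightarrow> energy norm w \<le> energy norm v) \<and>
     (\<forall>v. Adm L v \<longrightarrow> energy norm v = energy norm w \<longrightarrow> energy sq w \<le> energy sq v)"

text \<open>By convexity the midpoint is again a minimiser of the first energy, so its second energy
  is no smaller than that of \<open>u\<close>. The parallelogram law then leaves no room for a
  difference of the gradients.\<close>

lemma lex_min_unique:
  assumes u: "lex_min L u" and v: "Adm L v" "energy norm v = energy norm u" "energy sq v = energy sq u"
  shows "u = v"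
proof -
  have Au: "Adm L u" using u by (simp add: lex_min_def)
  let ?m = "\<lambda>x. 1/2 * u x + 1/2 * v x"
  have m: "Adm L ?m" by (rule Adm_convex[OF Au v(1)]) auto
  have "energy norm ?m \<le> 1/2 * energy norm u + 1/2 * energy norm v"
    by (rule energy_norm_convex[OF Au v(1)]) auto
  then have "energy norm ?m \<le> energy norm u" using v(2) by simp
  then have "energy norm ?m = energy norm u" using u m by (auto simp: lex_min_def intro: antisym)
  then have "energy sq u \<le> energy sq ?m" using u m by (auto simp: lex_min_def)
  then have "(\<integral>x. indicator \<Omega> x * sq (grad u x - grad v x) \<partial>lborel) \<le> 0"
    using energy_sq_parallelogram(2)[OF Au v(1)] v(3) by simp
  moreover have "(\<integral>x. indicator \<Omega> x * sq (grad u x - grad v x) \<partial>lborel) \<ge> 0"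
    by (intro integral_nonneg_AE) auto
  ultimately have "(\<integral>x. indicator \<Omega> x * sq (grad u x - grad v x) \<partial>lborel) = 0" by simp
  then have "AE x in lborel. indicator \<Omega> x * sq (grad u x - grad v x) = 0"
    by (subst (asm) integral_nonneg_eq_0_iff_AE[OF energy_sq_parallelogram(1)[OF Au v(1)]]) auto
  then have "AE x in lborel. grad u x = grad v x"
    using Lip_grad_zero_AE[OF AdmD(1)[OF Au]] Lip_grad_zero_AE[OF AdmD(1)[OF v(1)]]
  proof eventually_elim
    case (elim x)
    show ?case
    proof (cases "x \<in> \<Omega>")
      case True then show ?thesis using elim(1) by simp
    next
      case False
      then show ?thesis using elim AdmD(2)[OF Au False] AdmD(2)[OF v(1) False] by simp
    qed
  qed
  from LC_eq_if_grad_eq_AE[OF AdmD(4)[OF Au] AdmD(4)[OF v(1)] this] show ?thesis by auto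
qed

end

section \<open>Limits of admissible functions\<close>

text \<open>Lower semicontinuity of the \<open>L^1\<close> norm of a derivative under pointwise
  convergence. For a fixed increment \<open>t\<close> the \<open>L^1\<close> norm of the difference
  quotient is at most that of the derivative and passes to the limit in \<open>k\<close>; afterwards
  \<open>t\<close> tends to 0.\<close>

lemma LC_pd_L1_limit:
  fixes d :: "nat \<Rightarrow> real^'m::finite \<Rightarrow> real"
  assumes d: "\<And>k. LC (d k)" and d': "LC d'" and lim: "\<And>x. (\<lambda>k. d k x) \<longlonglongrightarrow> d' x"
    and S: "bounded S" and B: "\<And>k x. \<bar>d k x\<bar> \<le> B" and off: "\<And>k x. x \<notin> S \<Longrightarrow> d k x = 0"
    and le: "\<And>k. k \<ge> N \<Longrightarrow> (\<integral>x. \<bar>pd i (d k) x\<bar> \<partial>lborel) \<le> e"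
  shows "(\<integral>x. \<bar>pd i d' x\<bar> \<partial>lborel) \<le> e"
proof -
  have [measurable]: "d k \<in> borel_measurable borel" "d' \<in> borel_measurable borel" for k
    using Lip_measurable LC_Lip d d' by auto
  obtain R where R: "\<And>x. x \<in> S \<Longrightarrow> norm x \<le> R" using S by (auto simp: bounded_iff)
  let ?b = "\<lambda>x :: real^'m. B * indicator (cball 0 R) x :: real"
  have b: "integrable lborel ?b"
    by (intro integrable_mult_right integrable_real_indicator emeasure_lborel_cball_finite) simp
  have db: "\<bar>d k x\<bar> \<le> ?b x" for k x
    using B[of k x] off[of x k] R[of x] by (cases "x \<in> S") (auto split: split_indicator)
  have step: "(\<integral>x. \<bar>(d' (x + t *\<^sub>R axis i 1) - d' x) / t\<bar> \<partial>lborel) \<le> e" if t: "t > 0" for t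
  proof -
    have "(\<lambda>k. \<integral>x. \<bar>d k (x + t *\<^sub>R axis i 1) - d k x\<bar> \<partial>lborel) \<longlonglongrightarrow> (\<integral>x. \<bar>d' (x + t *\<^sub>R axis i 1) - d' x\<bar> \<partial>lborel)"
    proof (rule integral_dominated_convergence[where w = "\<lambda>x. ?b (x + t *\<^sub>R axis i 1) + ?b x"])
      show "integrable lborel (\<lambda>x. ?b (x + t *\<^sub>R axis i 1) + ?b x)"
        by (rule Bochner_Integration.integrable_add[OF integrable_lborel_translate[OF b] b])
      show "AE x in lborel. (\<lambda>k. \<bar>d k (x + t *\<^sub>R axis i 1) - d k x\<bar>) \<longlonglongrightarrow> \<bar>d' (x + t *\<^sub>R axis i 1) - d' x\<bar>"
        by (intro AE_I2 tendsto_intros lim)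
      show "AE x in lborel. norm \<bar>d k (x + t *\<^sub>R axis i 1) - d k x\<bar> \<le> ?b (x + t *\<^sub>R axis i 1) + ?b x" for k
      proof (rule AE_I2)
        fix x
        show "norm \<bar>d k (x + t *\<^sub>R axis i 1) - d k x\<bar> \<le> ?b (x + t *\<^sub>R axis i 1) + ?b x"
          using db[of k "x + t *\<^sub>R axis i 1"] db[of k x] by simp
      qed
    qed measurable
    moreover have "(\<integral>x. \<bar>d k (x + t *\<^sub>R axis i 1) - d k x\<bar> \<partial>lborel) \<le> t * e" if "k \<ge> N" for k
    proof -
      have "(\<integral>x. \<bar>d k (x + t *\<^sub>R axis i 1) - d k x\<bar> \<partial>lborel) \<le> t * (\<integral>x. \<bar>pd i (d k) x\<bar> \<partial>lborel)"
        using LC_difference_excess_le(2)[OF d order_refl t, of k i] by simp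
      also have "\<dots> \<le> t * e" using le[OF that] t by (intro mult_left_mono) auto
      finally show ?thesis .
    qed
    ultimately have "(\<integral>x. \<bar>d' (x + t *\<^sub>R axis i 1) - d' x\<bar> \<partial>lborel) \<le> t * e"
      by (intro LIMSEQ_le_const2) blast+
    moreover have "(\<integral>x. \<bar>(d' (x + t *\<^sub>R axis i 1) - d' x) / t\<bar> \<partial>lborel) = (\<integral>x. \<bar>d' (x + t *\<^sub>R axis i 1) - d' x\<bar> \<partial>lborel) / t"
      using t by (simp add: abs_divide)
    ultimately show ?thesis using t by (simp add: divide_le_eq mult.commute)
  qed
  have s: "(\<lambda>n. 1 / real (Suc n)) \<longlonglongrightarrow> 0"
    using LIMSEQ_inverse_real_of_nat by (simp add: inverse_eq_divide)
  have "(\<lambda>n. \<integral>x. \<bar>(d' (x + (1 / real (Suc n)) *\<^sub>R axis i 1) - d' x) / (1 / real (Suc n))\<bar> \<partial>lborel) \<longlonglongrightarrow> (\<integral>x. \<bar>pd i d' x\<bar> \<partial>lborel)"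
    by (rule LC_diff_quotient_tendsto(2)[OF d' s, of "\<lambda>r. \<bar>r\<bar>"]) (auto intro!: continuous_intros)
  then show ?thesis
    by (rule LIMSEQ_le_const2) (use step[of "1 / real (Suc n)" for n] in auto)
qed

lemma LC_norm_grad_L1_le:
  assumes "LC w"
  shows "(\<integral>x. norm (grad w x) \<partial>lborel) \<le> (\<Sum>i\<in>UNIV. \<integral>x. \<bar>pd i w x\<bar> \<partial>lborel)"
proof -
  have i: "integrable lborel (\<lambda>x. \<bar>pd i w x\<bar>)" for i
    by (rule integrable_abs[OF LC_pd_integral_zero(1)[OF assms]])
  have "(\<integral>x. norm (grad w x) \<partial>lborel) \<le> (\<integral>x. (\<Sum>i\<in>UNIV. \<bar>pd i w x\<bar>) \<partial>lborel)"
  proof (rule integral_mono[OF LC_grad_norm_integrable[OF assms]])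
    show "integrable lborel (\<lambda>x. \<Sum>i\<in>UNIV. \<bar>pd i w x\<bar>)" using i by (rule Bochner_Integration.integrable_sum)
    show "norm (grad w x) \<le> (\<Sum>i\<in>UNIV. \<bar>pd i w x\<bar>)" for x
      using norm_le_l1_cart[of "grad w x"] by simp
  qed
  also have "\<dots> = (\<Sum>i\<in>UNIV. \<integral>x. \<bar>pd i w x\<bar> \<partial>lborel)" using i by (rule Bochner_Integration.integral_sum)
  finally show ?thesis .
qed

lemma Lip_grad_diff_AE:
  "Lip u \<Longrightarrow> Lip v \<Longrightarrow> AE x in lborel. grad (\<lambda>x. u x - v x) x = grad u x - grad v x"
proof -
  assume "Lip u" "Lip v"
  from Lip_has_grad_AE[OF this(1)] Lip_has_grad_AE[OF this(2)] show ?thesis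
    by eventually_elim (rule grad_eq[OF has_grad_diff])
qed

context haar begin

text \<open>Inside \<Omega> the gradient is \<open>V u - F\<close>, and outside it vanishes almost
  everywhere with \<open>u\<close>. The constant does not depend on \<open>u\<close>, which supplies
  the equicontinuity for compactness.\<close>

lemma Adm_lipschitz:
  assumes u: "Adm L u" and L: "L \<ge> 0"
  shows "\<bar>u x - u y\<bar> \<le> real CARD('m) * (L + M) * norm (x - y)"
proof (rule LC_pd_bounded_imp_lipschitz[OF AdmD(4)[OF u]])
  show "AE x in lborel. \<forall>i. \<bar>pd i u x\<bar> \<le> L + M"
    using AdmD(3)[OF u] Lip_grad_zero_AE[OF AdmD(1)[OF u]]
  proof eventually_elim
    case (elim x)
    have "norm (grad u x) \<le> L + M"
    proof (cases "x \<in> \<Omega>")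
      case True
      have "norm (grad u x) \<le> norm (V u x) + norm (F x)"
        using norm_triangle_ineq4[of "V u x" "F x"] by (simp add: V_def)
      then show ?thesis using elim(1) True F_bound[OF True] by simp
    next
      case False
      then have "grad u x = 0" using elim(2) AdmD(2)[OF u] by blast
      then show ?thesis using L M_pos by simp
    qed
    then show ?case
      using component_le_norm_cart[of "grad u x"] by (auto intro: order_trans)
  qed
  show "L + M \<ge> 0" using L M_pos by simp
qed

lemma Adm_bound:
  assumes L: "L \<ge> 0"
  obtains B where "B \<ge> 0" "\<And>u x. Adm L u \<Longrightarrow> \<bar>u x\<bar> \<le> B"
proof -
  obtain R where R: "R > 0" "\<And>x. x \<in> \<Omega> \<Longrightarrow> norm x \<le> R"
    using bounded_\<Omega> by (auto simp: bounded_pos)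
  obtain y :: "real^'m" where y: "norm y = R + 1" using vector_choose_size[of "R + 1"] R(1) by auto
  then have y': "y \<notin> \<Omega>" using R(2) by force
  let ?K = "real CARD('m) * (L + M)"
  have K: "?K \<ge> 0" using L M_pos by simp
  have "\<bar>u x\<bar> \<le> ?K * (2 * R + 1)" if u: "Adm L u" for u x
  proof (cases "x \<in> \<Omega>")
    case True
    have "\<bar>u x\<bar> \<le> ?K * norm (x - y)" using Adm_lipschitz[OF u L, of x y] AdmD(2)[OF u y'] by simp
    also have "\<dots> \<le> ?K * (2 * R + 1)"
      using norm_triangle_ineq4[of x y] R(2)[OF True] y by (intro mult_left_mono K) auto
    finally show ?thesis .
  next
    case False
    then show ?thesis using AdmD(2)[OF u] K R(1) by simp
  qed
  then show ?thesis using that[of "?K * (2 * R + 1)"] K R(1) by simp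
qed

lemma energy_diff_le:
  fixes G :: "real^'m \<Rightarrow> real"
  assumes u: "Adm L u" and v: "Adm L v" and [measurable]: "G \<in> borel_measurable borel"
    and B: "\<And>a. norm a \<le> L \<Longrightarrow> \<bar>G a\<bar> \<le> B" and c: "c \<ge> 0"
    and G: "\<And>a b. norm a \<le> L \<Longrightarrow> norm b \<le> L \<Longrightarrow> \<bar>G a - G b\<bar> \<le> c * norm (a - b)"
  shows "\<bar>energy G u - energy G v\<bar> \<le> c * (\<integral>x. norm (grad (\<lambda>x. u x - v x) x) \<partial>lborel)"
proof -
  note iu = integrable_energy[OF u assms(3) B] and iv = integrable_energy[OF v assms(3) B]
  have "\<bar>energy G u - energy G v\<bar> = \<bar>\<integral>x. indicator \<Omega> x * G (V u x) - indicator \<Omega> x * G (V v x) \<partial>lborel\<bar>"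
    unfolding energy_def using iu iv by simp
  also have "\<dots> \<le> (\<integral>x. \<bar>indicator \<Omega> x * G (V u x) - indicator \<Omega> x * G (V v x)\<bar> \<partial>lborel)"
    by (rule integral_abs_bound)
  also have "\<dots> \<le> (\<integral>x. c * norm (grad (\<lambda>x. u x - v x) x) \<partial>lborel)"
  proof (rule integral_mono_AE)
    show "integrable lborel (\<lambda>x. \<bar>indicator \<Omega> x * G (V u x) - indicator \<Omega> x * G (V v x)\<bar>)"
      using iu iv by (intro integrable_abs Bochner_Integration.integrable_diff) auto
    show "integrable lborel (\<lambda>x. c * norm (grad (\<lambda>x. u x - v x) x))"
      by (intro integrable_mult_right LC_grad_norm_integrable LC_diff AdmD(4)[OF u] AdmD(4)[OF v])
    show "AE x in lborel. \<bar>indicator \<Omega> x * G (V u x) - indicator \<Omega> x * G (V v x)\<bar> \<le> c * norm (grad (\<lambda>x. u x - v x) x)"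
      using AdmD(3)[OF u] AdmD(3)[OF v] Lip_grad_diff_AE[OF AdmD(1)[OF u] AdmD(1)[OF v]]
    proof eventually_elim
      case (elim x)
      show ?case
      proof (cases "x \<in> \<Omega>")
        case True
        then show ?thesis using G[of "V u x" "V v x"] elim by (simp add: V_diff)
      qed (use c in simp)
    qed
  qed
  also have "\<dots> = c * (\<integral>x. norm (grad (\<lambda>x. u x - v x) x) \<partial>lborel)" by simp
  finally show ?thesis .
qed

text \<open>The pointwise inequality \<open>r \<le> \<delta> + r\<^sup>2 / \<delta>\<close>,
  integrated over \<Omega>, replaces the Cauchy-Schwarz inequality.\<close>

lemma pd_L1_le_L2:
  assumes u: "Adm L u" and v: "Adm L v" and \<delta>: "\<delta> > 0"
  shows "(\<integral>x. \<bar>pd i (\<lambda>x. u x - v x) x\<bar> \<partial>lborel) \<le>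
    \<delta> * measure lborel \<Omega> + (\<integral>x. indicator \<Omega> x * sq (grad u x - grad v x) \<partial>lborel) / \<delta>"
proof -
  note uv = LC_diff[OF AdmD(4)[OF u] AdmD(4)[OF v]]
  have "(\<integral>x. \<bar>pd i (\<lambda>x. u x - v x) x\<bar> \<partial>lborel) \<le> (\<integral>x. indicator \<Omega> x * \<delta> + (indicator \<Omega> x * sq (grad u x - grad v x)) / \<delta> \<partial>lborel)"
  proof (rule integral_mono_AE)
    show "integrable lborel (\<lambda>x. \<bar>pd i (\<lambda>x. u x - v x) x\<bar>)"
      by (rule integrable_abs[OF LC_pd_integral_zero(1)[OF uv]])
    show "integrable lborel (\<lambda>x. indicator \<Omega> x * \<delta> + (indicator \<Omega> x * sq (grad u x - grad v x)) / \<delta>)"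
      by (intro Bochner_Integration.integrable_add integrable_const_\<Omega> integrable_divide energy_sq_parallelogram(1)[OF u v])
    show "AE x in lborel. \<bar>pd i (\<lambda>x. u x - v x) x\<bar> \<le> indicator \<Omega> x * \<delta> + (indicator \<Omega> x * sq (grad u x - grad v x)) / \<delta>"
      using Lip_grad_diff_AE[OF AdmD(1)[OF u] AdmD(1)[OF v]] Lip_grad_zero_AE[OF LC_Lip[OF uv]]
    proof eventually_elim
      case (elim x)
      show ?case
      proof (cases "x \<in> \<Omega>")
        case True
        define r where "r = norm (grad u x - grad v x)"
        have "\<bar>grad (\<lambda>x. u x - v x) x $ i\<bar> \<le> r"
          unfolding r_def elim(1)[symmetric] by (rule component_le_norm_cart)
        then have "\<bar>pd i (\<lambda>x. u x - v x) x\<bar> \<le> r" by simp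
        moreover have "r \<le> \<delta> + r\<^sup>2 / \<delta>"
        proof (cases "r \<le> \<delta>")
          case False
          then have "r * \<delta> \<le> r * r" using \<delta> by (intro mult_left_mono) auto
          then have "r \<le> r\<^sup>2 / \<delta>" using \<delta> by (simp add: pos_le_divide_eq power2_eq_square)
          then show ?thesis using \<delta> by simp
        qed (use \<delta> in \<open>simp add: add_increasing2\<close>)
        ultimately show ?thesis using True by (simp add: r_def)
      next
        case False
        then have "u x - v x = 0" using AdmD(2)[OF u] AdmD(2)[OF v] by simp
        then have "grad (\<lambda>x. u x - v x) x = 0" using elim(2) by simp
        then show ?thesis using False by (simp add: vec_eq_iff)
      qed
    qed
  qed
  also have "\<dots> = \<delta> * measure lborel \<Omega> + (\<integral>x. indicator \<Omega> x * sq (grad u x - grad v x) \<partial>lborel) / \<delta>"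
    using integrable_const_\<Omega>[of \<delta>] energy_sq_parallelogram(1)[OF u v] by (simp add: mult.commute)
  finally show ?thesis .
qed

lemma sq_lipschitz:
  assumes "norm a \<le> L" "norm b \<le> L"
  shows "\<bar>sq a - sq b\<bar> \<le> 2 * L * norm (a - b :: real^'m)"
proof -
  have "sq a - sq b = (norm a - norm b) * (norm a + norm b)" by (simp add: power2_eq_square algebra_simps)
  then have "\<bar>sq a - sq b\<bar> = \<bar>norm a - norm b\<bar> * (norm a + norm b)" by (simp add: abs_mult)
  also have "\<dots> \<le> norm (a - b) * (L + L)"
    using assms norm_triangle_ineq3[of a b] by (intro mult_mono) auto
  finally show ?thesis by (simp add: mult.commute)
qed

text \<open>Pointwise limits do not control gradients. The Cauchy condition in \<open>L^2\<close>
  makes the gradients converge to that of \<open>w\<close> in \<open>L^1\<close>; both integrands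
  are Lipschitz on the ball of radius \<open>L\<close>, so both energies converge.\<close>

lemma Adm_closed:
  fixes u :: "nat \<Rightarrow> real^'m \<Rightarrow> real"
  assumes u: "\<And>n. Adm L (u n)" and L: "L \<ge> 0" and lim: "\<And>x. (\<lambda>n. u n x) \<longlonglongrightarrow> w x"
    and cauchy: "\<And>e. e > 0 \<Longrightarrow> \<exists>N. \<forall>n\<ge>N. \<forall>k\<ge>N. (\<integral>x. indicator \<Omega> x * sq (grad (u n) x - grad (u k) x) \<partial>lborel) \<le> e"
  shows "Adm L w" "(\<lambda>n. energy norm (u n)) \<longlonglongrightarrow> energy norm w" "(\<lambda>n. energy sq (u n)) \<longlonglongrightarrow> energy sq w"
proof -
  have w0: "w x = 0" if "x \<notin> \<Omega>" for x
    using lim[of x] AdmD(2)[OF u that] by (simp add: LIMSEQ_const_iff)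
  let ?K = "real CARD('m) * (L + M)"
  have wL: "\<bar>w x - w y\<bar> \<le> ?K * norm (x - y)" for x y
  proof (rule LIMSEQ_le_const2)
    show "(\<lambda>n. \<bar>u n x - u n y\<bar>) \<longlonglongrightarrow> \<bar>w x - w y\<bar>" by (intro tendsto_intros lim)
  qed (use Adm_lipschitz[OF u L] in blast)
  have Lw: "Lip w" using wL by (rule LipI)
  have "bounded {x. w x \<noteq> 0}" by (rule bounded_subset[OF bounded_\<Omega>]) (use w0 in auto)
  with Lw have LCw: "LC w" by (simp add: LC_def)
  obtain B where B: "B \<ge> 0" "\<And>n x. \<bar>u n x\<bar> \<le> B" using Adm_bound[OF L] u by metis
  note LCu = AdmD(4)[OF u]
  have pd_small: "\<exists>N. \<forall>n\<ge>N. \<forall>i. (\<integral>x. \<bar>pd i (\<lambda>x. u n x - w x) x\<bar> \<partial>lborel) \<le> e" if e: "e > 0" for e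
  proof -
    define \<mu> where "\<mu> = measure lborel \<Omega> + 1"
    have \<mu>: "\<mu> > 0" by (simp add: \<mu>_def add_nonneg_pos)
    \<comment> \<open>Each of the two terms of \<open>pd_L1_le_L2\<close> is to be at most
      \<open>e / 2\<close>.\<close>
    define \<delta> where "\<delta> = e / (2 * \<mu>)"
    have \<delta>: "\<delta> > 0" using e \<mu> by (simp add: \<delta>_def)
    have "\<delta> * measure lborel \<Omega> \<le> \<delta> * \<mu>" using \<delta> by (intro mult_left_mono) (auto simp: \<mu>_def)
    also have "\<dots> = e / 2" unfolding \<delta>_def using \<mu> by simp
    finally have \<delta>': "\<delta> * measure lborel \<Omega> \<le> e / 2" .
    obtain N where N: "\<And>n k. n \<ge> N \<Longrightarrow> k \<ge> N \<Longrightarrow>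
        (\<integral>x. indicator \<Omega> x * sq (grad (u n) x - grad (u k) x) \<partial>lborel) \<le> e / 2 * \<delta>"
      using cauchy[of "e / 2 * \<delta>"] e \<delta> by auto
    \<comment> \<open>Here \<open>n\<close> is fixed and \<open>k\<close> tends to infinity: the
      bound between \<open>u n\<close> and \<open>u k\<close> is inherited by the limit.\<close>
    have "(\<integral>x. \<bar>pd i (\<lambda>x. u n x - w x) x\<bar> \<partial>lborel) \<le> e" if n: "n \<ge> N" for n i
    proof (rule LC_pd_L1_limit[where d = "\<lambda>k x. u n x - u k x" and S = \<Omega> and B = "2 * B" and N = N])
      show "LC (\<lambda>x. u n x - u k x)" for k by (rule LC_diff[OF LCu LCu])
      show "LC (\<lambda>x. u n x - w x)" by (rule LC_diff[OF LCu LCw])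
      show "(\<lambda>k. u n x - u k x) \<longlonglongrightarrow> u n x - w x" for x by (intro tendsto_intros lim)
      show "bounded \<Omega>" by (rule bounded_\<Omega>)
      show "\<bar>u n x - u k x\<bar> \<le> 2 * B" for k x using B(2)[of n x] B(2)[of k x] by linarith
      show "u n x - u k x = 0" if "x \<notin> \<Omega>" for k x using AdmD(2)[OF u that] by simp
      fix k assume k: "k \<ge> N"
      have "(\<integral>x. indicator \<Omega> x * sq (grad (u n) x - grad (u k) x) \<partial>lborel) / \<delta> \<le> e / 2"
        using N[OF n k] \<delta> by (simp add: pos_divide_le_eq)
      then show "(\<integral>x. \<bar>pd i (\<lambda>x. u n x - u k x) x\<bar> \<partial>lborel) \<le> e"
        using pd_L1_le_L2[OF u u \<delta>, of i n k] \<delta>' by linarith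
    qed
    then show ?thesis by blast
  qed
  let ?D = "\<lambda>n. \<integral>x. norm (grad (\<lambda>x. u n x - w x) x) \<partial>lborel"
  have D0: "?D n \<ge> 0" for n by (intro integral_nonneg_AE) auto
  have D: "?D \<longlonglongrightarrow> 0"
  proof (rule LIMSEQ_I)
    fix e :: real assume e: "e > 0"
    define e' where "e' = e / (2 * real CARD('m))"
    have e': "e' > 0" using e by (simp add: e'_def)
    obtain N where N: "\<And>n i. n \<ge> N \<Longrightarrow> (\<integral>x. \<bar>pd i (\<lambda>x. u n x - w x) x\<bar> \<partial>lborel) \<le> e'"
      using pd_small[OF e'] by blast
    have "?D n < e" if "n \<ge> N" for n
    proof -
      have "?D n \<le> (\<Sum>i\<in>UNIV. \<integral>x. \<bar>pd i (\<lambda>x. u n x - w x) x\<bar> \<partial>lborel)"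
        by (rule LC_norm_grad_L1_le[OF LC_diff[OF LCu LCw]])
      also have "\<dots> \<le> (\<Sum>i\<in>(UNIV :: 'm set). e')" by (intro sum_mono N that)
      also have "\<dots> = e / 2" by (simp add: e'_def)
      finally show ?thesis using e by simp
    qed
    then show "\<exists>N. \<forall>n\<ge>N. norm (?D n - 0) < e" using D0 by auto
  qed
  show Aw: "Adm L w"
  proof -
    \<comment> \<open>The amount by which \<open>V w\<close> violates the constraint is dominated by
      the norm of the gradient of \<open>u n - w\<close>, whose integral tends to 0.\<close>
    have meas: "(\<lambda>x. indicator \<Omega> x * max 0 (norm (V w x) - L)) \<in> borel_measurable borel"
      by (rule V_measurable[OF Lip_measurable[OF Lw], of "\<lambda>v. max 0 (norm v - L)"]) measurable
    have le: "AE x in lborel. indicator \<Omega> x * max 0 (norm (V w x) - L) \<le> norm (grad (\<lambda>x. u n x - w x) x)" for n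
      using AdmD(3)[OF u[of n]] Lip_grad_diff_AE[OF AdmD(1)[OF u[of n]] Lw]
    proof eventually_elim
      case (elim x)
      show ?case
      proof (cases "x \<in> \<Omega>")
        case True
        have "norm (V w x) \<le> norm (V (u n) x) + norm (V (u n) x - V w x)"
          using norm_triangle_ineq4[of "V (u n) x" "V (u n) x - V w x"] by simp
        then show ?thesis using elim True by (auto simp: V_diff)
      qed simp
    qed
    have int: "integrable lborel (\<lambda>x. indicator \<Omega> x * max 0 (norm (V w x) - L))"
      by (rule Bochner_Integration.integrable_bound[OF LC_grad_norm_integrable[OF LC_diff[OF LCu LCw]]])
        (use meas le[of 0] in \<open>auto simp: abs_mult\<close>)
    have "(\<integral>x. indicator \<Omega> x * max 0 (norm (V w x) - L) \<partial>lborel) \<le> ?D n" for n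
      by (rule integral_mono_AE[OF int LC_grad_norm_integrable[OF LC_diff[OF LCu LCw]] le])
    then have "(\<integral>x. indicator \<Omega> x * max 0 (norm (V w x) - L) \<partial>lborel) \<le> 0"
      by (intro LIMSEQ_le_const[OF D]) auto
    moreover have "(\<integral>x. indicator \<Omega> x * max 0 (norm (V w x) - L) \<partial>lborel) \<ge> 0"
      by (intro integral_nonneg_AE) auto
    ultimately have "AE x in lborel. indicator \<Omega> x * max 0 (norm (V w x) - L) = 0"
      using integral_nonneg_eq_0_iff_AE[OF int] by auto
    then have "AE x in lborel. x \<in> \<Omega> \<longrightarrow> norm (V w x) \<le> L"
      by eventually_elim (auto simp: max_def split: if_splits)
    then show ?thesis using Lw w0 by (simp add: Adm_def)
  qed
  have conv: "(\<lambda>n. energy G (u n)) \<longlonglongrightarrow> energy G w"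
    if le: "\<And>n. \<bar>energy G (u n) - energy G w\<bar> \<le> c * ?D n" for G c
  proof -
    have "(\<lambda>n. energy G (u n) - energy G w) \<longlonglongrightarrow> 0"
    proof (rule tendsto_0_le[OF D, where K = c])
      have "norm (energy G (u n) - energy G w) \<le> norm (?D n) * c" for n
        using le[of n] D0[of n] by (simp add: mult.commute)
      then show "\<forall>\<^sub>F n in sequentially. norm (energy G (u n) - energy G w) \<le> norm (?D n) * c"
        by (intro always_eventually allI)
    qed
    then show ?thesis by (rule LIM_zero_cancel)
  qed
  have "\<bar>energy norm (u n) - energy norm w\<bar> \<le> 1 * ?D n" for n
    by (rule energy_diff_le[OF u Aw, where B = L]) (simp_all add: norm_triangle_ineq3)
  then show "(\<lambda>n. energy norm (u n)) \<longlonglongrightarrow> energy norm w" by (rule conv)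
  have "\<bar>energy sq (u n) - energy sq w\<bar> \<le> 2 * L * ?D n" for n
  proof (rule energy_diff_le[OF u Aw, where B = "L\<^sup>2"])
    show "\<bar>sq a\<bar> \<le> L\<^sup>2" if "norm a \<le> L" for a using that by (simp add: power_mono)
    show "\<bar>sq a - sq b\<bar> \<le> 2 * L * norm (a - b)" if "norm a \<le> L" "norm b \<le> L" for a b
      using that by (rule sq_lipschitz)
  qed (use L in simp_all)
  then show "(\<lambda>n. energy sq (u n)) \<longlonglongrightarrow> energy sq w" by (rule conv)
qed

end

section \<open>Existence of the two-step minimiser\<close>

context haar begin

lemma energy_nonneg: "(\<And>v. G v \<ge> 0) \<Longrightarrow> energy G w \<ge> 0"
  unfolding energy_def by (intro integral_nonneg_AE) auto

lemma Adm_zero: "M \<le> L \<Longrightarrow> Adm L (\<lambda>x. 0)"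
  using order_trans[OF F_bound] by (simp add: Adm_def V_def Lip_const grad_eq[OF has_grad_const])

lemma energy_sq_bounded:
  assumes "Adm L v" shows "energy sq v \<le> L\<^sup>2 * measure lborel \<Omega>"
proof -
  have "energy sq v \<le> (\<integral>x. indicator \<Omega> x * L\<^sup>2 \<partial>lborel)"
    unfolding energy_def
    by (rule integral_mono_AE[OF integrable_energy_sq[OF assms] integrable_const_\<Omega>])
      (use AdmD(3)[OF assms] in eventually_elim, auto split: split_indicator intro: power_mono)
  then show ?thesis by (simp add: mult.commute)
qed

text \<open>Arzela-Ascoli on the closure of \<Omega>; outside \<Omega> all functions of the sequence
  are zero.\<close>

lemma Adm_pointwise_compact:
  assumes u: "\<And>n. Adm L (u n)" and L: "L \<ge> 0"
  obtains w and s :: "nat \<Rightarrow> nat" where "strict_mono s" "\<And>x. (\<lambda>n. u (s n) x) \<longlonglongrightarrow> w x"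
proof -
  obtain B where B: "\<And>n x. \<bar>u n x\<bar> \<le> B" using Adm_bound[OF L] u by metis
  define K where "K = real CARD('m) * (L + M) + 1"
  have K: "K > 0" using L M_pos by (simp add: K_def add_nonneg_pos)
  have lip: "\<bar>u n x - u n y\<bar> \<le> K * norm (x - y)" for n x y
  proof -
    have "real CARD('m) * (L + M) * norm (x - y) \<le> K * norm (x - y)"
      by (intro mult_right_mono) (simp_all add: K_def)
    then show ?thesis using Adm_lipschitz[OF u L, of n x y] by linarith
  qed
  have eq: "\<exists>d>0. \<forall>n y. y \<in> closure \<Omega> \<and> norm (x - y) < d \<longrightarrow> norm (u n x - u n y) < e" if "e > 0" for x e
  proof (intro exI[of _ "e / K"] conjI allI impI)
    show "e / K > 0" using K that by simp
    fix n y assume "y \<in> closure \<Omega> \<and> norm (x - y) < e / K"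
    then have "K * norm (x - y) < e" using K by (simp add: pos_less_divide_eq mult.commute)
    then show "norm (u n x - u n y) < e" using lip[of n x y] by simp
  qed
  have "compact (closure \<Omega>)" using bounded_\<Omega> by simp
  then obtain g s where s: "strict_mono (s :: nat \<Rightarrow> nat)" and
    g: "\<And>e. 0 < e \<Longrightarrow> \<exists>N. \<forall>n x. n \<ge> N \<and> x \<in> closure \<Omega> \<longrightarrow> norm (u (s n) x - g x) < e"
    by (rule Arzela_Ascoli[of "closure \<Omega>" u B]) (use B eq in auto)
  have "(\<lambda>n. u (s n) x) \<longlonglongrightarrow> (if x \<in> \<Omega> then g x else 0)" for x
  proof (cases "x \<in> \<Omega>")
    case True
    then have "x \<in> closure \<Omega>" using closure_subset by blast
    then show ?thesis using g True by (intro LIMSEQ_I) fastforce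
  qed (simp add: AdmD(2)[OF u])
  then show ?thesis by (rule that[OF s])
qed

text \<open>One sequence solves both problems. The convex sets \<open>C n\<close> of almost
  minimisers decrease, so the infima \<open>q n\<close> of the second energy over them increase to a
  limit \<open>q'\<close>. Choosing \<open>u n\<close> in \<open>C n\<close> almost optimal for the
  second energy gives Cauchy gradients, because midpoints stay in the larger of two such sets. A
  minimiser of the first energy lies in every \<open>C n\<close>, hence has second energy at least
  \<open>q'\<close>, the value attained by the limit.\<close>

lemma lex_min_exists:
  assumes L: "M \<le> L"
  obtains w where "lex_min L w"
proof -
  have L0: "L \<ge> 0" using L M_pos by simp
  define \<mu> where "\<mu> = Inf (energy norm ` Collect (Adm L))"
  have bdd: "bdd_below (energy norm ` S)" "bdd_below (energy sq ` S)" for S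
    by (intro bdd_belowI2[of _ 0] energy_nonneg; simp)+
  have \<mu>_le: "\<mu> \<le> energy norm v" if "Adm L v" for v
    unfolding \<mu>_def using that by (intro cINF_lower bdd) simp
  define C where "C n = {v. Adm L v \<and> energy norm v \<le> \<mu> + 1 / real (Suc n)}" for n
  have C_ne: "C n \<noteq> {}" for n
  proof -
    have "\<exists>v\<in>Collect (Adm L). energy norm v < \<mu> + 1 / real (Suc n)"
      unfolding \<mu>_def
      by (subst cINF_less_iff[symmetric]) (use Adm_zero[OF L] bdd in auto)
    then show ?thesis by (force simp: C_def)
  qed
  have C_mono: "C k \<subseteq> C n" if "n \<le> k" for n k
  proof -
    have "1 / real (Suc k) \<le> 1 / real (Suc n)" using that by (simp add: frac_le)
    then show ?thesis by (auto simp: C_def)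
  qed
  have C_mid: "(\<lambda>x. 1/2 * u x + 1/2 * v x) \<in> C n" if "u \<in> C n" "v \<in> C n" for u v n
    using Adm_convex[of L u v "1/2" "1/2"] energy_norm_convex[of L u v "1/2" "1/2"] that
    by (auto simp: C_def)
  define q where "q n = Inf (energy sq ` C n)" for n
  have q_le: "q n \<le> energy sq v" if "v \<in> C n" for n v
    unfolding q_def by (intro cINF_lower bdd that)
  have "\<exists>v. v \<in> C n \<and> energy sq v < q n + 1 / real (Suc n)" for n
  proof -
    have "\<exists>v\<in>C n. energy sq v < q n + 1 / real (Suc n)"
      unfolding q_def by (subst cINF_less_iff[symmetric]) (use C_ne bdd in auto)
    then show ?thesis by blast
  qed
  then obtain u where u: "\<And>n. u n \<in> C n" "\<And>n. energy sq (u n) < q n + 1 / real (Suc n)" by metis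
  have uA: "Adm L (u n)" for n using u(1)[of n] by (simp add: C_def)
  have q_mono: "q n \<le> q k" if "n \<le> k" for n k
    unfolding q_def by (rule cINF_superset_mono[OF C_ne bdd(2) C_mono[OF that]]) simp
  have q_bd: "q n \<le> L\<^sup>2 * measure lborel \<Omega>" for n
    using q_le[OF u(1)] energy_sq_bounded[OF uA] by (rule order_trans)
  obtain q' where q': "q \<longlonglongrightarrow> q'" "\<And>n. q n \<le> q'"
  proof -
    have "incseq q" using q_mono by (intro monoI)
    then show ?thesis using incseq_convergent[of q] q_bd that by blast
  qed
  have inv: "(\<lambda>n. 1 / real (Suc n)) \<longlonglongrightarrow> 0"
    using LIMSEQ_inverse_real_of_nat by (simp add: inverse_eq_divide)
  \<comment> \<open>For n \<le> k the second energies of \<open>u n\<close> and \<open>u k\<close>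
    are below \<open>q n + 1 / Suc n\<close> and \<open>q' + 1 / Suc n\<close>, and that of the
    midpoint is at least \<open>q n\<close>. The parallelogram law combines these to
    \<open>\<eta> n\<close>.\<close>
  define \<eta> where "\<eta> n = 2 * (q' - q n) + 4 * (1 / real (Suc n))" for n
  have \<eta>: "\<eta> \<longlonglongrightarrow> 0"
    using tendsto_add[OF tendsto_mult_left[OF tendsto_diff[OF tendsto_const[of q'] q'(1)], of 2] tendsto_mult_left[OF inv, of 4]]
    by (simp add: \<eta>_def[abs_def])
  let ?I = "\<lambda>n k. \<integral>x. indicator \<Omega> x * sq (grad (u n) x - grad (u k) x) \<partial>lborel"
  have I: "?I n k \<le> \<eta> n" if nk: "n \<le> k" for n k
  proof -
    have "q n \<le> energy sq (\<lambda>x. 1/2 * u n x + 1/2 * u k x)"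
      using C_mono[OF nk] u(1)[of k] by (intro q_le C_mid u) auto
    moreover have "1 / real (Suc k) \<le> 1 / real (Suc n)" using nk by (simp add: frac_le)
    ultimately show ?thesis
      using u(2)[of n] u(2)[of k] q'(2)[of k] q_mono[OF nk]
      unfolding energy_sq_parallelogram(2)[OF uA uA] \<eta>_def by argo
  qed
  obtain w and s :: "nat \<Rightarrow> nat" where s: "strict_mono s" and w: "\<And>x. (\<lambda>n. u (s n) x) \<longlonglongrightarrow> w x"
    using Adm_pointwise_compact[of L u, OF uA L0] by metis
  have cauchy: "\<exists>N. \<forall>n\<ge>N. \<forall>k\<ge>N. ?I (s n) (s k) \<le> e" if e: "e > 0" for e
  proof -
    obtain N where "\<forall>n\<ge>N. norm (\<eta> n - 0) < e" using LIMSEQ_D[OF \<eta> e] by blast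
    then have N: "\<eta> n < e" if "n \<ge> N" for n using that by (auto simp: abs_less_iff)
    have "?I (s n) (s k) \<le> e" if "n \<ge> N" "k \<ge> N" for n k
    proof -
      have sN: "s n \<ge> N" "s k \<ge> N"
        using that seq_suble[OF s, of n] seq_suble[OF s, of k] by linarith+
      have sym: "?I (s n) (s k) = ?I (s k) (s n)" by (simp add: norm_minus_commute)
      show ?thesis
      proof (cases "s n \<le> s k")
        case True
        then show ?thesis using I[OF True] N[OF sN(1)] by linarith
      next
        case False
        then have "s k \<le> s n" by simp
        then show ?thesis using I[of "s k" "s n"] N[OF sN(2)] sym by linarith
      qed
    qed
    then show ?thesis by blast
  qed
  note closed = Adm_closed[OF uA L0 w cauchy]
  have "(\<lambda>n. energy norm (u n)) \<longlonglongrightarrow> \<mu>"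
  proof (rule real_tendsto_sandwich[where f = "\<lambda>n. \<mu>"])
    show "(\<lambda>n. \<mu> + 1 / real (Suc n)) \<longlonglongrightarrow> \<mu>" using tendsto_add[OF tendsto_const inv] by simp
    show "\<forall>\<^sub>F n in sequentially. \<mu> \<le> energy norm (u n)" using \<mu>_le[OF uA] by simp
    show "\<forall>\<^sub>F n in sequentially. energy norm (u n) \<le> \<mu> + 1 / real (Suc n)"
      using u(1) by (simp add: C_def)
  qed simp
  from LIMSEQ_subseq_LIMSEQ[OF this s] closed(2) have wn: "energy norm w = \<mu>"
    by (auto simp: comp_def intro: LIMSEQ_unique)
  have "(\<lambda>n. energy sq (u n)) \<longlonglongrightarrow> q'"
  proof (rule real_tendsto_sandwich[OF _ _ q'(1)])
    show "(\<lambda>n. q n + 1 / real (Suc n)) \<longlonglongrightarrow> q'" using tendsto_add[OF q'(1) inv] by simp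
    show "\<forall>\<^sub>F n in sequentially. q n \<le> energy sq (u n)" using q_le[OF u(1)] by simp
    show "\<forall>\<^sub>F n in sequentially. energy sq (u n) \<le> q n + 1 / real (Suc n)"
      using u(2) by (intro always_eventually allI less_imp_le)
  qed
  from LIMSEQ_subseq_LIMSEQ[OF this s] closed(3) have ws: "energy sq w = q'"
    by (auto simp: comp_def intro: LIMSEQ_unique)
  have "q' \<le> energy sq v" if v: "Adm L v" "energy norm v = \<mu>" for v
  proof -
    have "v \<in> C n" for n using v by (simp add: C_def)
    then show ?thesis using q_le by (intro LIMSEQ_le_const2[OF q'(1)]) auto
  qed
  then have "lex_min L w"
    using closed(1) \<mu>_le wn ws by (auto simp: lex_min_def)
  then show ?thesis by (rule that)
qed

end

subsection \<open>Barriers\<close>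

lemma norm_sgn_diff_le:
  fixes a b :: "'a::real_normed_vector"
  assumes "a \<noteq> 0" "b \<noteq> 0"
  shows "norm (sgn a - sgn b) \<le> 2 * norm (a - b) / norm a"
proof -
  have "sgn a - sgn b = (a - b) /\<^sub>R norm a + ((norm b - norm a) / (norm a * norm b)) *\<^sub>R b"
  proof -
    have c: "(norm b - norm a) / (norm a * norm b) = inverse (norm a) - inverse (norm b)"
      using assms by (simp add: field_simps)
    show ?thesis unfolding c sgn_div_norm by (simp add: algebra_simps)
  qed
  also have "norm \<dots> \<le> norm ((a - b) /\<^sub>R norm a) + norm (((norm b - norm a) / (norm a * norm b)) *\<^sub>R b)"
    by (rule norm_triangle_ineq)
  also have "\<dots> = norm (a - b) / norm a + \<bar>norm b - norm a\<bar> / norm a"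
    using assms by (simp add: abs_mult divide_inverse)
  also have "\<dots> \<le> norm (a - b) / norm a + norm (a - b) / norm a"
    using norm_triangle_ineq3[of b a] by (intro add_left_mono divide_right_mono) (simp_all add: norm_minus_commute)
  finally show ?thesis by simp
qed

lemma Bessel_two:
  fixes v e f :: "'a::real_inner"
  assumes "norm e = 1" "norm f = 1" "e \<bullet> f = 0"
  shows "(v \<bullet> e)\<^sup>2 + (v \<bullet> f)\<^sup>2 \<le> (norm v)\<^sup>2"
proof -
  have ee: "e \<bullet> e = 1" "f \<bullet> f = 1" "f \<bullet> e = 0"
    using assms by (simp_all add: dot_square_norm inner_commute)
  have "0 \<le> (norm (v - (v \<bullet> e) *\<^sub>R e - (v \<bullet> f) *\<^sub>R f))\<^sup>2" by simp
  also have "\<dots> = (norm v)\<^sup>2 - (v \<bullet> e)\<^sup>2 - (v \<bullet> f)\<^sup>2"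
    unfolding power2_norm_eq_inner
    by (simp add: inner_simps inner_commute[of e v] inner_commute[of f v] ee assms(3) power2_eq_square)
  finally show ?thesis by simp
qed

lemma inner_axis_real: "v \<bullet> axis i (1::real) = v $ i"
  by (simp add: inner_axis)

lemma line_deriv_unit_component:
  fixes W :: "real^'m::finite \<Rightarrow> real^'m"
  assumes W: "((\<lambda>t. W (x + t *\<^sub>R axis i 1)) has_vector_derivative W') (at 0)" and nz: "W x \<noteq> 0"
  shows "line_deriv i (\<lambda>x. sgn (W x) $ i) x
    (W' $ i / norm (W x) - W x $ i * (W x \<bullet> W') / norm (W x) ^ 3)"
proof -
  let ?W = "\<lambda>t. W (x + t *\<^sub>R axis i 1)"
  have comp: "((\<lambda>t. ?W t $ i) has_real_derivative W' $ i) (at 0)"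
    using bounded_linear.has_vector_derivative[OF bounded_linear_vec_nth W, of i]
    by (simp add: has_real_derivative_iff_has_vector_derivative)
  have "((\<lambda>t. ?W t \<bullet> ?W t) has_real_derivative (2 * (W x \<bullet> W'))) (at 0)"
    using bounded_bilinear.has_vector_derivative[OF bounded_bilinear_inner W W]
    by (simp add: has_real_derivative_iff_has_vector_derivative inner_commute)
  from DERIV_chain'[OF this DERIV_real_sqrt]
  have "((\<lambda>t. sqrt (?W t \<bullet> ?W t)) has_real_derivative (W x \<bullet> W') / norm (W x)) (at 0)"
    using nz by (simp add: norm_eq_sqrt_inner field_simps)
  then have "((\<lambda>t. norm (?W t)) has_real_derivative (W x \<bullet> W') / norm (W x)) (at 0)"
    by (simp add: norm_eq_sqrt_inner)
  from DERIV_divide[OF comp this] nz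
  have "((\<lambda>t. ?W t $ i / norm (?W t)) has_real_derivative
      (W' $ i * norm (W x) - W x $ i * ((W x \<bullet> W') / norm (W x))) / (norm (W x) * norm (W x))) (at 0)"
    by simp
  moreover have "(W' $ i * norm (W x) - W x $ i * ((W x \<bullet> W') / norm (W x))) / (norm (W x) * norm (W x)) =
      W' $ i / norm (W x) - W x $ i * (W x \<bullet> W') / norm (W x) ^ 3"
    using nz by (simp add: field_simps power3_eq_cube)
  ultimately show ?thesis by (simp add: line_deriv_def sgn_div_norm divide_inverse mult.commute)
qed

locale haar_C1 = haar +
  fixes DF :: "'a \<Rightarrow> real^'a \<Rightarrow> real^'a"
  assumes DF: "x \<in> \<Omega> \<Longrightarrow> ((\<lambda>t. F (x + t *\<^sub>R axis i 1)) has_vector_derivative DF i x) (at 0)"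
    and DF_bound: "x \<in> \<Omega> \<Longrightarrow> norm (DF i x) \<le> M"

text \<open>\<open>f\<close> is the axis of the parabola at \<open>p\<close> and \<open>e\<close>
  the direction in which it curves. The bound \<open>2 * M\<close> for \<open>k\<close> keeps
  \<open>W\<close> away from zero, with \<open>W x \<bullet> f \<ge> k / 2\<close>; the bound for
  \<open>k * a\<close> makes the divergence of the unit field \<open>W / \<bar>W\<bar>\<close>
  negative.\<close>

locale barrier_at = haar_C1 +
  fixes a d k :: real and p e f :: "real^'a"
  assumes a_pos: "a > 0" and d_pos: "d > 0" and k_ge: "k \<ge> 2 * M"
    and k_gr: "k * a > 16 * real CARD('a) * M * (1 + 2 * a * d)\<^sup>2"
    and orthonormal: "norm e = 1" "norm f = 1" "e \<bullet> f = 0"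
    and parabola: "x \<in> \<Omega> \<Longrightarrow> a * ((x - p) \<bullet> e)\<^sup>2 < (x - p) \<bullet> f"
    and dist_le: "x \<in> \<Omega> \<Longrightarrow> norm (x - p) \<le> d"
begin

definition b :: "real^'a \<Rightarrow> real" where
  "b x = k * ((x - p) \<bullet> f - a * ((x - p) \<bullet> e)\<^sup>2)"

definition Db :: "real^'a \<Rightarrow> real^'a" where
  "Db x = k *\<^sub>R (f - (2 * a * ((x - p) \<bullet> e)) *\<^sub>R e)"

definition W :: "real^'a \<Rightarrow> real^'a" where
  "W x = Db x + F x"

definition DW :: "'a \<Rightarrow> real^'a \<Rightarrow> real^'a" where
  "DW i x = - (2 * a * k * e $ i) *\<^sub>R e + DF i x"

text \<open>The divergence of \<open>sgn (W x)\<close>, written out by the quotient rule.\<close>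

definition divN :: "real^'a \<Rightarrow> real" where
  "divN x = (\<Sum>i\<in>UNIV. DW i x $ i / norm (W x)
     - W x $ i * (W x \<bullet> DW i x) / norm (W x) ^ 3)"

text \<open>In \<Omega> the coordinate along \<open>e\<close> is at most \<open>d\<close> in
  absolute value, so \<open>k * d'\<close> bounds the gradient of \<open>b\<close>.\<close>

abbreviation d' :: real where "d' \<equiv> 1 + 2 * a * d"

lemma k_pos: "k > 0" using k_ge M_pos by simp

lemma d'_ge: "d' \<ge> 1" using a_pos d_pos by simp

lemma b_pos: "x \<in> \<Omega> \<Longrightarrow> b x > 0"
  using parabola[of x] k_pos by (simp add: b_def)

lemma abs_inner_e_le: "x \<in> \<Omega> \<Longrightarrow> \<bar>(x - p) \<bullet> e\<bar> \<le> d"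
  using Cauchy_Schwarz_ineq2[of "x - p" e] dist_le[of x] orthonormal by simp

lemma b_lipschitz:
  assumes "x \<in> \<Omega>" "y \<in> \<Omega>" shows "\<bar>b x - b y\<bar> \<le> k * d' * norm (x - y)"
proof -
  have "b x - b y = k * ((x - y) \<bullet> f - a * (((x - y) \<bullet> e) * ((x - p) \<bullet> e + (y - p) \<bullet> e)))"
    by (simp add: b_def inner_simps power2_eq_square algebra_simps)
  also have "\<bar>\<dots>\<bar> = k * \<bar>(x - y) \<bullet> f - a * (((x - y) \<bullet> e) * ((x - p) \<bullet> e + (y - p) \<bullet> e))\<bar>"
    using k_pos by (simp add: abs_mult)
  also have "\<dots> \<le> k * (norm (x - y) + a * (norm (x - y) * (d + d)))"
  proof (intro mult_left_mono)
    have "\<bar>a * (((x - y) \<bullet> e) * ((x - p) \<bullet> e + (y - p) \<bullet> e))\<bar> \<le> a * (norm (x - y) * (d + d))"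
      unfolding abs_mult using a_pos Cauchy_Schwarz_ineq2[of "x - y" e] orthonormal abs_inner_e_le[OF assms(1)] abs_inner_e_le[OF assms(2)]
      by (intro mult_mono mult_left_mono) (auto simp: abs_mult intro!: mult_mono)
    moreover have "\<bar>(x - y) \<bullet> f\<bar> \<le> norm (x - y)" using Cauchy_Schwarz_ineq2[of "x - y" f] orthonormal by simp
    ultimately show "\<bar>(x - y) \<bullet> f - a * (((x - y) \<bullet> e) * ((x - p) \<bullet> e + (y - p) \<bullet> e))\<bar> \<le> norm (x - y) + a * (norm (x - y) * (d + d))"
      by linarith
  qed (use k_pos in simp)
  finally show ?thesis by (simp add: algebra_simps)
qed

lemma has_grad_b: "has_grad b x (Db x)"
  unfolding has_grad_def line_deriv_def
proof
  fix i
  have "((\<lambda>t. k * (((x - p) \<bullet> f + t * f $ i) - a * ((x - p) \<bullet> e + t * e $ i)\<^sup>2)) has_real_derivative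
      k * (f $ i - a * (2 * ((x - p) \<bullet> e) * e $ i))) (at 0)"
    by (auto intro!: derivative_eq_intros)
  moreover have "b (x + t *\<^sub>R axis i 1) = k * (((x - p) \<bullet> f + t * f $ i) - a * ((x - p) \<bullet> e + t * e $ i)\<^sup>2)" for t
  proof -
    have eq: "(x + t *\<^sub>R axis i 1 - p) \<bullet> v = (x - p) \<bullet> v + t * v $ i" for v
      by (simp add: inner_simps inner_commute[of "axis i 1"] inner_axis_real)
    show ?thesis unfolding b_def eq ..
  qed
  moreover have "Db x $ i = k * (f $ i - a * (2 * ((x - p) \<bullet> e) * e $ i))"
    by (simp add: Db_def)
  ultimately show "((\<lambda>t. b (x + t *\<^sub>R axis i 1)) has_real_derivative Db x $ i) (at 0)" by simp
qed

lemma W_inner_f: "x \<in> \<Omega> \<Longrightarrow> W x \<bullet> f \<ge> k / 2"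
proof -
  assume x: "x \<in> \<Omega>"
  have "W x \<bullet> f = k * (f \<bullet> f) + F x \<bullet> f" using orthonormal by (simp add: W_def Db_def inner_simps)
  also have "f \<bullet> f = 1" using orthonormal by (simp add: dot_square_norm)
  finally show ?thesis
    using Cauchy_Schwarz_ineq2[of "F x" f] F_bound[OF x] orthonormal k_ge by simp
qed

lemma norm_W_ge: "x \<in> \<Omega> \<Longrightarrow> norm (W x) \<ge> k / 2"
  using W_inner_f[of x] Cauchy_Schwarz_ineq2[of "W x" f] orthonormal by simp

lemma W_nz: "x \<in> \<Omega> \<Longrightarrow> W x \<noteq> 0"
  using norm_W_ge[of x] k_pos by auto

lemma norm_W_le: "x \<in> \<Omega> \<Longrightarrow> norm (W x) \<le> k * d' + M"
proof -
  assume x: "x \<in> \<Omega>"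
  have "norm (f - (2 * a * ((x - p) \<bullet> e)) *\<^sub>R e) \<le> norm f + norm ((2 * a * ((x - p) \<bullet> e)) *\<^sub>R e)"
    by (rule norm_triangle_ineq4)
  also have "\<dots> = 1 + 2 * a * \<bar>(x - p) \<bullet> e\<bar>" using orthonormal a_pos by (simp add: abs_mult)
  also have "\<dots> \<le> d'" using abs_inner_e_le[OF x] a_pos by simp
  finally have "norm (Db x) \<le> k * d'" using k_pos by (simp add: Db_def)
  then show ?thesis unfolding W_def using norm_triangle_ineq[of "Db x" "F x"] F_bound[OF x] by linarith
qed

lemma W_deriv:
  assumes "x \<in> \<Omega>"
  shows "((\<lambda>t. W (x + t *\<^sub>R axis i 1)) has_vector_derivative DW i x) (at 0)"
proof -
  have eq: "(x + t *\<^sub>R axis i 1 - p) \<bullet> e = (x - p) \<bullet> e + t * e $ i" for t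
    by (simp add: inner_simps inner_commute[of "axis i 1"] inner_axis_real)
  have "((\<lambda>t. - (2 * a * k) * ((x - p) \<bullet> e + t * e $ i)) has_real_derivative - (2 * a * k * e $ i)) (at 0)"
    by (auto intro!: derivative_eq_intros)
  from has_vector_derivative_add[OF has_vector_derivative_scaleR[OF this has_vector_derivative_const[of e]]
      has_vector_derivative_const[of "k *\<^sub>R f"]]
  have "((\<lambda>t. (- (2 * a * k) * ((x - p) \<bullet> e + t * e $ i)) *\<^sub>R e + k *\<^sub>R f) has_vector_derivative - (2 * a * k * e $ i) *\<^sub>R e) (at 0)"
    by simp
  moreover have "Db (x + t *\<^sub>R axis i 1) = (- (2 * a * k) * ((x - p) \<bullet> e + t * e $ i)) *\<^sub>R e + k *\<^sub>R f" for t
    unfolding Db_def eq by (simp add: algebra_simps)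
  ultimately have "((\<lambda>t. Db (x + t *\<^sub>R axis i 1)) has_vector_derivative - (2 * a * k * e $ i) *\<^sub>R e) (at 0)"
    by simp
  from has_vector_derivative_add[OF this DF[OF assms]] show ?thesis unfolding W_def DW_def .
qed

lemma sgn_W_deriv:
  assumes "x \<in> \<Omega>"
  shows "line_deriv i (\<lambda>x. sgn (W x) $ i) x (DW i x $ i / norm (W x)
     - W x $ i * (W x \<bullet> DW i x) / norm (W x) ^ 3)"
  by (rule line_deriv_unit_component[OF W_deriv[OF assms] W_nz[OF assms]])

text \<open>The curvature of the parabola enters through the term \<open>- 2 a k\<close>, which for large \<open>k\<close>
  beats the derivatives of \<open>F\<close>.\<close>

lemma divN_neg:
  assumes x: "x \<in> \<Omega>"
  shows "divN x < 0"
proof -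
  let ?m = "real CARD('a)"
  have nW: "norm (W x) > 0" using W_nz[OF x] by simp
  have tr: "(\<Sum>i\<in>UNIV. DW i x $ i) = - (2 * a * k) + (\<Sum>i\<in>UNIV. DF i x $ i)"
  proof -
    have "(\<Sum>i\<in>UNIV. DW i x $ i) = - (2 * a * k) * (e \<bullet> e) + (\<Sum>i\<in>UNIV. DF i x $ i)"
      by (simp add: DW_def sum.distrib sum_subtractf sum_negf inner_vec_def sum_distrib_left mult.assoc)
    then show ?thesis using orthonormal by (simp add: dot_square_norm)
  qed
  have Q: "(\<Sum>i\<in>UNIV. W x $ i * (W x \<bullet> DW i x)) =
      - (2 * a * k) * (W x \<bullet> e)\<^sup>2 + (\<Sum>i\<in>UNIV. W x $ i * (W x \<bullet> DF i x))"
  proof -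
    have "(\<Sum>i\<in>UNIV. W x $ i * (W x \<bullet> DW i x)) =
       - (2 * a * k) * (\<Sum>i\<in>UNIV. W x $ i * e $ i) * (W x \<bullet> e) + (\<Sum>i\<in>UNIV. W x $ i * (W x \<bullet> DF i x))"
      by (simp add: DW_def inner_simps sum.distrib sum_subtractf sum_distrib_left sum_distrib_right sum_negf algebra_simps)
    also have "(\<Sum>i\<in>UNIV. W x $ i * e $ i) = W x \<bullet> e" by (simp add: inner_vec_def)
    finally show ?thesis by (simp add: power2_eq_square)
  qed
  have "\<bar>\<Sum>i\<in>UNIV. DF i x $ i\<bar> \<le> (\<Sum>i\<in>(UNIV::'a set). M)"
    by (rule order_trans[OF sum_abs sum_mono]) (use component_le_norm_cart DF_bound[OF x] order_trans in blast)
  then have trb: "(\<Sum>i\<in>UNIV. DF i x $ i) \<le> ?m * M" by simp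
  have "\<bar>W x $ i * (W x \<bullet> DF i x)\<bar> \<le> norm (W x) * (norm (W x) * M)" for i
    unfolding abs_mult
  proof (intro mult_mono component_le_norm_cart)
    show "\<bar>W x \<bullet> DF i x\<bar> \<le> norm (W x) * M"
      using Cauchy_Schwarz_ineq2[of "W x" "DF i x"] mult_left_mono[OF DF_bound[OF x, of i], of "norm (W x)"] by simp
  qed auto
  then have "\<bar>\<Sum>i\<in>UNIV. W x $ i * (W x \<bullet> DF i x)\<bar> \<le> (\<Sum>i\<in>(UNIV::'a set). norm (W x) * (norm (W x) * M))"
    by (intro order_trans[OF sum_abs sum_mono])
  then have Qb: "- (\<Sum>i\<in>UNIV. W x $ i * (W x \<bullet> DF i x)) \<le> ?m * M * (norm (W x))\<^sup>2"
    by (simp add: power2_eq_square mult_ac)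
  have "divN x * norm (W x) ^ 3 =
      (\<Sum>i\<in>UNIV. DW i x $ i) * (norm (W x))\<^sup>2
      - (\<Sum>i\<in>UNIV. W x $ i * (W x \<bullet> DW i x))"
  proof -
    have "(s / norm (W x) - t / norm (W x) ^ 3) * norm (W x) ^ 3 = s * (norm (W x))\<^sup>2 - t" for s t
      using nW by (simp add: field_simps power2_eq_square power3_eq_cube)
    then show ?thesis unfolding divN_def sum_distrib_right sum_subtractf[symmetric] by simp
  qed
  also have "\<dots> = - (2 * a * k) * ((norm (W x))\<^sup>2 - (W x \<bullet> e)\<^sup>2) + (\<Sum>i\<in>UNIV. DF i x $ i) * (norm (W x))\<^sup>2
      - (\<Sum>i\<in>UNIV. W x $ i * (W x \<bullet> DF i x))"
    unfolding tr Q by (simp add: algebra_simps)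
  also have "\<dots> \<le> - (2 * a * k) * (k / 2)\<^sup>2 + ?m * M * (norm (W x))\<^sup>2 + ?m * M * (norm (W x))\<^sup>2"
  proof -
    \<comment> \<open>The curvature term acts on the part of \<open>W\<close> orthogonal to
      \<open>e\<close>. By Bessel's inequality this part is at least as long as the component along
      \<open>f\<close>.\<close>
    have "(k / 2)\<^sup>2 \<le> (W x \<bullet> f)\<^sup>2" using W_inner_f[OF x] k_pos by (intro power_mono) auto
    also have "\<dots> \<le> (norm (W x))\<^sup>2 - (W x \<bullet> e)\<^sup>2" using Bessel_two[of e f "W x"] orthonormal by simp
    finally have "(2 * a * k) * (k / 2)\<^sup>2 \<le> (2 * a * k) * ((norm (W x))\<^sup>2 - (W x \<bullet> e)\<^sup>2)"
      using a_pos k_pos by (intro mult_left_mono) auto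
    moreover have "(\<Sum>i\<in>UNIV. DF i x $ i) * (norm (W x))\<^sup>2 \<le> ?m * M * (norm (W x))\<^sup>2"
      by (intro mult_right_mono trb) simp
    ultimately show ?thesis using Qb unfolding mult_minus_left by linarith
  qed
  also have "\<dots> \<le> - (2 * a * k) * (k / 2)\<^sup>2 + 2 * (?m * M * (2 * k * d')\<^sup>2)"
  proof -
    have "k * 1 \<le> k * d'" using d'_ge k_pos by (intro mult_left_mono) auto
    then have "norm (W x) \<le> 2 * k * d'" using norm_W_le[OF x] k_ge M_pos by linarith
    then have "(norm (W x))\<^sup>2 \<le> (2 * k * d')\<^sup>2" by (intro power_mono) auto
    then have "?m * M * (norm (W x))\<^sup>2 \<le> ?m * M * (2 * k * d')\<^sup>2"
      using M_pos by (intro mult_left_mono) auto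
    then show ?thesis by linarith
  qed
  \<comment> \<open>The curvature contributes a term of order \<open>k ^ 3\<close>, the derivatives
    of \<open>F\<close> one of order \<open>k ^ 2\<close>. Factoring out
    \<open>k\<^sup>2 / 2\<close> produces the constant 16 in the assumption on
    \<open>k * a\<close>.\<close>
  also have "\<dots> = k\<^sup>2 / 2 * (16 * ?m * M * d'\<^sup>2 - k * a)"
    by (simp add: power2_eq_square field_simps)
  also have "\<dots> < 0" using k_gr k_pos by (intro mult_pos_neg) auto
  finally show ?thesis using nW by (simp add: mult_less_0_iff zero_less_power)
qed

lemma sgn_W_lipschitz:
  assumes "x \<in> \<Omega>" "y \<in> \<Omega>"
  shows "norm (sgn (W x) - sgn (W y)) \<le> 4 / k * (2 * a * k + M) * norm (x - y)"
proof -
  have "W x - W y = (- 2 * a * k * ((x - y) \<bullet> e)) *\<^sub>R e + (F x - F y)"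
    by (simp add: W_def Db_def algebra_simps)
  then have "norm (W x - W y) \<le> norm ((- 2 * a * k * ((x - y) \<bullet> e)) *\<^sub>R e) + norm (F x - F y)"
    by (metis norm_triangle_ineq)
  also have "norm ((- 2 * a * k * ((x - y) \<bullet> e)) *\<^sub>R e) = 2 * a * k * \<bar>(x - y) \<bullet> e\<bar>"
    using orthonormal a_pos k_pos by (simp add: abs_mult)
  also have "\<dots> \<le> 2 * a * k * norm (x - y)"
    using Cauchy_Schwarz_ineq2[of "x - y" e] orthonormal a_pos k_pos by (intro mult_left_mono) auto
  finally have 1: "norm (W x - W y) \<le> (2 * a * k + M) * norm (x - y)"
    using F_lip[OF assms] by (simp add: algebra_simps)
  have "norm (sgn (W x) - sgn (W y)) \<le> 2 * norm (W x - W y) / norm (W x)"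
    using assms by (intro norm_sgn_diff_le W_nz)
  also have "\<dots> \<le> 2 * ((2 * a * k + M) * norm (x - y)) / (k / 2)"
    using 1 norm_W_ge[OF assms(1)] k_pos a_pos M_pos by (intro frac_le mult_left_mono) auto
  finally show ?thesis by (simp add: field_simps)
qed

text \<open>Calibration. Let \<eta> be the positive part of \<open>w - b\<close> in \<Omega> and
  \<open>N = W / \<bar>W\<bar>\<close>. The competitor \<open>z = w - \<eta>\<close> satisfies
  \<open>norm (V w) - norm (V z) \<ge> grad \<eta> \<bullet> N\<close>, and the right side is the
  divergence of \<open>\<eta> N\<close> minus \<open>\<eta> divN\<close>. The divergence integrates
  to zero, so minimality of \<open>w\<close> forces the integral of the nonnegative function
  \<open>- \<eta> divN\<close> to vanish; as \<open>divN\<close> is negative, \<eta> is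
  zero.\<close>

theorem barrier:
  assumes w: "Adm L w" and min: "\<And>v. Adm L v \<Longrightarrow> energy norm w \<le> energy norm v"
    and L: "k * d' + M \<le> L" and x0: "x0 \<in> \<Omega>"
  shows "w x0 \<le> b x0"
proof -
  have L0: "L \<ge> 0" using L M_pos k_pos d'_ge by (smt (verit) mult_nonneg_nonneg)
  define \<eta> where "\<eta> x = (if x \<in> \<Omega> then max 0 (w x - b x) else 0)" for x
  define K where "K = real CARD('a) * (L + M) + k * d'"
  have wK: "\<bar>w x - w y\<bar> \<le> K * norm (x - y)" for x y
  proof -
    have "real CARD('a) * (L + M) * norm (x - y) \<le> K * norm (x - y)"
      unfolding K_def using k_pos d'_ge by (intro mult_right_mono) auto
    then show ?thesis using Adm_lipschitz[OF w L0, of x y] by linarith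
  qed
  have \<eta>_in: "\<bar>\<eta> x - \<eta> y\<bar> \<le> K * norm (x - y)" if xy: "x \<in> \<Omega>" "y \<in> \<Omega>" for x y
  proof -
    have "\<bar>\<eta> x - \<eta> y\<bar> \<le> \<bar>w x - w y\<bar> + \<bar>b x - b y\<bar>" using xy by (simp add: \<eta>_def max_def abs_if)
    also have "\<dots> \<le> real CARD('a) * (L + M) * norm (x - y) + k * d' * norm (x - y)"
      by (intro add_mono Adm_lipschitz[OF w L0] b_lipschitz xy)
    finally show ?thesis by (simp add: K_def algebra_simps)
  qed
  \<comment> \<open>Since \<open>b\<close> is positive in \<Omega>, the truncation lies below the
    positive part of \<open>w\<close> and decays towards the complement at least as fast as
    \<open>w\<close>.\<close>
  have \<eta>_bd: "\<bar>\<eta> x\<bar> \<le> K * norm (x - y)" if xy: "x \<in> \<Omega>" "y \<notin> \<Omega>" for x y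
  proof -
    have "\<bar>\<eta> x\<bar> \<le> \<bar>w x - w y\<bar>" using xy b_pos[OF xy(1)] AdmD(2)[OF w xy(2)] by (simp add: \<eta>_def)
    then show ?thesis using wK[of x y] by linarith
  qed
  have \<eta>_nn: "\<eta> x \<ge> 0" and \<eta>_off: "x \<notin> \<Omega> \<Longrightarrow> \<eta> x = 0" for x by (simp_all add: \<eta>_def)
  have \<eta>_Lip: "Lip \<eta>" by (rule Lip_extend_zero[OF \<eta>_in \<eta>_bd \<eta>_off])
  have "bounded {x. \<eta> x \<noteq> 0}" by (rule bounded_subset[OF bounded_\<Omega>]) (use \<eta>_off in auto)
  then have \<eta>_LC: "LC \<eta>" using \<eta>_Lip by (simp add: LC_def)
  have op: "open {x \<in> \<Omega>. w x > b x}"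
  proof -
    have "continuous_on \<Omega> (\<lambda>x. w x - b x)"
      by (intro continuous_intros continuous_on_subset[OF Lip_continuous[OF AdmD(1)[OF w]]])
        (auto simp: b_def intro!: continuous_intros)
    then have "open ((\<lambda>x. w x - b x) -` {0<..} \<inter> \<Omega>)"
      by (subst (asm) continuous_on_open_vimage[OF open_\<Omega>]) auto
    moreover have "(\<lambda>x. w x - b x) -` {0<..} \<inter> \<Omega> = {x \<in> \<Omega>. w x > b x}" by auto
    ultimately show ?thesis by simp
  qed
  have \<eta>_grad: "AE x in lborel. grad \<eta> x = (if x \<in> \<Omega> \<and> w x > b x then V w x - W x else 0)"
    using Lip_has_grad_AE[OF AdmD(1)[OF w]] Lip_grad_zero_AE[OF \<eta>_Lip]
  proof eventually_elim
    case (elim x)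
    show ?case
    proof (cases "x \<in> \<Omega> \<and> w x > b x")
      case True
      have "has_grad \<eta> x (grad w x - Db x)"
        by (rule has_grad_transfer[OF has_grad_diff[OF elim(1) has_grad_b] op]) (use True in \<open>auto simp: \<eta>_def\<close>)
      then show ?thesis using True by (simp add: grad_eq V_def W_def)
    next
      case False
      then have "\<eta> x = 0" by (auto simp: \<eta>_def)
      then show ?thesis using elim(2) False by auto
    qed
  qed
  \<comment> \<open>Where \<open>w\<close> exceeds \<open>b\<close>, the vector \<open>V z\<close>
    equals \<open>W\<close>, of norm at most \<open>k * d' + M\<close>. This is the reason for the
    lower bound on \<open>L\<close>.\<close>
  define z where "z x = w x - \<eta> x" for x
  have z_Lip: "Lip z" unfolding z_def by (rule Lip_diff[OF AdmD(1)[OF w] \<eta>_Lip])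
  have Vz: "AE x in lborel. V z x = (if x \<in> \<Omega> \<and> w x > b x then W x else V w x)"
    using \<eta>_grad Lip_grad_diff_AE[OF AdmD(1)[OF w] \<eta>_Lip]
    by eventually_elim (auto simp: V_def z_def[abs_def])
  have z: "Adm L z"
    unfolding Adm_def
  proof (intro conjI allI impI)
    show "AE x in lborel. x \<in> \<Omega> \<longrightarrow> norm (V z x) \<le> L"
      using Vz AdmD(3)[OF w]
    proof eventually_elim
      case (elim x)
      then show ?case using norm_W_le[of x] L by auto
    qed
  qed (use z_Lip AdmD(2)[OF w] \<eta>_off in \<open>auto simp: z_def\<close>)
  \<comment> \<open>The components of \<open>\<eta> N\<close>. The field \<open>N\<close> is
    Lipschitz in \<Omega> only, but \<eta> decays at the boundary, so the products are Lipschitz on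
    the whole space.\<close>
  define g where "g i x = \<eta> x * (if x \<in> \<Omega> then sgn (W x) $ i else 0)" for i x
  have N1: "\<bar>sgn (W x) $ i\<bar> \<le> 1" for x i
    by (rule order_trans[OF component_le_norm_cart]) (simp add: norm_sgn)
  obtain B where B: "B \<ge> 0" "\<And>x. \<bar>\<eta> x\<bar> \<le> B" using LC_bounded[OF \<eta>_LC] by metis
  define K' where "K' = K + B * (4 / k * (2 * a * k + M))"
  have g_Lip: "Lip (g i)" for i
  proof (rule Lip_extend_zero[where C = K'])
    have K'_ge: "K * norm v \<le> K' * norm v" for v :: "real^'a"
      unfolding K'_def using B(1) k_pos a_pos M_pos by (intro mult_right_mono) auto
    fix x y assume x: "x \<in> \<Omega>"
    { assume y: "y \<in> \<Omega>"
      have s: "\<bar>sgn (W x) $ i - sgn (W y) $ i\<bar> \<le> 4 / k * (2 * a * k + M) * norm (x - y)"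
        using component_le_norm_cart[of "sgn (W x) - sgn (W y)" i] sgn_W_lipschitz[OF x y] by simp
      have "g i x - g i y = (\<eta> x - \<eta> y) * sgn (W x) $ i + \<eta> y * (sgn (W x) $ i - sgn (W y) $ i)"
        using x y by (simp add: g_def algebra_simps)
      then have "\<bar>g i x - g i y\<bar> \<le> \<bar>\<eta> x - \<eta> y\<bar> * \<bar>sgn (W x) $ i\<bar> + \<bar>\<eta> y\<bar> * \<bar>sgn (W x) $ i - sgn (W y) $ i\<bar>"
        using abs_triangle_ineq by (simp add: abs_mult[symmetric])
      also have "\<dots> \<le> (K * norm (x - y)) * 1 + B * (4 / k * (2 * a * k + M) * norm (x - y))"
        using s N1[of x i] \<eta>_in[OF x y] B by (intro add_mono mult_mono) auto
      finally show "\<bar>g i x - g i y\<bar> \<le> K' * norm (x - y)" by (simp add: K'_def algebra_simps) }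
    { assume y: "y \<notin> \<Omega>"
      have "\<bar>g i x\<bar> \<le> \<bar>\<eta> x\<bar> * 1" unfolding g_def abs_mult using N1[of x i] by (intro mult_left_mono) auto
      then show "\<bar>g i x\<bar> \<le> K' * norm (x - y)" using \<eta>_bd[OF x y] K'_ge[of "x - y"] by linarith }
  qed (simp add: g_def \<eta>_off)
  have g_LC: "LC (g i)" for i
    unfolding LC_def
    by (intro conjI g_Lip bounded_subset[OF bounded_\<Omega>, of "{x. g i x \<noteq> 0}"]) (auto simp: g_def)
  define S where "S x = (\<Sum>i\<in>UNIV. pd i (g i) x)" for x
  have S_int: "integrable lborel S" and S_0: "(\<integral>x. S x \<partial>lborel) = 0"
    unfolding S_def using LC_pd_integral_zero[OF g_LC] by (simp_all add: Bochner_Integration.integral_sum)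
  have g_pd: "AE x in lborel. \<forall>i. pd i (g i) x = (if x \<in> \<Omega> then pd i \<eta> x * sgn (W x) $ i + \<eta> x *
      (DW i x $ i / norm (W x)
        - W x $ i * (W x \<bullet> DW i x) / norm (W x) ^ 3) else 0)"
  proof -
    have "AE x in lborel. \<forall>i. g i x = 0 \<longrightarrow> grad (g i) x = 0"
      using Lip_grad_zero_AE[OF g_Lip] by (intro AE_all_countable[THEN iffD2] allI) auto
    with Lip_has_grad_AE[OF \<eta>_Lip] show ?thesis
    proof eventually_elim
      case (elim x)
      show ?case
      proof
        fix i
        show "pd i (g i) x = (if x \<in> \<Omega> then pd i \<eta> x * sgn (W x) $ i + \<eta> x *
          (DW i x $ i / norm (W x)
            - W x $ i * (W x \<bullet> DW i x) / norm (W x) ^ 3) else 0)"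
        proof (cases "x \<in> \<Omega>")
          case True
          have "line_deriv i \<eta> x (pd i \<eta> x)" using elim(1) by (simp add: has_grad_iff)
          note D = line_deriv_mult[OF this sgn_W_deriv[OF True, of i]]
          have "pd i (g i) x = pd i \<eta> x * sgn (W x) $ i + (DW i x $ i / norm (W x)
            - W x $ i * (W x \<bullet> DW i x) / norm (W x) ^ 3) * \<eta> x"
            by (rule pd_eq, rule line_deriv_transfer[OF D open_\<Omega> True]) (simp add: g_def)
          then show ?thesis using True by (simp add: mult.commute)
        next
          case False
          then have "grad (g i) x = 0" using elim(2) by (simp add: g_def)
          then show ?thesis using False by (simp add: vec_eq_iff)
        qed
      qed
    qed
  qed
  \<comment> \<open>The energy gained by truncation, minus a divergence: a function that is
    nonnegative pointwise and whose integral is nonpositive by minimality.\<close>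
  let ?T = "\<lambda>x. indicator \<Omega> x * norm (V w x) - indicator \<Omega> x * norm (V z x) - S x"
  have T: "AE x in lborel. ?T x \<ge> - (if x \<in> \<Omega> then \<eta> x * divN x else 0)"
    using g_pd \<eta>_grad Vz
  proof eventually_elim
    case (elim x)
    show ?case
    proof (cases "x \<in> \<Omega>")
      case True
      have "S x = (\<Sum>i\<in>UNIV. pd i \<eta> x * sgn (W x) $ i) + \<eta> x * divN x"
        unfolding S_def divN_def using elim(1) True by (simp add: sum.distrib sum_distrib_left)
      also have "(\<Sum>i\<in>UNIV. pd i \<eta> x * sgn (W x) $ i) = grad \<eta> x \<bullet> sgn (W x)"
        by (simp add: inner_vec_def)
      finally have S: "S x = grad \<eta> x \<bullet> sgn (W x) + \<eta> x * divN x" .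
      have "grad \<eta> x \<bullet> sgn (W x) \<le> norm (V w x) - norm (V z x)"
      proof (cases "w x > b x")
        case gt: True
        have "W x \<bullet> sgn (W x) = norm (W x)"
          using W_nz[OF True] by (simp add: sgn_div_norm dot_square_norm power2_eq_square)
        moreover have "V w x \<bullet> sgn (W x) \<le> norm (V w x)"
          using Cauchy_Schwarz_ineq2[of "V w x" "sgn (W x)"] W_nz[OF True] by (simp add: norm_sgn)
        ultimately show ?thesis using elim(2,3) True gt by (simp add: inner_diff_left)
      next
        case False
        then show ?thesis using elim(2,3) by simp
      qed
      then show ?thesis using S True by simp
    next
      case False
      then have "S x = 0" unfolding S_def using elim(1) by simp
      then show ?thesis using False by simp
    qed
  qed
  have T_nn: "AE x in lborel. ?T x \<ge> 0"
    using T
  proof eventually_elim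
    case (elim x)
    have "(if x \<in> \<Omega> then \<eta> x * divN x else 0) \<le> 0"
      using divN_neg[of x] \<eta>_nn[of x] by (auto intro: mult_nonneg_nonpos)
    then show ?case using elim by linarith
  qed
  note iw = integrable_energy_norm[OF w] and iz = integrable_energy_norm[OF z]
  have T_int: "integrable lborel ?T" using iw iz S_int by simp
  have "(\<integral>x. ?T x \<partial>lborel) = energy norm w - energy norm z"
    using iw iz S_int S_0 by (simp add: energy_def)
  also have "\<dots> \<le> 0" using min[OF z] by simp
  finally have "(\<integral>x. ?T x \<partial>lborel) = 0" using integral_nonneg_AE[OF T_nn] by linarith
  then have T0: "AE x in lborel. ?T x = 0" using integral_nonneg_eq_0_iff_AE[OF T_int T_nn] by simp
  have "AE x in lborel. \<eta> x = 0"
    using T T0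
  proof eventually_elim
    case (elim x)
    show ?case
    proof (cases "x \<in> \<Omega>")
      case True
      then have "\<eta> x * divN x \<ge> 0" using elim by simp
      then show ?thesis using divN_neg[OF True] \<eta>_nn[of x] by (auto simp: zero_le_mult_iff)
    qed (rule \<eta>_off)
  qed
  then have "\<eta> x0 = 0" by (rule AE_lborel_continuous_zero[OF Lip_continuous[OF \<eta>_Lip]])
  then show ?thesis using x0 by (simp add: \<eta>_def)
qed

end

subsection \<open>Comparison with translates\<close>

context haar begin

lemma Adm_mono: "Adm L w \<Longrightarrow> L \<le> L' \<Longrightarrow> Adm L' w"
proof -
  assume w: "Adm L w" and L: "L \<le> L'"
  have "AE x in lborel. x \<in> \<Omega> \<longrightarrow> norm (V w x) \<le> L'"
    using AdmD(3)[OF w] by eventually_elim (use L in auto)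
  then show ?thesis using w by (simp add: Adm_def)
qed

text \<open>The problem is symmetric under changing the signs of \<open>w\<close> and
  \<open>F\<close> together; this turns upper barriers into lower ones.\<close>

lemma haar_uminus: "haar \<Omega> (\<lambda>x. - F x) M"
proof unfold_locales
  show "norm (- F x - - F y) \<le> M * norm (x - y)" if "x \<in> \<Omega>" "y \<in> \<Omega>" for x y
    using F_lip[OF that] by (simp add: norm_minus_commute)
qed (use open_\<Omega> bounded_\<Omega> M_pos F_bound in auto)

lemma V_uminus_AE:
  assumes "Lip w" shows "AE x in lborel. haar.V (\<lambda>x. - F x) (\<lambda>x. - w x) x = - V w x"
proof -
  interpret neg: haar \<Omega> "\<lambda>x. - F x" M by (rule haar_uminus)
  from Lip_has_grad_AE[OF assms] show ?thesis
    by eventually_elim (simp add: V_def neg.V_def grad_eq[OF has_grad_uminus])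
qed

lemma Adm_uminus:
  assumes "Adm L w" shows "haar.Adm \<Omega> (\<lambda>x. - F x) L (\<lambda>x. - w x)"
proof -
  interpret neg: haar \<Omega> "\<lambda>x. - F x" M by (rule haar_uminus)
  have "AE x in lborel. x \<in> \<Omega> \<longrightarrow> norm (neg.V (\<lambda>x. - w x) x) \<le> L"
    using AdmD(3)[OF assms] V_uminus_AE[OF AdmD(1)[OF assms]] by eventually_elim simp
  then show ?thesis using assms by (simp add: neg.Adm_def Adm_def Lip_uminus)
qed

lemma energy_uminus:
  assumes "Adm L w" shows "haar.energy \<Omega> (\<lambda>x. - F x) norm (\<lambda>x. - w x) = energy norm w"
proof -
  interpret neg: haar \<Omega> "\<lambda>x. - F x" M by (rule haar_uminus)
  show ?thesis unfolding energy_def neg.energy_def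
  proof (rule integral_cong_AE)
    show "AE x in lborel. indicator \<Omega> x * norm (neg.V (\<lambda>x. - w x) x) = indicator \<Omega> x * norm (V w x)"
      using V_uminus_AE[OF AdmD(1)[OF assms]] by eventually_elim simp
  qed (use integrable_energy_norm[OF assms] neg.integrable_energy_norm[OF Adm_uminus[OF assms]] in auto)
qed

end

text \<open>In \<open>translates\<close> the bound \<open>M * norm h\<close> enters the final
  Lipschitz constant, while \<open>C\<close> may depend on \<open>h\<close> and only ensures that
  the exchanged functions are Lipschitz.\<close>

locale haar_problem = haar_C1 +
  fixes a d :: real
  assumes a_pos: "a > 0" and d_pos: "d > 0"
    and parabolas: "p \<in> frontier \<Omega> \<Longrightarrow> \<exists>e f. norm e = 1 \<and> norm f = 1 \<and> e \<bullet> f = 0 \<and>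
        (\<forall>x\<in>\<Omega>. a * ((x - p) \<bullet> e)\<^sup>2 < (x - p) \<bullet> f)"
    and diam: "p \<in> frontier \<Omega> \<Longrightarrow> x \<in> \<Omega> \<Longrightarrow> norm (x - p) \<le> d"
    and translates: "\<exists>g C. (\<forall>x. x \<in> \<Omega> \<longrightarrow> x + h \<in> \<Omega> \<longrightarrow> \<bar>g x\<bar> \<le> M * norm h \<and> has_grad g x (F (x + h) - F x)) \<and>
        (\<forall>x y. x \<in> \<Omega> \<longrightarrow> x + h \<in> \<Omega> \<longrightarrow> y \<in> \<Omega> \<longrightarrow> y + h \<in> \<Omega> \<longrightarrow> \<bar>g x - g y\<bar> \<le> C * norm (x - y))"
begin

text \<open>The first two summands answer the two lower bounds on \<open>k\<close> in
  \<open>barrier_at\<close>. The value is the same for every boundary point and does not involve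
  \<open>L\<close>.\<close>

definition k :: real where
  "k = 2 * M + (16 * real CARD('a) * M * (1 + 2 * a * d)\<^sup>2) / a + 1"

lemma k_ge: "k \<ge> 2 * M" and k_gr: "k * a > 16 * real CARD('a) * M * (1 + 2 * a * d)\<^sup>2"
proof -
  have "(16 * real CARD('a) * M * (1 + 2 * a * d)\<^sup>2) / a \<ge> 0" using a_pos M_pos by simp
  then show "k \<ge> 2 * M" by (simp add: k_def)
  have "k * a = 2 * M * a + 16 * real CARD('a) * M * (1 + 2 * a * d)\<^sup>2 + a"
    using a_pos by (simp add: k_def field_simps)
  moreover have "2 * M * a > 0" using a_pos M_pos by simp
  ultimately show "k * a > 16 * real CARD('a) * M * (1 + 2 * a * d)\<^sup>2" using a_pos by linarith
qed

lemma k_pos: "k > 0" using k_ge M_pos by simp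

lemma upper_bound:
  assumes w: "Adm L w" and min: "\<And>v. Adm L v \<Longrightarrow> energy norm w \<le> energy norm v"
    and L: "k * (1 + 2 * a * d) + M \<le> L" and x: "x \<in> \<Omega>" and p: "p \<in> frontier \<Omega>"
  shows "w x \<le> k * norm (x - p)"
proof -
  obtain e f where ef: "norm e = 1" "norm f = 1" "e \<bullet> f = 0" and par: "\<forall>x\<in>\<Omega>. a * ((x - p) \<bullet> e)\<^sup>2 < (x - p) \<bullet> f"
    using parabolas[OF p] by blast
  interpret barrier_at \<Omega> F M DF a d k p e f
    by unfold_locales (use a_pos d_pos k_ge k_gr ef par diam[OF p] in auto)
  have "w x \<le> b x" by (rule barrier[OF w min L x])
  also have "\<dots> \<le> k * ((x - p) \<bullet> f)" unfolding b_def using k_pos a_pos by (intro mult_left_mono) auto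
  also have "\<dots> \<le> k * norm (x - p)"
    using Cauchy_Schwarz_ineq2[of "x - p" f] ef k_pos by (intro mult_left_mono) auto
  finally show ?thesis .
qed

text \<open>The segment from \<open>x\<close> to a point outside \<Omega> meets the frontier at a
  point no farther from \<open>x\<close>, where the barrier applies. The lower estimate is the upper
  one for \<open>- w\<close> and \<open>- F\<close>, with the same \<open>k\<close> because
  \<open>k\<close> is built from \<open>M\<close>, \<open>a\<close>, \<open>d\<close> and the
  dimension alone.\<close>

lemma boundary_estimate:
  assumes w: "Adm L w" and min: "\<And>v. Adm L v \<Longrightarrow> energy norm w \<le> energy norm v"
    and L: "k * (1 + 2 * a * d) + M \<le> L" and y: "y \<notin> \<Omega>"
  shows "\<bar>w x\<bar> \<le> k * norm (x - y)"
proof (cases "x \<in> \<Omega>")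
  case False
  then show ?thesis using AdmD(2)[OF w] k_pos by simp
next
  case x: True
  have "closed_segment x y \<inter> frontier \<Omega> \<noteq> {}"
    by (rule connected_Int_frontier) (use x y in auto)
  then obtain p where p: "p \<in> closed_segment x y" "p \<in> frontier \<Omega>" by blast
  have "k * norm (x - p) \<le> k * norm (x - y)"
    using segment_bound(1)[OF p(1)] k_pos by (intro mult_left_mono) (auto simp: norm_minus_commute)
  moreover have "w x \<le> k * norm (x - p)" by (rule upper_bound[OF w min L x p(2)])
  moreover have "- w x \<le> k * norm (x - p)"
  proof -
    interpret neg: haar_problem \<Omega> "\<lambda>x. - F x" M "\<lambda>i x. - DF i x" a d
    proof (intro haar_problem.intro haar_C1.intro haar_uminus haar_C1_axioms.intro haar_problem_axioms.intro)
      show "((\<lambda>t. - F (x + t *\<^sub>R axis i 1)) has_vector_derivative - DF i x) (at 0)" if "x \<in> \<Omega>" for x i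
        by (rule has_vector_derivative_minus[OF DF[OF that]])
      show "norm (- DF i x) \<le> M" if "x \<in> \<Omega>" for x i using DF_bound[OF that] by simp
    next
      fix h
      obtain g C where g: "\<And>x. x \<in> \<Omega> \<Longrightarrow> x + h \<in> \<Omega> \<Longrightarrow> \<bar>g x\<bar> \<le> M * norm h \<and> has_grad g x (F (x + h) - F x)"
        and C: "\<And>x y. x \<in> \<Omega> \<Longrightarrow> x + h \<in> \<Omega> \<Longrightarrow> y \<in> \<Omega> \<Longrightarrow> y + h \<in> \<Omega> \<Longrightarrow> \<bar>g x - g y\<bar> \<le> C * norm (x - y)"
        using translates[of h] by blast
      have "\<bar>- g x\<bar> \<le> M * norm h \<and> has_grad (\<lambda>x. - g x) x (- F (x + h) - - F x)" if "x \<in> \<Omega>" "x + h \<in> \<Omega>" for x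
        using g[OF that] has_grad_uminus[of g x "F (x + h) - F x"] by simp
      moreover have "\<bar>- g x - - g y\<bar> \<le> C * norm (x - y)" if "x \<in> \<Omega>" "x + h \<in> \<Omega>" "y \<in> \<Omega>" "y + h \<in> \<Omega>" for x y
        using C[OF that] by (simp add: abs_minus_commute)
      ultimately show "\<exists>g C. (\<forall>x. x \<in> \<Omega> \<longrightarrow> x + h \<in> \<Omega> \<longrightarrow> \<bar>g x\<bar> \<le> M * norm h \<and> has_grad g x (- F (x + h) - - F x)) \<and>
        (\<forall>x y. x \<in> \<Omega> \<longrightarrow> x + h \<in> \<Omega> \<longrightarrow> y \<in> \<Omega> \<longrightarrow> y + h \<in> \<Omega> \<longrightarrow> \<bar>g x - g y\<bar> \<le> C * norm (x - y))"
        by (intro exI[of _ "\<lambda>x. - g x"] exI[of _ C]) blast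
    next
      show "0 < a" "0 < d" by (rule a_pos d_pos)+
      show "\<exists>e f. norm e = 1 \<and> norm f = 1 \<and> e \<bullet> f = 0 \<and> (\<forall>x\<in>\<Omega>. a * ((x - p) \<bullet> e)\<^sup>2 < (x - p) \<bullet> f)"
        if "p \<in> frontier \<Omega>" for p using that by (rule parabolas)
      show "norm (x - p) \<le> d" if "p \<in> frontier \<Omega>" "x \<in> \<Omega>" for p x using that by (rule diam)
    qed
    have negmin: "neg.energy norm (\<lambda>x. - w x) \<le> neg.energy norm v" if v: "neg.Adm L v" for v
    proof -
      have "Adm L (\<lambda>x. - v x)" using neg.Adm_uminus[OF v] by simp
      from min[OF this] show ?thesis
        using neg.energy_uminus[OF v] energy_uminus[OF w] by simp
    qed
    show ?thesis by (rule neg.upper_bound[OF Adm_uminus[OF w] negmin L x p(2)])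
  qed
  ultimately show ?thesis by linarith
qed

text \<open>Haar's trick: replacing \<open>w\<close> by \<open>w(\<cdot> + h) + g + c\<close> where the latter is smaller, and \<open>w(\<cdot> + h)\<close> by
  \<open>w - g - c\<close> there, leaves the sum of the energies unchanged.\<close>

lemma translation_estimate:
  assumes w: "lex_min L w" and L: "k * (1 + 2 * a * d) + M \<le> L"
    and x0: "x0 \<in> \<Omega>" "x0 + h \<in> \<Omega>"
  shows "w x0 - w (x0 + h) \<le> (k + 2 * M) * norm h"
proof -
  have Aw: "Adm L w" and min: "\<And>v. Adm L v \<Longrightarrow> energy norm w \<le> energy norm v"
    and min2: "\<And>v. Adm L v \<Longrightarrow> energy norm v = energy norm w \<Longrightarrow> energy sq w \<le> energy sq v"
    using w by (auto simp: lex_min_def)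
  have "k * (1 + 2 * a * d) \<ge> 0" using k_pos a_pos d_pos by simp
  then have L0: "L \<ge> 0" using L M_pos by linarith
  note bdry = boundary_estimate[OF Aw min L]
  obtain g C where g_bd: "\<And>x. x \<in> \<Omega> \<Longrightarrow> x + h \<in> \<Omega> \<Longrightarrow> \<bar>g x\<bar> \<le> M * norm h"
    and g_grad: "\<And>x. x \<in> \<Omega> \<Longrightarrow> x + h \<in> \<Omega> \<Longrightarrow> has_grad g x (F (x + h) - F x)"
    and g_lip: "\<And>x y. x \<in> \<Omega> \<Longrightarrow> x + h \<in> \<Omega> \<Longrightarrow> y \<in> \<Omega> \<Longrightarrow> y + h \<in> \<Omega> \<Longrightarrow> \<bar>g x - g y\<bar> \<le> C * norm (x - y)"
    using translates[of h] by blast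
  \<comment> \<open>\<open>k * norm h\<close> covers the variation of \<open>w\<close> at the
    boundary over the distance \<open>norm h\<close>, and \<open>M * norm h\<close> covers the size
    of \<open>g\<close>. With this choice the difference of \<open>w\<close> and the corrected
    translate is not positive at the edge of \<open>U\<close>.\<close>
  define c where "c = (k + M) * norm h"
  define U where "U = {x \<in> \<Omega>. x + h \<in> \<Omega>}"
  define \<theta> where "\<theta> x = (if x \<in> U then max 0 (w x - w (x + h) - g x - c) else 0)" for x
  define K where "K = real CARD('a) * (L + M)"
  have wK: "\<bar>w x - w y\<bar> \<le> K * norm (x - y)" for x y
    unfolding K_def by (rule Adm_lipschitz[OF Aw L0])
  have wK': "\<bar>w (x + h) - w (y + h)\<bar> \<le> K * norm (x - y)" for x y
    using wK[of "x + h" "y + h"] by simp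
  have \<theta>_Lip: "Lip \<theta>"
  proof (rule Lip_extend_zero[where U = U and C = "2 * K + \<bar>C\<bar>"])
    fix x y assume x: "x \<in> U"
    have C': "C * norm (x - y) \<le> \<bar>C\<bar> * norm (x - y)" by (intro mult_right_mono) auto
    { assume y: "y \<in> U"
      have "\<bar>\<theta> x - \<theta> y\<bar> \<le> \<bar>w x - w y\<bar> + \<bar>w (x + h) - w (y + h)\<bar> + \<bar>g x - g y\<bar>"
        using x y by (simp add: \<theta>_def)
      also have "\<dots> \<le> (2 * K + \<bar>C\<bar>) * norm (x - y)"
        using wK[of x y] wK'[of x y] g_lip[of x y] x y C' by (simp add: U_def algebra_simps)
      finally show "\<bar>\<theta> x - \<theta> y\<bar> \<le> (2 * K + \<bar>C\<bar>) * norm (x - y)" . }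
    { assume y: "y \<notin> U"
      \<comment> \<open>One of \<open>y\<close> and \<open>y + h\<close> lies outside \<Omega>,
        where \<open>w\<close> is zero; the boundary estimate bounds the other value.\<close>
      have "w y - w (y + h) \<le> k * norm h"
      proof (cases "y \<in> \<Omega>")
        case True
        then have "y + h \<notin> \<Omega>" using y by (simp add: U_def)
        then show ?thesis using bdry[of "y + h" y] AdmD(2)[OF Aw] by simp
      next
        case False
        then show ?thesis using bdry[of y "y + h"] AdmD(2)[OF Aw False] by simp
      qed
      moreover have "- g x \<le> M * norm h" using g_bd[of x] x by (simp add: U_def)
      moreover have "c = k * norm h + M * norm h" by (simp add: c_def algebra_simps)
      ultimately have "\<theta> x \<le> \<bar>w x - w y\<bar> + \<bar>w (x + h) - w (y + h)\<bar>"
        using x by (simp add: \<theta>_def)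
      also have "\<dots> \<le> 2 * K * norm (x - y)" using wK[of x y] wK'[of x y] by simp
      also have "\<dots> \<le> (2 * K + \<bar>C\<bar>) * norm (x - y)" by (intro mult_right_mono) auto
      finally show "\<bar>\<theta> x\<bar> \<le> (2 * K + \<bar>C\<bar>) * norm (x - y)" by (simp add: \<theta>_def split: if_splits) }
  qed (simp add: \<theta>_def)
  define A where "A = {x. \<theta> x > 0}"
  have A: "open A" unfolding A_def
    by (intro open_Collect_less Lip_continuous \<theta>_Lip continuous_intros)
  have A_eq: "x \<in> A \<longleftrightarrow> x \<in> U \<and> w x - w (x + h) - g x - c > 0" for x
    by (auto simp: A_def \<theta>_def)
  have \<theta>_nn: "\<theta> x \<ge> 0" for x by (simp add: \<theta>_def)
  have \<theta>_A: "x \<notin> A \<Longrightarrow> \<theta> x = 0" for x using \<theta>_nn[of x] by (simp add: A_def)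
  note w_grad = Lip_has_grad_AE[OF AdmD(1)[OF Aw]]
  have \<theta>_grad: "AE x in lborel. has_grad \<theta> x (if x \<in> A then V w x - V w (x + h) else 0)"
    using w_grad AE_lborel_translate[OF w_grad, of h] Lip_grad_zero_AE[OF \<theta>_Lip] Lip_has_grad_AE[OF \<theta>_Lip]
  proof eventually_elim
    case (elim x)
    show ?case
    proof (cases "x \<in> A")
      case True
      then have x: "x \<in> \<Omega>" "x + h \<in> \<Omega>" by (auto simp: A_eq U_def)
      \<comment> \<open>The gradient of \<open>g\<close> turns the difference of the gradients of
        \<open>w\<close> into the difference of the values of \<open>V w\<close>, which is what the
        energies see.\<close>
      have "has_grad (\<lambda>x. w x - w (x + h) - g x - c) x (grad w x - grad w (x + h) - (F (x + h) - F x) - 0)"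
        by (intro has_grad_diff has_grad_const elim g_grad x) (use elim(2) in \<open>simp add: has_grad_translate\<close>)
      from has_grad_transfer[OF this A True, of \<theta>]
      have "has_grad \<theta> x (grad w x - grad w (x + h) - (F (x + h) - F x) - 0)"
        by (simp add: A_eq \<theta>_def)
      also have "grad w x - grad w (x + h) - (F (x + h) - F x) - 0 = V w x - V w (x + h)" by (simp add: V_def)
      finally show ?thesis using True by simp
    next
      case False
      then show ?thesis using elim(3,4) \<theta>_A[OF False] by simp
    qed
  qed
  define u1 where "u1 x = w x - \<theta> x" for x
  \<comment> \<open>If \<open>x - h\<close> is in \<open>A\<close>, this is
    \<open>w (x - h) - g (x - h) - c\<close>, so that \<open>V u2 x\<close> equals
    \<open>V w (x - h)\<close>.\<close>
  define u2 where "u2 x = w x + \<theta> (x - h)" for x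
  have V1: "AE x in lborel. V u1 x = (if x \<in> A then V w (x + h) else V w x)"
    using w_grad \<theta>_grad
  proof eventually_elim
    case (elim x)
    from grad_eq[OF has_grad_diff[OF elim]] show ?case
      unfolding u1_def[abs_def] V_def by (auto simp: V_def)
  qed
  have V2: "AE x in lborel. V u2 x = (if x - h \<in> A then V w (x - h) else V w x)"
    using w_grad AE_lborel_translate[OF \<theta>_grad, of "- h"]
  proof eventually_elim
    case (elim x)
    then have "has_grad (\<lambda>x. \<theta> (x + - h)) x (if x - h \<in> A then V w (x - h) - V w x else 0)"
      unfolding has_grad_translate by (cases "x - h \<in> A") simp_all
    from grad_eq[OF has_grad_add[OF elim(1) this]] show ?case
      unfolding u2_def[abs_def] V_def by (auto simp: V_def)
  qed
  have A_\<Omega>: "x \<in> A \<Longrightarrow> x \<in> \<Omega>" "x \<in> A \<Longrightarrow> x + h \<in> \<Omega>" for x by (auto simp: A_eq U_def)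
  have A1: "Adm L u1"
    unfolding Adm_def
  proof (intro conjI allI impI)
    show "Lip u1" unfolding u1_def by (intro Lip_diff AdmD(1)[OF Aw] \<theta>_Lip)
    show "u1 x = 0" if "x \<notin> \<Omega>" for x
      using AdmD(2)[OF Aw that] \<theta>_A[of x] A_\<Omega>(1)[of x] that by (auto simp: u1_def)
    show "AE x in lborel. x \<in> \<Omega> \<longrightarrow> norm (V u1 x) \<le> L"
      using V1 AdmD(3)[OF Aw] AE_lborel_translate[OF AdmD(3)[OF Aw], of h]
    proof eventually_elim
      case (elim x)
      then show ?case using A_\<Omega>(2)[of x] by auto
    qed
  qed
  have A2: "Adm L u2"
    unfolding Adm_def
  proof (intro conjI allI impI)
    show "Lip u2" unfolding u2_def
      using Lip_translate[OF \<theta>_Lip, of "- h"] by (intro Lip_add AdmD(1)[OF Aw]) simp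
    show "u2 x = 0" if "x \<notin> \<Omega>" for x
      using AdmD(2)[OF Aw that] \<theta>_A[of "x - h"] A_\<Omega>(2)[of "x - h"] that by (auto simp: u2_def)
    show "AE x in lborel. x \<in> \<Omega> \<longrightarrow> norm (V u2 x) \<le> L"
      using V2 AdmD(3)[OF Aw] AE_lborel_translate[OF AdmD(3)[OF Aw], of "- h"]
    proof eventually_elim
      case (elim x)
      then show ?case using A_\<Omega>(1)[of "x - h"] by auto
    qed
  qed
  \<comment> \<open>On \<open>A\<close> the function \<open>u1\<close> uses the values of
    \<open>V w\<close> from \<open>A\<close> shifted by \<open>h\<close>, and on the shifted set
    \<open>u2\<close> uses those from \<open>A\<close>. By translation invariance gain and loss
    cancel whatever the integrand.\<close>
  have sum: "energy G u1 + energy G u2 = 2 * energy G w"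
    if [measurable]: "G \<in> borel_measurable borel"
      and int: "\<And>v. Adm L v \<Longrightarrow> integrable lborel (\<lambda>x. indicator \<Omega> x * G (V v x))" for G :: "real^'a \<Rightarrow> real"
  proof -
    define P where "P x = indicator \<Omega> x * G (V w x)" for x
    have P: "integrable lborel P" unfolding P_def by (rule int[OF Aw])
    have [measurable]: "P \<in> borel_measurable borel" using borel_measurable_integrable[OF P] by simp
    have [measurable]: "A \<in> sets borel" using A by simp
    have IA: "integrable lborel (\<lambda>x. indicator A (x + s) * P (x + t))" for s t :: "real^'a"
    proof (rule Bochner_Integration.integrable_bound[OF integrable_lborel_translate[OF P, of t]])
      show "AE x in lborel. norm (indicator A (x + s) * P (x + t)) \<le> norm (P (x + t))"
        by (intro AE_I2) (auto split: split_indicator)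
    qed measurable
    have 1: "energy G u1 = (\<integral>x. P x - indicator A x * P x + indicator A x * P (x + h) \<partial>lborel)"
      unfolding energy_def
    proof (rule integral_cong_AE)
      show "AE x in lborel. indicator \<Omega> x * G (V u1 x) = P x - indicator A x * P x + indicator A x * P (x + h)"
        using V1
      proof eventually_elim
        case (elim x)
        then show ?case using A_\<Omega>[of x] by (cases "x \<in> A") (auto simp: P_def)
      qed
      show "(\<lambda>x. indicator \<Omega> x * G (V u1 x)) \<in> borel_measurable lborel"
        using borel_measurable_integrable[OF int[OF A1]] .
    qed measurable
    have 2: "energy G u2 = (\<integral>x. P x - indicator A (x + - h) * P x + indicator A (x + - h) * P (x + - h) \<partial>lborel)"
      unfolding energy_def
    proof (rule integral_cong_AE)
      show "AE x in lborel. indicator \<Omega> x * G (V u2 x) = P x - indicator A (x + - h) * P x + indicator A (x + - h) * P (x + - h)"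
        using V2
      proof eventually_elim
        case (elim x)
        then show ?case using A_\<Omega>[of "x - h"] by (cases "x - h \<in> A") (auto simp: P_def)
      qed
      show "(\<lambda>x. indicator \<Omega> x * G (V u2 x)) \<in> borel_measurable lborel"
        using borel_measurable_integrable[OF int[OF A2]] .
    qed measurable
    have "(\<integral>x. indicator A (x + - h) * P (x + - h) \<partial>lborel) = (\<integral>x. indicator A x * P x \<partial>lborel)"
      by (rule integral_lborel_translate[of "\<lambda>x. indicator A x * P x"]) measurable
    moreover have "(\<integral>x. indicator A (x + - h) * P x \<partial>lborel) = (\<integral>x. indicator A x * P (x + h) \<partial>lborel)"
      using integral_lborel_translate[of "\<lambda>x. indicator A (x + - h) * P x" h] by simp
    ultimately show ?thesis
      unfolding 1 2 using P IA[of 0 0] IA[of 0 h] IA[of "- h" 0] IA[of "- h" "- h"]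
      by (simp add: energy_def P_def[symmetric])
  qed
  have n: "energy norm u1 + energy norm u2 = 2 * energy norm w"
    by (rule sum) (simp_all add: integrable_energy_norm)
  then have n1: "energy norm u1 = energy norm w" and n2: "energy norm u2 = energy norm w"
    using min[OF A1] min[OF A2] by linarith+
  have "energy sq u1 + energy sq u2 = 2 * energy sq w"
    by (rule sum) (simp_all add: integrable_energy_sq)
  then have "energy sq u1 = energy sq w"
    using min2[OF A1 n1] min2[OF A2 n2] by linarith
  \<comment> \<open>As neither summand can be below the minimum, both energies of \<open>u1\<close>
    equal those of \<open>w\<close>. Uniqueness gives \<open>u1 = w\<close>, so \<theta>
    vanishes.\<close>
  from lex_min_unique[OF w A1 n1 this] have "\<theta> x0 = 0" by (simp add: u1_def fun_eq_iff)
  then have "w x0 - w (x0 + h) - g x0 - c \<le> 0" using x0 by (simp add: \<theta>_def U_def max_def split: if_splits)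
  then show ?thesis using g_bd[OF x0] by (simp add: c_def algebra_simps)
qed

lemma lex_min_lipschitz:
  assumes w: "lex_min L w" and L: "k * (1 + 2 * a * d) + M \<le> L"
  shows "\<bar>w x - w y\<bar> \<le> (k + 2 * M) * norm (x - y)"
proof -
  have Aw: "Adm L w" and min: "\<And>v. Adm L v \<Longrightarrow> energy norm w \<le> energy norm v"
    using w by (auto simp: lex_min_def)
  note bdry = boundary_estimate[OF Aw min L]
  have k_le: "k * norm (x - y) \<le> (k + 2 * M) * norm (x - y)" using M_pos by (intro mult_right_mono) auto
  consider "x \<in> \<Omega>" "y \<in> \<Omega>" | "x \<notin> \<Omega>" | "y \<notin> \<Omega>" by blast
  then show ?thesis
  proof cases
    case 1
    then show ?thesis
      using translation_estimate[OF w L, of x "y - x"] translation_estimate[OF w L, of y "x - y"]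
      by (auto simp: norm_minus_commute abs_le_iff)
  next
    case 2
    then show ?thesis using bdry[of x y] AdmD(2)[OF Aw 2] k_le by (simp add: norm_minus_commute)
  next
    case 3
    then show ?thesis using bdry[of y x] AdmD(2)[OF Aw 3] k_le by simp
  qed
qed

text \<open>The Lipschitz constant of \<open>w\<close> is independent of \<open>L\<close>. For large
  \<open>L\<close> the constraint therefore holds with slack, a small multiple of any variation is
  admissible, and convexity of the energy extends the inequality from the small multiple to the full
  variation.\<close>

theorem lipschitz_minimizer:
  obtains w K where "\<And>x y. \<bar>w x - w y\<bar> \<le> K * norm (x - y)" "\<And>x. x \<notin> \<Omega> \<Longrightarrow> w x = 0"
    "\<And>\<zeta>. Lip \<zeta> \<Longrightarrow> (\<And>x. x \<notin> \<Omega> \<Longrightarrow> \<zeta> x = 0) \<Longrightarrow> energy norm w \<le> energy norm (\<lambda>x. w x + \<zeta> x)"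
proof -
  define K where "K = k + 2 * M"
  \<comment> \<open>The first summand together with \<open>M\<close> permits the Lipschitz estimate,
    \<open>real CARD('a) * K + M\<close> bounds \<open>norm (V w)\<close> almost everywhere in
    \<Omega>, and the final 1 is the slack for variations.\<close>
  define L where "L = k * (1 + 2 * a * d) + real CARD('a) * K + M + 1"
  have K0: "K > 0" using k_pos M_pos by (simp add: K_def)
  have kd: "k * (1 + 2 * a * d) > 0" using k_pos a_pos d_pos by (intro mult_pos_pos add_pos_pos) auto
  have L1: "k * (1 + 2 * a * d) + M \<le> L" and L2: "M \<le> L" and L3: "real CARD('a) * K + M + 1 \<le> L"
    using kd K0 by (simp_all add: L_def)
  obtain w where w: "lex_min L w" using lex_min_exists[OF L2] by blast
  then have Aw: "Adm L w" and min: "\<And>v. Adm L v \<Longrightarrow> energy norm w \<le> energy norm v"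
    by (auto simp: lex_min_def)
  have lip: "\<bar>w x - w y\<bar> \<le> K * norm (x - y)" for x y
    unfolding K_def by (rule lex_min_lipschitz[OF w L1])
  have "energy norm w \<le> energy norm (\<lambda>x. w x + \<zeta> x)"
    if \<zeta>: "Lip \<zeta>" and \<zeta>0: "\<And>x. x \<notin> \<Omega> \<Longrightarrow> \<zeta> x = 0" for \<zeta>
  proof -
    obtain C where C: "C \<ge> 0" "\<And>x y. \<bar>\<zeta> x - \<zeta> y\<bar> \<le> C * norm (x - y)" using LipE[OF \<zeta>] by metis
    have Adm: "Adm (real CARD('a) * K + M + t * (real CARD('a) * C)) (\<lambda>x. w x + t * \<zeta> x)" if t: "t \<ge> 0" for t
      unfolding Adm_def
    proof (intro conjI allI impI)
      show "Lip (\<lambda>x. w x + t * \<zeta> x)" by (intro Lip_add Lip_cmult \<zeta> AdmD(1)[OF Aw])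
      show "AE x in lborel. x \<in> \<Omega> \<longrightarrow> norm (V (\<lambda>x. w x + t * \<zeta> x) x) \<le> real CARD('a) * K + M + t * (real CARD('a) * C)"
        using Lip_has_grad_AE[OF AdmD(1)[OF Aw]] Lip_has_grad_AE[OF \<zeta>]
      proof eventually_elim
        case (elim x)
        show ?case
        proof
          assume x: "x \<in> \<Omega>"
          have "V (\<lambda>x. w x + t * \<zeta> x) x = grad w x + t *\<^sub>R grad \<zeta> x + F x"
            by (simp add: V_def grad_eq[OF has_grad_add[OF elim(1) has_grad_cmult[OF elim(2)]]])
          also have "norm \<dots> \<le> norm (grad w x) + norm (t *\<^sub>R grad \<zeta> x) + norm (F x)"
            by (intro norm_triangle_mono norm_triangle_ineq) simp
          also have "\<dots> \<le> real CARD('a) * K + t * (real CARD('a) * C) + M"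
            using lipschitz_norm_grad_le[OF elim(1) lip] lipschitz_norm_grad_le[OF elim(2) C(2)] F_bound[OF x] t
            by (intro add_mono) (auto intro: mult_left_mono)
          finally show "norm (V (\<lambda>x. w x + t * \<zeta> x) x) \<le> real CARD('a) * K + M + t * (real CARD('a) * C)" by simp
        qed
      qed
    qed (use \<zeta>0 AdmD(2)[OF Aw] in auto)
    \<comment> \<open>Chosen so that the gradient of \<open>t * \<zeta>\<close> is at most 1 in
      norm, which uses up the slack in \<open>L\<close>.\<close>
    define t where "t = 1 / (real CARD('a) * C + 1)"
    have mC: "real CARD('a) * C \<ge> 0" using C(1) by simp
    have t: "t > 0" "t \<le> 1" using mC by (auto simp: t_def)
    have "t * (real CARD('a) * C) \<le> t * (real CARD('a) * C + 1)" using t by (intro mult_left_mono) auto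
    also have "\<dots> = 1" using mC by (simp add: t_def)
    finally have "Adm L (\<lambda>x. w x + t * \<zeta> x)"
      using L3 t by (intro Adm_mono[OF Adm]) auto
    note le = min[OF this]
    \<comment> \<open>Convexity of the energy is available inside one admissible class, and
      \<open>w + \<zeta>\<close> may violate the bound \<open>L\<close>. The larger class contains
      both functions; minimality of \<open>w\<close> in it is not claimed.\<close>
    define L' where "L' = max L (real CARD('a) * K + M + 1 * (real CARD('a) * C))"
    have Aw': "Adm L' w" by (rule Adm_mono[OF Aw]) (simp add: L'_def)
    have A\<zeta>: "Adm L' (\<lambda>x. w x + \<zeta> x)"
      using Adm[of 1] by (intro Adm_mono[of "real CARD('a) * K + M + 1 * (real CARD('a) * C)" _ L']) (simp_all add: L'_def)
    have "(\<lambda>x. w x + t * \<zeta> x) = (\<lambda>x. (1 - t) * w x + t * (w x + \<zeta> x))" by (simp add: fun_eq_iff algebra_simps)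
    then have "energy norm (\<lambda>x. w x + t * \<zeta> x) \<le> (1 - t) * energy norm w + t * energy norm (\<lambda>x. w x + \<zeta> x)"
      using energy_norm_convex[OF Aw' A\<zeta>, of "1 - t" t] t by simp
    with le have "t * energy norm w \<le> t * energy norm (\<lambda>x. w x + \<zeta> x)" by (simp add: algebra_simps)
    then show ?thesis using t by simp
  qed
  then show ?thesis using that[of w K] lip AdmD(2)[OF Aw] by blast
qed

end

subsection \<open>Smooth cut-off functions\<close>

text \<open>The standard smooth function \<open>exp (- 1 / s)\<close>, multiplied by a polynomial in
  \<open>1 / s\<close> so that the family is closed under differentiation.\<close>

definition flat :: "real poly \<Rightarrow> real \<Rightarrow> real" where
  "flat P s = (if s > 0 then poly P (1 / s) * exp (- 1 / s) else 0)"

lemma poly_exp_tendsto_0: "((\<lambda>s. poly P s * exp (- s)) \<longlongrightarrow> (0::real)) at_top"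
proof -
  have "((\<lambda>s. \<Sum>i\<le>degree P. coeff P i * (s ^ i / exp s)) \<longlongrightarrow> (\<Sum>i\<le>degree P. coeff P i * 0)) at_top"
    by (intro tendsto_intros tendsto_power_div_exp_0)
  moreover have "(\<lambda>s. \<Sum>i\<le>degree P. coeff P i * (s ^ i / exp s)) = (\<lambda>s. poly P s * exp (- s))"
    by (simp add: poly_altdef sum_distrib_right exp_minus divide_inverse mult.assoc fun_eq_iff)
  ultimately show ?thesis by simp
qed

text \<open>With \<open>r = 1 / s\<close> the derivative of \<open>P(r) exp(-r)\<close> is
  \<open>r^2 (P - P')(r) exp(-r)\<close>, which is again of this form. At \<open>s = 0\<close>
  exponential decay beats every polynomial.\<close>

lemma flat_deriv: "(flat P has_real_derivative flat ([:0, 0, 1:] * (P - pderiv P)) s) (at s)"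
proof -
  consider "s > 0" | "s < 0" | "s = 0" by linarith
  then show ?thesis
  proof cases
    case 1
    have "((\<lambda>s. poly P (1 / s) * exp (- 1 / s)) has_real_derivative
        poly (pderiv P) (1 / s) * (- 1 / s\<^sup>2) * exp (- 1 / s) + exp (- 1 / s) * (1 / s\<^sup>2) * poly P (1 / s)) (at s)"
      using 1 by (auto intro!: derivative_eq_intros poly_DERIV[THEN DERIV_chain2] simp: power2_eq_square)
    also have "poly (pderiv P) (1 / s) * (- 1 / s\<^sup>2) * exp (- 1 / s) + exp (- 1 / s) * (1 / s\<^sup>2) * poly P (1 / s) =
        flat ([:0, 0, 1:] * (P - pderiv P)) s"
      using 1 by (simp add: flat_def power2_eq_square field_simps)
    finally show ?thesis
      by (rule has_field_derivative_transform_within_open[of _ _ _ "{0<..}"]) (use 1 in \<open>auto simp: flat_def\<close>)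
  next
    case 2
    have "((\<lambda>s. 0) has_real_derivative 0) (at s)" by simp
    then have "(flat P has_real_derivative 0) (at s)"
      by (rule has_field_derivative_transform_within_open[of _ _ _ "{..<0}"]) (use 2 in \<open>auto simp: flat_def\<close>)
    then show ?thesis using 2 by (simp add: flat_def)
  next
    case 3
    \<comment> \<open>Division by \<open>h\<close> is multiplication by \<open>r = 1 / h\<close>,
      hence the polynomial \<open>[:0, 1:] * P\<close>.\<close>
    have "((\<lambda>h. poly ([:0, 1:] * P) (inverse h) * exp (- inverse h)) \<longlongrightarrow> (0::real)) (at_right 0)"
      by (rule filterlim_compose[OF poly_exp_tendsto_0 filterlim_inverse_at_top_right])
    moreover have "\<forall>\<^sub>F h in at_right 0. poly ([:0, 1:] * P) (inverse h) * exp (- inverse h) = flat P h / h"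
      by (auto simp: eventually_at_right_field flat_def divide_inverse intro!: exI[of _ 1])
    ultimately have r: "((\<lambda>h. flat P h / h) \<longlongrightarrow> 0) (at_right 0)"
      by (rule Lim_transform_eventually)
    have "\<forall>\<^sub>F h in at_left 0. (0::real) = flat P h / h"
      by (auto simp: eventually_at_left_field flat_def intro!: exI[of _ "-1"])
    then have "((\<lambda>h. flat P h / h) \<longlongrightarrow> 0) (at_left 0)"
      by (rule Lim_transform_eventually[OF tendsto_const])
    with r show ?thesis using 3 by (simp add: DERIV_def flat_def filterlim_split_at)
  qed
qed

text \<open>An algebra that contains the partial derivatives of its elements. Smoothness of all
  orders thereby reduces to a single differentiation for each constructor.\<close>

inductive_set cutoffs :: "(real^'m::finite \<Rightarrow> real) set" where
  const: "(\<lambda>x. c) \<in> cutoffs"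
| flat: "(\<lambda>x. flat P (c * x $ i + e)) \<in> cutoffs"
| add: "f \<in> cutoffs \<Longrightarrow> g \<in> cutoffs \<Longrightarrow> (\<lambda>x. f x + g x) \<in> cutoffs"
| mult: "f \<in> cutoffs \<Longrightarrow> g \<in> cutoffs \<Longrightarrow> (\<lambda>x. f x * g x) \<in> cutoffs"

lemma partial_eq: "(f has_derivative f') (at x) \<Longrightarrow> partial i f x = f' (axis i 1)"
  unfolding partial_def by (simp add: frechet_derivative_at[symmetric])

lemma cutoffs_derivative:
  fixes f :: "real^'m::finite \<Rightarrow> real"
  shows "f \<in> cutoffs \<Longrightarrow> (\<forall>x. f differentiable (at x)) \<and> (\<forall>k. partial k f \<in> cutoffs)"
proof (induction rule: cutoffs.induct)
  case (const c)
  have "partial k (\<lambda>x::real^'m. c) = (\<lambda>x. 0)" for k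
    by (rule ext) (simp add: partial_eq[OF has_derivative_const])
  then show ?case by (auto intro: cutoffs.const)
next
  case (flat P c i e)
  let ?P = "[:0, 0, 1:] * (P - pderiv P)"
  have D: "((\<lambda>x::real^'m. flat P (c * x $ i + e)) has_derivative (\<lambda>v. flat ?P (c * x $ i + e) * (c * v $ i))) (at x)" for x
  proof -
    have inner: "((\<lambda>x::real^'m. c * x $ i + e) has_derivative (\<lambda>v. c * v $ i)) (at x)"
      by (auto intro!: derivative_eq_intros bounded_linear.has_derivative[OF bounded_linear_vec_nth])
    show ?thesis
      using has_derivative_compose[OF inner, of "flat P" "(*) (flat ?P (c * x $ i + e))"] flat_deriv[of P "c * x $ i + e"]
      by (simp add: has_field_derivative_def)
  qed
  have "partial k (\<lambda>x::real^'m. flat P (c * x $ i + e)) = (\<lambda>x. flat ?P (c * x $ i + e) * (c * axis k 1 $ i))" for k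
    by (rule ext) (rule partial_eq[OF D])
  then show ?case using D by (auto simp: differentiable_def intro!: cutoffs.intros)
next
  case (add f g)
  have D: "((\<lambda>x. f x + g x) has_derivative (\<lambda>v. frechet_derivative f (at x) v + frechet_derivative g (at x) v)) (at x)" for x
    using add.IH by (intro has_derivative_add) (auto simp: frechet_derivative_works[symmetric])
  have "partial k (\<lambda>x. f x + g x) = (\<lambda>x. partial k f x + partial k g x)" for k
    by (rule ext) (simp add: partial_eq[OF D], simp add: partial_def)
  then show ?case using D add.IH by (auto simp: differentiable_def intro!: cutoffs.add)
next
  case (mult f g)
  have D: "((\<lambda>x. f x * g x) has_derivative (\<lambda>v. f x * frechet_derivative g (at x) v + frechet_derivative f (at x) v * g x)) (at x)" for x
    using mult.IH by (intro has_derivative_mult) (auto simp: frechet_derivative_works[symmetric])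
  have "partial k (\<lambda>x. f x * g x) = (\<lambda>x. f x * partial k g x + partial k f x * g x)" for k
    by (rule ext) (simp add: partial_eq[OF D], simp add: partial_def)
  then show ?case using D mult.IH mult.hyps by (auto simp: differentiable_def intro!: cutoffs.add cutoffs.mult)
qed

lemma cutoffs_C_k:
  assumes "f \<in> cutoffs" shows "C_k k UNIV f"
proof -
  have p: "partials ks f \<in> cutoffs" for ks
    using assms cutoffs_derivative by (induction ks) (auto simp: partials_def)
  then have "partials ks f differentiable (at x)" for ks x
    using cutoffs_derivative by blast
  then show ?thesis
    unfolding C_k_def by (auto intro!: continuous_at_imp_continuous_on differentiable_imp_continuous_within)
qed

text \<open>The parameter \<open>c\<close> stretches the transition: since
  \<open>exp (- 1 / (c * r))\<close> tends to 1 for \<open>r > 0\<close>, the functions tend to the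
  indicator of the open box as \<open>c\<close> grows.\<close>

definition bump :: "real \<Rightarrow> real^'m::finite \<Rightarrow> real^'m \<Rightarrow> real^'m \<Rightarrow> real" where
  "bump c a b x = (\<Prod>i\<in>UNIV. flat 1 (c * (x $ i - a $ i)) * flat 1 (c * (b $ i - x $ i)))"

lemma flat_one: "flat 1 s = (if s > 0 then exp (- 1 / s) else 0)"
  by (simp add: flat_def)

lemma bump_cutoffs: "bump c a b \<in> cutoffs"
proof -
  have "(\<lambda>x. \<Prod>i\<in>S. flat 1 (c * (x $ i - a $ i)) * flat 1 (c * (b $ i - x $ i))) \<in> cutoffs" if "finite S" for S
    using that
  proof (induction S)
    case empty show ?case by (simp add: cutoffs.const)
  next
    case (insert i S)
    have "(\<lambda>x. flat 1 (c * x $ i + - c * a $ i)) \<in> cutoffs" "(\<lambda>x. flat 1 (- c * x $ i + c * b $ i)) \<in> cutoffs"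
      by (rule cutoffs.flat)+
    then have "(\<lambda>x. flat 1 (c * (x $ i - a $ i))) \<in> cutoffs" "(\<lambda>x. flat 1 (c * (b $ i - x $ i))) \<in> cutoffs"
      by (simp_all add: algebra_simps)
    then show ?case using insert by (simp add: cutoffs.mult)
  qed
  then show ?thesis unfolding bump_def[abs_def] by simp
qed

lemma bump_bounds: "0 \<le> bump c a b x" "bump c a b x \<le> 1"
proof -
  have f: "0 \<le> flat 1 s" "flat 1 s \<le> 1" for s by (auto simp: flat_one)
  show "0 \<le> bump c a b x" unfolding bump_def by (intro prod_nonneg) (simp add: f)
  show "bump c a b x \<le> 1" unfolding bump_def by (intro prod_le_1) (auto simp: f mult_le_one)
qed

lemma bump_support: "c > 0 \<Longrightarrow> bump c a b x \<noteq> 0 \<Longrightarrow> x \<in> box a b"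
  by (auto simp: bump_def flat_one mem_box_cart zero_less_mult_iff split: if_splits) 

lemma bump_tendsto: "(\<lambda>n. bump (real (Suc n)) a b x) \<longlonglongrightarrow> indicator (box a b) x"
proof (cases "x \<in> box a b")
  case True
  then have pos: "x $ i - a $ i > 0" "b $ i - x $ i > 0" for i by (auto simp: mem_box_cart)
  have one: "(\<lambda>n. flat 1 (real (Suc n) * r)) \<longlonglongrightarrow> 1" if "r > 0" for r
  proof -
    have "(\<lambda>n. exp (- (1 / r * inverse (real (Suc n))))) \<longlonglongrightarrow> exp (- (1 / r * 0))"
      by (intro tendsto_intros LIMSEQ_inverse_real_of_nat)
    then show ?thesis using that by (simp add: flat_one divide_inverse mult.commute zero_less_mult_iff)
  qed
  have "(\<lambda>n. bump (real (Suc n)) a b x) \<longlonglongrightarrow> (\<Prod>i\<in>(UNIV::'a set). 1 * 1)"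
    unfolding bump_def by (intro tendsto_prod tendsto_mult one pos)
  then show ?thesis using True by simp
next
  case False
  then have "bump (real (Suc n)) a b x = 0" for n using bump_support[of "real (Suc n)" a b x] by fastforce
  then show ?thesis using False by simp
qed

lemma test_function_bump:
  assumes "c > 0" "cbox a b \<subseteq> \<Omega>"
  shows "test_function \<Omega> (bump c a b)"
proof -
  have "{x. bump c a b x \<noteq> 0} \<subseteq> box a b" using bump_support[OF assms(1), of a b] by blast
  then have "{x. bump c a b x \<noteq> 0} \<subseteq> cbox a b" using box_subset_cbox by blast
  then have sub: "closure {x. bump c a b x \<noteq> 0} \<subseteq> cbox a b" by (rule closure_minimal[OF _ closed_cbox])
  then have "compact (closure {x. bump c a b x \<noteq> 0})"
    using bounded_subset[OF bounded_cbox sub] by (simp add: compact_eq_bounded_closed)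
  then show ?thesis
    unfolding test_function_def using sub assms(2) cutoffs_C_k[OF bump_cutoffs] by blast
qed

subsection \<open>The fundamental lemma of the calculus of variations\<close>

text \<open>Lebesgue differentiation with cubes whose lower corner is \<open>x\<close>; small ones
  lie in \<Omega>, so all averages near \<open>x\<close> are zero.\<close>

lemma integral_cbox_zero_imp_zero:
  fixes f :: "real^'m::finite \<Rightarrow> real"
  assumes f: "integrable lebesgue f" and \<Omega>: "open \<Omega>"
    and zero: "\<And>a b. cbox a b \<subseteq> \<Omega> \<Longrightarrow> (LINT x:box a b|lebesgue. f x) = 0"
  shows "AE x in lebesgue. x \<in> \<Omega> \<longrightarrow> f x = 0"
proof -
  have ai: "f absolutely_integrable_on UNIV" using f by (simp add: set_integrable_def)
  have int: "f integrable_on cbox a b" for a b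
    using absolutely_integrable_on_subcbox[OF ai] by (simp add: set_lebesgue_integral_eq_integral(1))
  have z: "integral (cbox a b) f = 0" if "cbox a b \<subseteq> \<Omega>" for a b
  proof -
    have "set_integrable lebesgue (box a b) f"
      using f unfolding set_integrable_def by (intro integrable_mult_indicator) auto
    then have "integral (box a b) f = (LINT x:box a b|lebesgue. f x)"
      by (simp add: set_lebesgue_integral_eq_integral(2))
    then show ?thesis using zero[OF that] by (simp add: integral_open_interval)
  qed
  obtain N where N: "negligible N" and e: "\<And>x e. \<lbrakk>x \<notin> N; 0 < e\<rbrakk> \<Longrightarrow>
      \<exists>d>0. \<forall>h. 0 < h \<and> h < d \<longrightarrow> norm (integral (cbox x (x + h *\<^sub>R One)) f /\<^sub>R h ^ DIM(real^'m) - f x) < e"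
    using integrable_ccontinuous_explicit[OF int] by blast
  have "f x = 0" if x: "x \<in> \<Omega>" "x \<notin> N" for x
  proof (rule ccontr)
    assume "f x \<noteq> 0"
    then obtain d where d: "d > 0" "\<And>h. 0 < h \<Longrightarrow> h < d \<Longrightarrow> norm (integral (cbox x (x + h *\<^sub>R One)) f /\<^sub>R h ^ DIM(real^'m) - f x) < norm (f x)"
      using e[OF x(2), of "norm (f x)"] by auto
    obtain r where r: "r > 0" "ball x r \<subseteq> \<Omega>" using \<Omega> x(1) open_contains_ball by blast
    have n: "norm (One :: real^'m) > 0" by simp
    \<comment> \<open>The diagonal of a cube of side \<open>h\<close> has length
      \<open>h * norm One\<close>, which has to stay below \<open>r\<close>.\<close>
    define h where "h = min (d / 2) (r / (2 * norm (One :: real^'m)))"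
    have h: "h > 0" "h < d" "h * norm (One :: real^'m) < r"
    proof -
      show "h > 0" "h < d" using d r n by (auto simp: h_def)
      have "h * norm (One :: real^'m) \<le> r / (2 * norm (One :: real^'m)) * norm (One :: real^'m)"
        by (intro mult_right_mono) (auto simp: h_def)
      also have "\<dots> < r" using n r by simp
      finally show "h * norm (One :: real^'m) < r" .
    qed
    have "cbox x (x + h *\<^sub>R One) \<subseteq> ball x r"
    proof
      fix y assume y: "y \<in> cbox x (x + h *\<^sub>R One)"
      have "norm (y - x) \<le> norm (h *\<^sub>R (One :: real^'m))"
        by (rule norm_le_componentwise) (use y in \<open>auto simp: mem_box algebra_simps inner_simps abs_le_iff\<close>)
      then show "y \<in> ball x r" using h by (simp add: dist_norm norm_minus_commute)
    qed
    then have "integral (cbox x (x + h *\<^sub>R One)) f = 0" using z r(2) by blast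
    then show False using d(2)[OF h(1,2)] by simp
  qed
  then show ?thesis
    using N by (intro AE_I'[of N]) (auto simp: negligible_iff_null_sets)
qed

text \<open>The bump functions are bounded by 1 and tend to the indicator of a box, so dominated
  convergence reduces the claim to integrals over boxes.\<close>

lemma fundamental_lemma:
  fixes f :: "real^'m::finite \<Rightarrow> real"
  assumes f: "set_integrable lebesgue \<Omega> f" and \<Omega>: "open \<Omega>"
    and zero: "\<And>\<zeta>. test_function \<Omega> \<zeta> \<Longrightarrow> (LINT x:\<Omega>|lebesgue. f x * \<zeta> x) = 0"
  shows "AE x in lebesgue. x \<in> \<Omega> \<longrightarrow> f x = 0"
proof -
  define g where "g x = indicator \<Omega> x *\<^sub>R f x" for x
  have g: "integrable lebesgue g" using f by (simp add: g_def[abs_def] set_integrable_def)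
  have [measurable]: "g \<in> borel_measurable lebesgue" using g by auto
  have "AE x in lebesgue. x \<in> \<Omega> \<longrightarrow> g x = 0"
  proof (rule integral_cbox_zero_imp_zero[OF g \<Omega>])
    fix a b :: "real^'m" assume ab: "cbox a b \<subseteq> \<Omega>"
    have bm: "bump c a b \<in> borel_measurable lebesgue" for c
    proof -
      have "continuous_on UNIV (bump c a b)"
        using cutoffs_derivative[OF bump_cutoffs] by (auto intro!: continuous_at_imp_continuous_on differentiable_imp_continuous_within)
      then have "bump c a b \<in> borel_measurable borel" by (rule borel_measurable_continuous_onI)
      then have "bump c a b \<in> borel_measurable lborel" by simp
      then show ?thesis by (rule measurable_completion)
    qed
    have "(\<lambda>n. \<integral>x. g x * bump (real (Suc n)) a b x \<partial>lebesgue) \<longlonglongrightarrow> (\<integral>x. g x * indicator (box a b) x \<partial>lebesgue)"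
    proof (rule integral_dominated_convergence[where w = "\<lambda>x. \<bar>g x\<bar>"])
      show "(\<lambda>x. g x * indicator (box a b) x) \<in> borel_measurable lebesgue"
        by (intro borel_measurable_times borel_measurable_indicator) auto
      show "(\<lambda>x. g x * bump (real (Suc n)) a b x) \<in> borel_measurable lebesgue" for n
        using bm by measurable
      show "integrable lebesgue (\<lambda>x. \<bar>g x\<bar>)" using g by simp
      show "AE x in lebesgue. (\<lambda>n. g x * bump (real (Suc n)) a b x) \<longlonglongrightarrow> g x * indicator (box a b) x"
        by (intro AE_I2 tendsto_mult tendsto_const bump_tendsto)
      show "AE x in lebesgue. norm (g x * bump (real (Suc n)) a b x) \<le> \<bar>g x\<bar>" for n
        using bump_bounds[of "real (Suc n)" a b] by (intro AE_I2) (simp add: abs_mult mult_left_le)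
    qed
    moreover have "(\<integral>x. g x * bump (real (Suc n)) a b x \<partial>lebesgue) = 0" for n
      using zero[OF test_function_bump[OF _ ab, of "real (Suc n)"]]
      by (simp add: g_def set_lebesgue_integral_def mult.assoc)
    ultimately have "(\<integral>x. g x * indicator (box a b) x \<partial>lebesgue) = 0"
      using LIMSEQ_unique[OF tendsto_const] by force
    then show "(LINT x:box a b|lebesgue. g x) = 0" by (simp add: set_lebesgue_integral_def mult.commute)
  qed
  then show ?thesis by eventually_elim (simp add: g_def)
qed

section \<open>Classical derivatives and the mean value inequality\<close>

lemma has_derivative_line:
  assumes "(f has_derivative f') (at (x + s *\<^sub>R e))"
  shows "((\<lambda>t. f (x + t *\<^sub>R e)) has_vector_derivative f' e) (at s)"
proof -
  have "((\<lambda>t. x + t *\<^sub>R e) has_derivative (\<lambda>t. t *\<^sub>R e)) (at s)"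
    by (auto intro!: derivative_eq_intros)
  from has_derivative_compose[OF this assms] have "((\<lambda>t. f (x + t *\<^sub>R e)) has_derivative (\<lambda>t. f' (t *\<^sub>R e))) (at s)" .
  moreover have "f' (t *\<^sub>R e) = t *\<^sub>R f' e" for t
    using has_derivative_linear[OF assms] by (simp add: linear_cmul)
  ultimately show ?thesis by (simp add: has_vector_derivative_def)
qed

lemma frechet_derivative_partials:
  fixes f :: "real^'m::finite \<Rightarrow> 'b::real_normed_vector"
  assumes "f differentiable (at x)"
  shows "frechet_derivative f (at x) v = (\<Sum>i\<in>UNIV. v $ i *\<^sub>R partial i f x)"
proof -
  have lin: "linear (frechet_derivative f (at x))"
    by (rule linear_frechet_derivative[OF assms])
  have "frechet_derivative f (at x) v = frechet_derivative f (at x) (\<Sum>i\<in>UNIV. v $ i *\<^sub>R axis i 1)"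
    using basis_expansion[of v] by (simp add: scalar_mult_eq_scaleR)
  also have "\<dots> = (\<Sum>i\<in>UNIV. v $ i *\<^sub>R partial i f x)"
    using lin by (simp add: linear_sum linear_cmul partial_def)
  finally show ?thesis .
qed

lemma differentiable_line:
  fixes f :: "real^'m::finite \<Rightarrow> 'b::real_normed_vector"
  assumes "f differentiable (at (x + s *\<^sub>R e))"
  shows "((\<lambda>t. f (x + t *\<^sub>R e)) has_vector_derivative (\<Sum>i\<in>UNIV. e $ i *\<^sub>R partial i f (x + s *\<^sub>R e))) (at s)"
  using has_derivative_line[OF assms[unfolded frechet_derivative_works]] by (simp add: frechet_derivative_partials[OF assms])

lemma differentiable_partial_line:
  fixes f :: "real^'m::finite \<Rightarrow> 'b::real_normed_vector"
  assumes "f differentiable (at x)"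
  shows "((\<lambda>t. f (x + t *\<^sub>R axis i 1)) has_vector_derivative partial i f x) (at 0)"
  using has_derivative_line[of f "frechet_derivative f (at x)" x 0 "axis i 1"] assms
  by (simp add: frechet_derivative_works[symmetric] partial_def)

lemma differentiable_has_grad:
  fixes f :: "real^'m::finite \<Rightarrow> real"
  assumes "f differentiable (at x)"
  shows "has_grad f x (\<chi> i. partial i f x)"
  unfolding has_grad_def line_deriv_def
  using differentiable_partial_line[OF assms] by (simp add: has_real_derivative_iff_has_vector_derivative)

lemma bounded_partials_lipschitz:
  fixes f :: "real^'m::finite \<Rightarrow> 'b::real_normed_vector"
  assumes S: "convex S" and f: "\<And>x. x \<in> S \<Longrightarrow> f differentiable (at x)"
    and B: "\<And>i x. x \<in> S \<Longrightarrow> norm (partial i f x) \<le> B" and xy: "x \<in> S" "y \<in> S"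
  shows "norm (f x - f y) \<le> real CARD('m) * B * norm (x - y)"
proof (rule differentiable_bound[OF S])
  fix z assume z: "z \<in> S"
  show "(f has_derivative frechet_derivative f (at z)) (at z within S)"
    using f[OF z] by (simp add: frechet_derivative_works has_derivative_at_withinI)
  have "norm (frechet_derivative f (at z) v) \<le> real CARD('m) * B * norm v" for v
  proof -
    have "norm (frechet_derivative f (at z) v) \<le> (\<Sum>i\<in>UNIV. norm (v $ i *\<^sub>R partial i f z))"
      unfolding frechet_derivative_partials[OF f[OF z]] by (rule norm_sum)
    also have "\<dots> \<le> (\<Sum>i\<in>(UNIV::'m set). norm v * B)"
      unfolding norm_scaleR real_norm_def by (intro sum_mono mult_mono B z component_le_norm_cart) auto
    finally show ?thesis by (simp add: mult_ac)
  qed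
  then show "onorm (frechet_derivative f (at z)) \<le> real CARD('m) * B" by (rule onorm_le)
qed (use xy in auto)

subsection \<open>Test functions\<close>

lemma test_functionD:
  assumes "test_function \<Omega> \<zeta>"
  shows "\<zeta> differentiable (at x)" "continuous_on UNIV (partial i \<zeta>)" "x \<notin> \<Omega> \<Longrightarrow> \<zeta> x = 0"
    "compact (closure {x. \<zeta> x \<noteq> 0})"
proof -
  have "C_k 1 UNIV \<zeta>" using assms by (simp add: test_function_def)
  then have "(\<forall>ks. length ks < 1 \<longrightarrow> (\<forall>x\<in>UNIV. partials ks \<zeta> differentiable (at x)))"
    "(\<forall>ks. length ks \<le> 1 \<longrightarrow> continuous_on UNIV (partials ks \<zeta>))"
    unfolding C_k_def by blast+
  from this(1)[rule_format, of "[]"] this(2)[rule_format, of "[i]"]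
  show "\<zeta> differentiable (at x)" "continuous_on UNIV (partial i \<zeta>)" by (simp_all add: partials_def)
  show "x \<notin> \<Omega> \<Longrightarrow> \<zeta> x = 0" "compact (closure {x. \<zeta> x \<noteq> 0})"
    using assms closure_subset[of "{x. \<zeta> x \<noteq> 0}"] unfolding test_function_def by blast+
qed

lemma test_function_partial_bounded:
  fixes \<zeta> :: "real^'m::finite \<Rightarrow> real"
  assumes \<zeta>: "test_function \<Omega> \<zeta>"
  obtains B where "\<And>i x. \<bar>partial i \<zeta> x\<bar> \<le> B"
proof -
  let ?S = "closure {x. \<zeta> x \<noteq> 0}"
  have "\<exists>B\<ge>0. \<forall>x. \<bar>partial i \<zeta> x\<bar> \<le> B" for i
  proof -
    have "compact (partial i \<zeta> ` ?S)"
      by (intro compact_continuous_image test_functionD(4)[OF \<zeta>] continuous_on_subset[OF test_functionD(2)[OF \<zeta>]]) auto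
    then obtain B where B: "\<forall>y\<in>partial i \<zeta> ` ?S. norm y \<le> B" using compact_imp_bounded bounded_iff by blast
    have "partial i \<zeta> x = 0" if x: "x \<notin> ?S" for x
    proof -
      have 0: "((\<lambda>y. 0 :: real) has_derivative (\<lambda>v. 0)) (at x)" by simp
      have "(\<zeta> has_derivative (\<lambda>v. 0)) (at x)"
        by (rule has_derivative_transform_within_open[OF 0, of "- ?S"])
          (use x closure_subset[of "{x. \<zeta> x \<noteq> 0}"] in auto)
      then show ?thesis by (simp add: partial_eq)
    qed
    then have "\<bar>partial i \<zeta> x\<bar> \<le> \<bar>B\<bar>" for x using B by (cases "x \<in> ?S") fastforce+
    then show ?thesis by (intro exI[of _ "\<bar>B\<bar>"]) auto
  qed
  then obtain B where B: "\<And>i. B i \<ge> 0" "\<And>i x. \<bar>partial i \<zeta> x\<bar> \<le> B i" by metis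
  have "\<bar>partial i \<zeta> x\<bar> \<le> (\<Sum>i\<in>UNIV. B i)" for i x
    using B(2)[of i x] member_le_sum[of i UNIV B] B(1) by fastforce
  then show ?thesis by (rule that)
qed

lemma test_function_LC:
  fixes \<zeta> :: "real^'m::finite \<Rightarrow> real"
  assumes \<zeta>: "test_function \<Omega> \<zeta>"
  shows "LC \<zeta>"
proof -
  obtain B where B: "\<And>i x. \<bar>partial i \<zeta> x\<bar> \<le> B" using test_function_partial_bounded[OF \<zeta>] by blast
  have "Lip \<zeta>"
  proof (rule LipI)
    fix x y
    show "\<bar>\<zeta> x - \<zeta> y\<bar> \<le> real CARD('m) * B * norm (x - y)"
      using bounded_partials_lipschitz[of UNIV \<zeta> B x y] test_functionD(1)[OF \<zeta>] B by simp
  qed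
  moreover have "bounded {x. \<zeta> x \<noteq> 0}"
    using test_functionD(4)[OF \<zeta>] compact_imp_bounded bounded_subset closure_subset by metis
  ultimately show ?thesis by (simp add: LC_def)
qed

lemma integrable_mult_bounded_measurable:
  fixes f g :: "real^'m::finite \<Rightarrow> real"
  assumes f: "set_integrable lebesgue \<Omega> f" and g: "continuous_on UNIV g" and B: "\<And>x. \<bar>g x\<bar> \<le> B"
  shows "set_integrable lebesgue \<Omega> (\<lambda>x. f x * g x)"
proof -
  have i: "integrable lebesgue (\<lambda>x. indicator \<Omega> x *\<^sub>R f x)" using f by (simp add: set_integrable_def)
  have gm: "g \<in> borel_measurable lebesgue"
    using borel_measurable_continuous_onI[OF g] by (intro measurable_completion) simp
  have "integrable lebesgue (\<lambda>x. (indicator \<Omega> x *\<^sub>R f x) * g x)"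
  proof (rule Bochner_Integration.integrable_bound)
    show "integrable lebesgue (\<lambda>x. B * (indicator \<Omega> x *\<^sub>R f x))" using i by (rule integrable_mult_right)
    show "(\<lambda>x. (indicator \<Omega> x *\<^sub>R f x) * g x) \<in> borel_measurable lebesgue"
      using borel_measurable_integrable[OF i] gm by (rule borel_measurable_times)
    have "\<bar>g x\<bar> \<le> \<bar>B\<bar>" for x using B[of x] by simp
    then show "AE x in lebesgue. norm ((indicator \<Omega> x *\<^sub>R f x) * g x) \<le> norm (B * (indicator \<Omega> x *\<^sub>R f x))"
      by (intro AE_I2) (simp add: abs_mult mult.commute mult_right_mono)
  qed
  then show ?thesis by (simp add: set_integrable_def mult.assoc)
qed

lemma test_function_set_integrable:
  assumes f: "set_integrable lebesgue \<Omega> f" and \<zeta>: "test_function \<Omega> \<zeta>"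
  shows "set_integrable lebesgue \<Omega> (\<lambda>x. f x * \<zeta> x)" "set_integrable lebesgue \<Omega> (\<lambda>x. f x * partial i \<zeta> x)"
proof -
  note LC = test_function_LC[OF \<zeta>]
  obtain B where "\<And>x. \<bar>\<zeta> x\<bar> \<le> B" using LC_bounded[OF LC] by metis
  from integrable_mult_bounded_measurable[OF f Lip_continuous[OF LC_Lip[OF LC]] this]
  show "set_integrable lebesgue \<Omega> (\<lambda>x. f x * \<zeta> x)" .
  obtain B where "\<And>i x. \<bar>partial i \<zeta> x\<bar> \<le> B" using test_function_partial_bounded[OF \<zeta>] by metis
  from integrable_mult_bounded_measurable[OF f test_functionD(2)[OF \<zeta>] this]
  show "set_integrable lebesgue \<Omega> (\<lambda>x. f x * partial i \<zeta> x)" .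
qed

lemma set_integrable_nth:
  fixes v :: "real^'m::finite \<Rightarrow> real^'m"
  assumes "set_integrable M \<Omega> v" shows "set_integrable M \<Omega> (\<lambda>x. v x $ i)"
  using integrable_bounded_linear[OF bounded_linear_vec_nth, of M "\<lambda>x. indicator \<Omega> x *\<^sub>R v x" i] assms
  by (simp add: set_integrable_def)

subsection \<open>Weak gradients\<close>

text \<open>The fundamental lemma for each component. \<open>weak_gradient\<close> is an arbitrary
  choice, and this is what permits computing with it.\<close>

lemma weak_gradient_unique:
  fixes u :: "real^'m::finite \<Rightarrow> real"
  assumes \<Omega>: "open \<Omega>" and v: "set_integrable lebesgue \<Omega> v" "has_weak_gradient \<Omega> u v"
    and v': "set_integrable lebesgue \<Omega> v'" "has_weak_gradient \<Omega> u v'"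
  shows "AE x in lebesgue. x \<in> \<Omega> \<longrightarrow> v x = v' x"
proof -
  have "AE x in lebesgue. x \<in> \<Omega> \<longrightarrow> v x $ i - v' x $ i = 0" for i
  proof (rule fundamental_lemma[OF _ \<Omega>])
    show "set_integrable lebesgue \<Omega> (\<lambda>x. v x $ i - v' x $ i)"
      by (intro set_integral_diff set_integrable_nth v v')
    fix \<zeta> assume \<zeta>: "test_function \<Omega> \<zeta>"
    note i = test_function_set_integrable(1)[OF set_integrable_nth[OF v(1)] \<zeta>]
      test_function_set_integrable(1)[OF set_integrable_nth[OF v'(1)] \<zeta>]
    have "(LINT x:\<Omega>|lebesgue. u x * partial i \<zeta> x) = - (LINT x:\<Omega>|lebesgue. v x $ i * \<zeta> x)"
      "(LINT x:\<Omega>|lebesgue. u x * partial i \<zeta> x) = - (LINT x:\<Omega>|lebesgue. v' x $ i * \<zeta> x)"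
      using v(2) v'(2) \<zeta> unfolding has_weak_gradient_def by blast+
    then have "(LINT x:\<Omega>|lebesgue. v x $ i * \<zeta> x) = (LINT x:\<Omega>|lebesgue. v' x $ i * \<zeta> x)" by linarith
    then show "(LINT x:\<Omega>|lebesgue. (v x $ i - v' x $ i) * \<zeta> x) = 0"
      unfolding left_diff_distrib using set_integral_diff(2)[OF i] by simp
  qed
  then have "AE x in lebesgue. \<forall>i. x \<in> \<Omega> \<longrightarrow> v x $ i - v' x $ i = 0"
    by (intro AE_all_countable[THEN iffD2] allI) auto
  then show ?thesis by eventually_elim (simp add: vec_eq_iff)
qed

lemma weak_gradientD:
  assumes "u \<in> W11 \<Omega>"
  shows "set_integrable lebesgue \<Omega> (weak_gradient \<Omega> u)" "has_weak_gradient \<Omega> u (weak_gradient \<Omega> u)"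
proof -
  have "\<exists>v. set_integrable lebesgue \<Omega> v \<and> has_weak_gradient \<Omega> u v" using assms by (simp add: W11_def)
  from someI_ex[OF this] show "set_integrable lebesgue \<Omega> (weak_gradient \<Omega> u)" "has_weak_gradient \<Omega> u (weak_gradient \<Omega> u)"
    by (auto simp: weak_gradient_def)
qed

lemma W11_add:
  fixes u v :: "real^'m::finite \<Rightarrow> real"
  assumes \<Omega>: "open \<Omega>" and u: "u \<in> W11 \<Omega>" and v: "v \<in> W11 \<Omega>"
  shows "(\<lambda>x. u x + v x) \<in> W11 \<Omega>"
    "AE x in lebesgue. x \<in> \<Omega> \<longrightarrow> weak_gradient \<Omega> (\<lambda>x. u x + v x) x = weak_gradient \<Omega> u x + weak_gradient \<Omega> v x"
proof -
  have ui: "set_integrable lebesgue \<Omega> u" and vi: "set_integrable lebesgue \<Omega> v" using u v by (auto simp: W11_def)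
  note gu = weak_gradientD[OF u] and gv = weak_gradientD[OF v]
  have i: "set_integrable lebesgue \<Omega> (\<lambda>x. weak_gradient \<Omega> u x + weak_gradient \<Omega> v x)"
    by (rule set_integral_add(1)[OF gu(1) gv(1)])
  have w: "has_weak_gradient \<Omega> (\<lambda>x. u x + v x) (\<lambda>x. weak_gradient \<Omega> u x + weak_gradient \<Omega> v x)"
    unfolding has_weak_gradient_def
  proof (intro allI impI)
    fix \<zeta> i assume \<zeta>: "test_function \<Omega> \<zeta>"
    note 1 = set_integral_add(2)[OF test_function_set_integrable(2)[OF ui \<zeta>] test_function_set_integrable(2)[OF vi \<zeta>], of i i]
    note 2 = set_integral_add(2)[OF test_function_set_integrable(1)[OF set_integrable_nth[OF gu(1)] \<zeta>]
        test_function_set_integrable(1)[OF set_integrable_nth[OF gv(1)] \<zeta>], of i i]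
    have "(LINT x:\<Omega>|lebesgue. u x * partial i \<zeta> x) = - (LINT x:\<Omega>|lebesgue. weak_gradient \<Omega> u x $ i * \<zeta> x)"
      "(LINT x:\<Omega>|lebesgue. v x * partial i \<zeta> x) = - (LINT x:\<Omega>|lebesgue. weak_gradient \<Omega> v x $ i * \<zeta> x)"
      using gu(2) gv(2) \<zeta> unfolding has_weak_gradient_def by blast+
    with 1 2 show "(LINT x:\<Omega>|lebesgue. (u x + v x) * partial i \<zeta> x) =
        - (LINT x:\<Omega>|lebesgue. (weak_gradient \<Omega> u x + weak_gradient \<Omega> v x) $ i * \<zeta> x)"
      by (simp add: distrib_right)
  qed
  show W: "(\<lambda>x. u x + v x) \<in> W11 \<Omega>"
    unfolding W11_def using set_integral_add(1)[OF ui vi] i w by auto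
  show "AE x in lebesgue. x \<in> \<Omega> \<longrightarrow> weak_gradient \<Omega> (\<lambda>x. u x + v x) x = weak_gradient \<Omega> u x + weak_gradient \<Omega> v x"
    by (rule weak_gradient_unique[OF \<Omega> weak_gradientD[OF W] i w])
qed

lemma set_integrable_continuous_bounded:
  fixes g :: "real^'m::finite \<Rightarrow> 'b::{banach, second_countable_topology}"
  assumes \<Omega>: "open \<Omega>" "bounded \<Omega>" and g: "continuous_on \<Omega> g" "\<And>x. x \<in> \<Omega> \<Longrightarrow> norm (g x) \<le> B"
  shows "set_integrable lebesgue \<Omega> g"
proof -
  have \<Omega>_sets: "\<Omega> \<in> sets borel" using \<Omega>(1) by simp
  have const: "integrable lborel (\<lambda>x. indicator \<Omega> x * B)"
    by (intro integrable_mult_left integrable_real_indicator emeasure_bounded_finite[OF \<Omega>(2)]) (use \<Omega>_sets in simp)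
  have m: "(\<lambda>x. indicator \<Omega> x *\<^sub>R g x) \<in> borel_measurable borel"
    by (rule borel_measurable_continuous_on_indicator[OF \<Omega>_sets g(1)])
  have "integrable lborel (\<lambda>x. indicator \<Omega> x *\<^sub>R g x)"
  proof (rule Bochner_Integration.integrable_bound[OF const])
    show "AE x in lborel. norm (indicator \<Omega> x *\<^sub>R g x) \<le> norm (indicator \<Omega> x * B)"
      using g(2) by (intro AE_I2) (force split: split_indicator)
  qed (use m in simp)
  then show ?thesis using m by (simp add: set_integrable_def integrable_completion)
qed

text \<open>Integration by parts is the vanishing of the integral of the derivative of
  \<open>(\<phi> + w) \<zeta>\<close>, a Lipschitz function of bounded support.\<close>

lemma has_weak_gradient_lipschitz:
  fixes \<phi> w :: "real^'m::finite \<Rightarrow> real"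
  assumes \<Omega>: "open \<Omega>" "bounded \<Omega>"
    and \<phi>: "\<And>x y. x \<in> \<Omega> \<Longrightarrow> y \<in> \<Omega> \<Longrightarrow> \<bar>\<phi> x - \<phi> y\<bar> \<le> C * norm (x - y)" "\<And>x. x \<in> \<Omega> \<Longrightarrow> \<bar>\<phi> x\<bar> \<le> B"
    and \<Phi>: "\<And>x. x \<in> \<Omega> \<Longrightarrow> has_grad \<phi> x (\<Phi> x)" "continuous_on \<Omega> \<Phi>" "\<And>x. x \<in> \<Omega> \<Longrightarrow> norm (\<Phi> x) \<le> B"
    and w: "Lip w" "\<And>x. x \<notin> \<Omega> \<Longrightarrow> w x = 0"
  shows "set_integrable lebesgue \<Omega> (\<lambda>x. \<phi> x + w x)" "set_integrable lebesgue \<Omega> (\<lambda>x. \<Phi> x + grad w x)"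
    "has_weak_gradient \<Omega> (\<lambda>x. \<phi> x + w x) (\<lambda>x. \<Phi> x + grad w x)"
proof -
  have "bounded {x. w x \<noteq> 0}" by (rule bounded_subset[OF \<Omega>(2)]) (use w in auto)
  then have wLC: "LC w" using w by (simp add: LC_def)
  have \<Omega>_sets: "\<Omega> \<in> sets borel" using \<Omega>(1) by simp
  note bi = set_integrable_continuous_bounded[OF \<Omega>]
  have gm: "grad w \<in> borel_measurable borel" by (intro grad_measurable Lip_measurable w)
  have "\<phi> absolutely_integrable_on \<Omega>"
  proof (rule bi[OF _])
    have "\<bar>C\<bar>-lipschitz_on \<Omega> \<phi>"
    proof (rule lipschitz_onI)
      fix x y assume "x \<in> \<Omega>" "y \<in> \<Omega>"
      then show "dist (\<phi> x) (\<phi> y) \<le> \<bar>C\<bar> * dist x y"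
        using \<phi>(1)[of x y] mult_right_mono[OF abs_ge_self[of C] norm_ge_zero[of "x - y"]] by (simp add: dist_norm)
    qed simp
    then show "continuous_on \<Omega> \<phi>" by (rule lipschitz_on_continuous_on)
  qed (use \<phi>(2) in auto)
  moreover have "set_integrable lebesgue \<Omega> w"
    unfolding set_integrable_def
  proof (rule integrable_mult_indicator)
    show "integrable lebesgue w"
      using LC_integrable[OF wLC] Lip_measurable[OF w(1)] by (simp add: integrable_completion)
  qed (use \<Omega>_sets in auto)
  ultimately show ui: "set_integrable lebesgue \<Omega> (\<lambda>x. \<phi> x + w x)" by (rule set_integral_add(1))
  have "set_integrable lebesgue \<Omega> (grad w)"
    unfolding set_integrable_def
  proof (rule integrable_mult_indicator)
    show "integrable lebesgue (grad w)"
      using LC_grad_integrable[OF wLC] gm by (simp add: integrable_completion)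
  qed (use \<Omega>_sets in auto)
  with bi[OF \<Phi>(2,3)] show vi: "set_integrable lebesgue \<Omega> (\<lambda>x. \<Phi> x + grad w x)" by (rule set_integral_add(1))
  show "has_weak_gradient \<Omega> (\<lambda>x. \<phi> x + w x) (\<lambda>x. \<Phi> x + grad w x)"
    unfolding has_weak_gradient_def
  proof (intro allI impI)
    fix \<zeta> i assume \<zeta>: "test_function \<Omega> \<zeta>"
    let ?u = "\<lambda>x. \<phi> x + w x"
    let ?v = "\<lambda>x. (\<Phi> x + grad w x) $ i"
    define g where "g x = ?u x * \<zeta> x" for x
    note \<zeta>LC = test_function_LC[OF \<zeta>] and \<zeta>0 = test_functionD(3)[OF \<zeta>]
    obtain D where D: "D \<ge> 0" "\<And>x y. \<bar>\<zeta> x - \<zeta> y\<bar> \<le> D * norm (x - y)" using LipE[OF LC_Lip[OF \<zeta>LC]] by metis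
    obtain D' where D': "D' \<ge> 0" "\<And>x y. \<bar>w x - w y\<bar> \<le> D' * norm (x - y)" using LipE[OF w(1)] by metis
    obtain E where E: "E \<ge> 0" "\<And>x. \<bar>\<zeta> x\<bar> \<le> E" using LC_bounded[OF \<zeta>LC] by metis
    obtain E' where E': "E' \<ge> 0" "\<And>x. \<bar>w x\<bar> \<le> E'" using LC_bounded[OF wLC] by metis
    have ub: "\<bar>?u x\<bar> \<le> \<bar>B\<bar> + E'" if "x \<in> \<Omega>" for x using \<phi>(2)[OF that] E'(2)[of x] by simp
    have gLip: "Lip g"
    \<comment> \<open>Nothing is known about \<open>\<phi>\<close> outside \<Omega>, but \<zeta>
      vanishes there, so the product is Lipschitz on the whole space.\<close>
    proof (rule Lip_extend_zero[where U = \<Omega> and C = "(\<bar>C\<bar> + D') * E + (\<bar>B\<bar> + E') * D"])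
      fix x y assume x: "x \<in> \<Omega>"
      { assume y: "y \<in> \<Omega>"
        have "\<bar>\<phi> x - \<phi> y\<bar> \<le> \<bar>C\<bar> * norm (x - y)"
          using \<phi>(1)[OF x y] mult_right_mono[OF abs_ge_self[of C] norm_ge_zero[of "x - y"]] by linarith
        then have ul: "\<bar>?u x - ?u y\<bar> \<le> (\<bar>C\<bar> + D') * norm (x - y)" using D'(2)[of x y] by (simp add: algebra_simps)
        have "g x - g y = (?u x - ?u y) * \<zeta> x + ?u y * (\<zeta> x - \<zeta> y)" by (simp add: g_def algebra_simps)
        then have "\<bar>g x - g y\<bar> \<le> \<bar>?u x - ?u y\<bar> * \<bar>\<zeta> x\<bar> + \<bar>?u y\<bar> * \<bar>\<zeta> x - \<zeta> y\<bar>"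
          by (metis abs_mult abs_triangle_ineq)
        also have "\<dots> \<le> ((\<bar>C\<bar> + D') * norm (x - y)) * E + (\<bar>B\<bar> + E') * (D * norm (x - y))"
          using ul ub[OF y] E E' D(1) D(2)[of x y] D' by (intro add_mono mult_mono) auto
        finally show "\<bar>g x - g y\<bar> \<le> ((\<bar>C\<bar> + D') * E + (\<bar>B\<bar> + E') * D) * norm (x - y)" by (simp add: algebra_simps) }
      { assume y: "y \<notin> \<Omega>"
        have "\<bar>g x\<bar> = \<bar>?u x\<bar> * \<bar>\<zeta> x - \<zeta> y\<bar>" using \<zeta>0[OF y] by (simp add: g_def abs_mult)
        also have "\<dots> \<le> (\<bar>B\<bar> + E') * (D * norm (x - y))"
          using ub[OF x] D(2)[of x y] E' by (intro mult_mono) auto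
        also have "\<dots> \<le> ((\<bar>C\<bar> + D') * E + (\<bar>B\<bar> + E') * D) * norm (x - y)"
          using D' E by (simp add: algebra_simps)
        finally show "\<bar>g x\<bar> \<le> ((\<bar>C\<bar> + D') * E + (\<bar>B\<bar> + E') * D) * norm (x - y)" . }
    qed (simp add: g_def \<zeta>0)
    have "bounded {x. g x \<noteq> 0}" by (rule bounded_subset[OF \<Omega>(2)]) (use \<zeta>0 in \<open>auto simp: g_def\<close>)
    then have gLC: "LC g" using gLip by (simp add: LC_def)
    have "AE x in lborel. pd i g x = indicator \<Omega> x *\<^sub>R (?v x * \<zeta> x + ?u x * partial i \<zeta> x)"
      using Lip_has_grad_AE[OF w(1)] Lip_grad_zero_AE[OF gLip]
    proof eventually_elim
      case (elim x)
      show ?case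
      proof (cases "x \<in> \<Omega>")
        case True
        have "line_deriv i ?u x (?v x)" using has_grad_add[OF \<Phi>(1)[OF True] elim(1)] by (simp add: has_grad_def)
        moreover have "line_deriv i \<zeta> x (partial i \<zeta> x)"
          using differentiable_has_grad[OF test_functionD(1)[OF \<zeta>]] by (simp add: has_grad_def)
        ultimately have "line_deriv i g x (?v x * \<zeta> x + partial i \<zeta> x * ?u x)" unfolding g_def by (rule line_deriv_mult)
        then show ?thesis using True by (simp add: pd_eq mult.commute)
      next
        case False
        then have "g x = 0" using \<zeta>0 by (simp add: g_def)
        then have "grad g x = 0" using elim(2) by simp
        then show ?thesis using False by (simp add: vec_eq_iff)
      qed
    qed
    then have eq: "AE x in lebesgue. pd i g x = indicator \<Omega> x *\<^sub>R (?v x * \<zeta> x + ?u x * partial i \<zeta> x)"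
      by (rule AE_completion)
    have pm: "pd i g \<in> borel_measurable lborel" using pd_measurable[OF Lip_measurable[OF gLip]] by simp
    note 1 = test_function_set_integrable(1)[OF set_integrable_nth[OF vi] \<zeta>, of i]
      and 2 = test_function_set_integrable(2)[OF ui \<zeta>, of i]
    have "(LINT x:\<Omega>|lebesgue. ?v x * \<zeta> x + ?u x * partial i \<zeta> x) = (\<integral>x. pd i g x \<partial>lebesgue)"
      unfolding set_lebesgue_integral_def
    proof (rule integral_cong_AE)
      show "AE x in lebesgue. indicator \<Omega> x *\<^sub>R (?v x * \<zeta> x + ?u x * partial i \<zeta> x) = pd i g x"
        using eq by eventually_elim simp
      show "(\<lambda>x. indicator \<Omega> x *\<^sub>R (?v x * \<zeta> x + ?u x * partial i \<zeta> x)) \<in> borel_measurable lebesgue"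
        using set_integral_add(1)[OF 1 2] by (simp add: set_integrable_def)
    qed (use measurable_completion[OF pm] in simp)
    also have "\<dots> = (\<integral>x. pd i g x \<partial>lborel)" by (rule integral_completion[OF pm])
    also have "\<dots> = 0" by (rule LC_pd_integral_zero(2)[OF gLC])
    finally have "(LINT x:\<Omega>|lebesgue. ?v x * \<zeta> x) + (LINT x:\<Omega>|lebesgue. ?u x * partial i \<zeta> x) = 0"
      using set_integral_add(2)[OF 1 2] by simp
    then show "(LINT x:\<Omega>|lebesgue. ?u x * partial i \<zeta> x) = - (LINT x:\<Omega>|lebesgue. ?v x * \<zeta> x)" by simp
  qed
qed

section \<open>From Lipschitz to Sobolev variations\<close>

context haar begin

text \<open>Test functions are Lipschitz variations, for which minimality is known. For a general
  \<psi> with approximating test functions \<open>\<zeta> n\<close>, replacing \<psi> by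
  \<open>\<zeta> n\<close> changes the functional by at most the \<open>L^1\<close> norm of the weak
  gradient of \<open>\<psi> - \<zeta> n\<close>, which tends to zero.\<close>

lemma is_minimizer_if_energy_minimal:
  fixes \<phi> w :: "real^'m \<Rightarrow> real" and \<Phi> F0 :: "real^'m \<Rightarrow> real^'m"
  assumes \<phi>: "\<And>x y. x \<in> \<Omega> \<Longrightarrow> y \<in> \<Omega> \<Longrightarrow> \<bar>\<phi> x - \<phi> y\<bar> \<le> C * norm (x - y)" "\<And>x. x \<in> \<Omega> \<Longrightarrow> \<bar>\<phi> x\<bar> \<le> B"
    and \<Phi>: "\<And>x. x \<in> \<Omega> \<Longrightarrow> has_grad \<phi> x (\<Phi> x)" "continuous_on \<Omega> \<Phi>" "\<And>x. x \<in> \<Omega> \<Longrightarrow> norm (\<Phi> x) \<le> B"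
    and F0: "set_integrable lebesgue \<Omega> F0" "\<And>x. x \<in> \<Omega> \<Longrightarrow> F x = F0 x + \<Phi> x"
    and w: "Lip w" "\<And>x. x \<notin> \<Omega> \<Longrightarrow> w x = 0"
    and min: "\<And>\<zeta>. Lip \<zeta> \<Longrightarrow> (\<And>x. x \<notin> \<Omega> \<Longrightarrow> \<zeta> x = 0) \<Longrightarrow> energy norm w \<le> energy norm (\<lambda>x. w x + \<zeta> x)"
  shows "is_minimizer \<Omega> F0 (\<lambda>x. \<phi> x + w x)"
proof -
  have wg: "set_integrable lebesgue \<Omega> (\<lambda>x. \<phi> x + v x)" "set_integrable lebesgue \<Omega> (\<lambda>x. \<Phi> x + grad v x)"
    "has_weak_gradient \<Omega> (\<lambda>x. \<phi> x + v x) (\<lambda>x. \<Phi> x + grad v x)"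
    if v: "Lip v" "\<forall>x. x \<notin> \<Omega> \<longrightarrow> v x = 0" for v
    by (rule has_weak_gradient_lipschitz[OF open_\<Omega> bounded_\<Omega> \<phi> \<Phi> v(1) v(2)[rule_format]]; assumption)+
  have W: "(\<lambda>x. \<phi> x + v x) \<in> W11 \<Omega>" if v: "Lip v" "\<forall>x. x \<notin> \<Omega> \<longrightarrow> v x = 0" for v
    unfolding W11_def using wg[OF v] by blast
  have int: "set_integrable lebesgue \<Omega> (\<lambda>x. norm (weak_gradient \<Omega> v x + F0 x))" if "v \<in> W11 \<Omega>" for v
    by (rule set_integrable_norm[OF set_integral_add(1)[OF weak_gradientD(1)[OF that] F0(1)]])
  have func: "functional_F \<Omega> F0 (\<lambda>x. \<phi> x + v x) = energy norm v" if v: "Lip v" "\<forall>x. x \<notin> \<Omega> \<longrightarrow> v x = 0" for v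
  proof -
    have m: "(\<lambda>x. indicator \<Omega> x * norm (V v x)) \<in> borel_measurable lborel"
      using V_measurable[OF Lip_measurable[OF v(1)], of norm] by simp
    have "functional_F \<Omega> F0 (\<lambda>x. \<phi> x + v x) = (\<integral>x. indicator \<Omega> x * norm (V v x) \<partial>lebesgue)"
      unfolding functional_F_def set_lebesgue_integral_def
    proof (rule integral_cong_AE)
      show "AE x in lebesgue. indicator \<Omega> x *\<^sub>R norm (weak_gradient \<Omega> (\<lambda>x. \<phi> x + v x) x + F0 x) = indicator \<Omega> x * norm (V v x)"
        using weak_gradient_unique[OF open_\<Omega> weak_gradientD[OF W[OF v]] wg(2,3)[OF v]]
      proof eventually_elim
        case (elim x)
        then show ?case using F0(2)[of x] by (cases "x \<in> \<Omega>") (auto simp: V_def algebra_simps)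
      qed
      show "(\<lambda>x. indicator \<Omega> x *\<^sub>R norm (weak_gradient \<Omega> (\<lambda>x. \<phi> x + v x) x + F0 x)) \<in> borel_measurable lebesgue"
        using int[OF W[OF v]] by (simp add: set_integrable_def)
    qed (rule measurable_completion[OF m])
    also have "\<dots> = energy norm v" unfolding energy_def by (rule integral_completion[OF m])
    finally show ?thesis .
  qed
  have w': "Lip w" "\<forall>x. x \<notin> \<Omega> \<longrightarrow> w x = 0" using w by blast+
  have "functional_F \<Omega> F0 (\<lambda>x. \<phi> x + w x) \<le> functional_F \<Omega> F0 (\<lambda>x. (\<phi> x + w x) + \<psi> x)" if \<psi>: "\<psi> \<in> W11_0 \<Omega>" for \<psi>
  proof -
    obtain \<zeta> where \<zeta>: "\<And>n. test_function \<Omega> (\<zeta> n)" and lim: "(\<lambda>n. W11_norm \<Omega> (\<lambda>x. \<psi> x - \<zeta> n x)) \<longlonglongrightarrow> 0"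
      and \<psi>W: "\<psi> \<in> W11 \<Omega>"
      using \<psi> by (auto simp: W11_0_def)
    have le: "functional_F \<Omega> F0 (\<lambda>x. \<phi> x + w x) \<le> functional_F \<Omega> F0 (\<lambda>x. (\<phi> x + w x) + \<psi> x) + W11_norm \<Omega> (\<lambda>x. \<psi> x - \<zeta> n x)" for n
    proof -
      have \<zeta>L: "Lip (\<zeta> n)" and \<zeta>0: "\<And>x. x \<notin> \<Omega> \<Longrightarrow> \<zeta> n x = 0"
        using LC_Lip[OF test_function_LC[OF \<zeta>]] test_functionD(3)[OF \<zeta>] by auto
      have w\<zeta>: "Lip (\<lambda>x. w x + \<zeta> n x)" "\<forall>x. x \<notin> \<Omega> \<longrightarrow> w x + \<zeta> n x = 0"
        using Lip_add[OF w(1) \<zeta>L] w(2) \<zeta>0 by auto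
      let ?u = "\<lambda>x. \<phi> x + (w x + \<zeta> n x)" and ?p = "\<lambda>x. \<psi> x - \<zeta> n x"
      have uW: "?u \<in> W11 \<Omega>" by (rule W[OF w\<zeta>])
      \<comment> \<open>The case of zero boundary datum puts the negative test function into
        \<open>W11\<close>, so that \<open>\<psi> - \<zeta> n\<close> can be treated as a
        sum.\<close>
      have "set_integrable lebesgue \<Omega> (\<lambda>x. 0 + - \<zeta> n x)" "set_integrable lebesgue \<Omega> (\<lambda>x. 0 + grad (\<lambda>x. - \<zeta> n x) x)"
        "has_weak_gradient \<Omega> (\<lambda>x. 0 + - \<zeta> n x) (\<lambda>x. 0 + grad (\<lambda>x. - \<zeta> n x) x)"
        by (rule has_weak_gradient_lipschitz[OF open_\<Omega> bounded_\<Omega> _ _ has_grad_const _ _ Lip_uminus[OF \<zeta>L], where C = 0 and B = 0];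
          simp add: \<zeta>0)+
      then have "(\<lambda>x. - \<zeta> n x) \<in> W11 \<Omega>" unfolding W11_def by auto
      from W11_add(1)[OF open_\<Omega> \<psi>W this] have pW: "?p \<in> W11 \<Omega>" by simp
      have sum: "(\<lambda>x. ?u x + ?p x) = (\<lambda>x. (\<phi> x + w x) + \<psi> x)" by (simp add: fun_eq_iff)
      note add = W11_add[OF open_\<Omega> uW pW, unfolded sum]
      have "functional_F \<Omega> F0 (\<lambda>x. \<phi> x + w x) \<le> functional_F \<Omega> F0 ?u"
        unfolding func[OF w'] func[OF w\<zeta>] by (rule min[OF \<zeta>L \<zeta>0])
      also have "\<dots> \<le> (LINT x:\<Omega>|lebesgue. norm (weak_gradient \<Omega> (\<lambda>x. (\<phi> x + w x) + \<psi> x) x + F0 x) + norm (weak_gradient \<Omega> ?p x))"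
        unfolding functional_F_def
      proof (rule set_integral_mono_AE)
        show "set_integrable lebesgue \<Omega> (\<lambda>x. norm (weak_gradient \<Omega> ?u x + F0 x))" by (rule int[OF uW])
        show "set_integrable lebesgue \<Omega> (\<lambda>x. norm (weak_gradient \<Omega> (\<lambda>x. (\<phi> x + w x) + \<psi> x) x + F0 x) + norm (weak_gradient \<Omega> ?p x))"
          by (rule set_integral_add(1)[OF int[OF add(1)] set_integrable_norm[OF weak_gradientD(1)[OF pW]]])
        show "AE x\<in>\<Omega> in lebesgue. norm (weak_gradient \<Omega> ?u x + F0 x) \<le>
            norm (weak_gradient \<Omega> (\<lambda>x. (\<phi> x + w x) + \<psi> x) x + F0 x) + norm (weak_gradient \<Omega> ?p x)"
          using add(2)
        proof eventually_elim
          case (elim x)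
          show ?case
          proof
            assume "x \<in> \<Omega>"
            with elim have "weak_gradient \<Omega> ?u x + F0 x = (weak_gradient \<Omega> (\<lambda>x. (\<phi> x + w x) + \<psi> x) x + F0 x) - weak_gradient \<Omega> ?p x"
              by simp
            then show "norm (weak_gradient \<Omega> ?u x + F0 x) \<le>
                norm (weak_gradient \<Omega> (\<lambda>x. (\<phi> x + w x) + \<psi> x) x + F0 x) + norm (weak_gradient \<Omega> ?p x)"
              by (simp only: norm_triangle_ineq4)
          qed
        qed
      qed
      also have "\<dots> = functional_F \<Omega> F0 (\<lambda>x. (\<phi> x + w x) + \<psi> x) + (LINT x:\<Omega>|lebesgue. norm (weak_gradient \<Omega> ?p x))"
        unfolding functional_F_def
        by (rule set_integral_add(2)[OF int[OF add(1)] set_integrable_norm[OF weak_gradientD(1)[OF pW]]])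
      also have "(LINT x:\<Omega>|lebesgue. norm (weak_gradient \<Omega> ?p x)) \<le> W11_norm \<Omega> ?p"
      proof -
        have "(LINT x:\<Omega>|lebesgue. \<bar>?p x\<bar>) \<ge> 0"
          unfolding set_lebesgue_integral_def by (intro integral_nonneg_AE) auto
        then show ?thesis by (simp add: W11_norm_def)
      qed
      finally show ?thesis by simp
    qed
    have "(\<lambda>n. functional_F \<Omega> F0 (\<lambda>x. (\<phi> x + w x) + \<psi> x) + W11_norm \<Omega> (\<lambda>x. \<psi> x - \<zeta> n x)) \<longlonglongrightarrow>
        functional_F \<Omega> F0 (\<lambda>x. (\<phi> x + w x) + \<psi> x) + 0"
      by (intro tendsto_intros lim)
    then have "functional_F \<Omega> F0 (\<lambda>x. \<phi> x + w x) \<le> functional_F \<Omega> F0 (\<lambda>x. (\<phi> x + w x) + \<psi> x) + 0"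
      by (rule LIMSEQ_le_const) (use le in blast)
    then show ?thesis by simp
  qed
  then show ?thesis unfolding is_minimizer_def using F0(1) W[OF w'] by blast
qed

end

subsection \<open>The hypotheses on the data\<close>

lemma C_k_closure_bounded:
  assumes f: "C_k_closure k \<Omega> f" and \<Omega>: "bounded \<Omega>" and ks: "length ks \<le> k"
  obtains B where "\<And>x. x \<in> \<Omega> \<Longrightarrow> norm (partials ks f x) \<le> B"
proof -
  obtain g where g: "continuous_on (closure \<Omega>) g" "\<forall>x\<in>\<Omega>. g x = partials ks f x"
    using f ks unfolding C_k_closure_def by blast
  have "compact (g ` closure \<Omega>)" using \<Omega> by (intro compact_continuous_image g) simp
  then obtain B where "\<forall>y\<in>g ` closure \<Omega>. norm y \<le> B" using compact_imp_bounded bounded_iff by blast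
  then have "norm (partials ks f x) \<le> B" if "x \<in> \<Omega>" for x
    using g(2) that closure_subset[of \<Omega>] by force
  then show ?thesis by (rule that)
qed

lemma C_k_partials:
  assumes "C_k k \<Omega> f"
  shows "length ks < k \<Longrightarrow> x \<in> \<Omega> \<Longrightarrow> partials ks f differentiable (at x)"
    "length ks \<le> k \<Longrightarrow> continuous_on \<Omega> (partials ks f)"
  using assms[unfolded C_k_def, THEN conjunct1, rule_format] assms[unfolded C_k_def, THEN conjunct2, rule_format]
  by auto

text \<open>As the origin is at \<open>p\<close>, the coordinate map is \<open>R *v (x - p)\<close>;
  its coordinates are inner products with the rows of \<open>R\<close>, which are
  orthonormal.\<close>

lemma p_convex_parabolas:
  assumes "p_convex \<Omega>"
  obtains a where "a > 0" "\<And>p. p \<in> frontier \<Omega> \<Longrightarrow> \<exists>e f. norm e = 1 \<and> norm f = 1 \<and> e \<bullet> f = 0 \<and>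
        (\<forall>x\<in>\<Omega>. a * ((x - p) \<bullet> e)\<^sup>2 < (x - p) \<bullet> f)"
proof -
  obtain a where a: "a > 0" and T: "\<forall>p\<in>frontier \<Omega>. \<exists>T i j. orthonormal_coordinates T \<and> T p = 0 \<and> i \<noteq> j \<and>
      \<Omega> \<subseteq> {x. a * (T x $ i)\<^sup>2 - T x $ j < 0}"
    using assms unfolding p_convex_def by (elim exE conjE) (rule that)
  have "\<exists>e f. norm e = 1 \<and> norm f = 1 \<and> e \<bullet> f = 0 \<and> (\<forall>x\<in>\<Omega>. a * ((x - p) \<bullet> e)\<^sup>2 < (x - p) \<bullet> f)"
    if p: "p \<in> frontier \<Omega>" for p
  proof -
    obtain T i j where T: "orthonormal_coordinates T" "T p = 0" "i \<noteq> j" "\<Omega> \<subseteq> {x. a * (T x $ i)\<^sup>2 - T x $ j < 0}"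
      using bspec[OF T p] by (elim exE conjE) (rule that)
    obtain R c where R: "rotation_matrix R" and T_eq: "T = (\<lambda>x. R *v (x - c))"
      using T(1) by (auto simp: orthonormal_coordinates_def)
    have "T x = R *v (x - p)" for x
    proof -
      have "R *v (x - p) = R *v (x - c) - R *v (p - c)" by (simp add: matrix_vector_mult_diff_distrib[symmetric])
      then show ?thesis using T(2) by (simp add: T_eq)
    qed
    then have nth: "T x $ l = (x - p) \<bullet> row l R" for x l
      by (simp add: matrix_mult_dot inner_commute row_def)
    have "orthogonal_matrix R" using R by (simp add: rotation_matrix_def)
    then have "norm (row i R) = 1" "norm (row j R) = 1" "row i R \<bullet> row j R = 0"
      using T(3) by (auto simp: orthogonal_matrix_orthonormal_rows orthogonal_def)
    moreover have "\<forall>x\<in>\<Omega>. a * ((x - p) \<bullet> row i R)\<^sup>2 < (x - p) \<bullet> row j R"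
      using T(4) unfolding nth by auto
    ultimately show ?thesis by blast
  qed
  then show ?thesis by (rule that[OF a])
qed

text \<open>The parabola at a frontier point \<open>p\<close> gives a half space with
  \<open>p\<close> on its boundary and \<Omega> strictly inside. A segment with endpoints in
  \<Omega> cannot pass through \<open>p\<close>, so it never reaches the frontier.\<close>

lemma parabolas_imp_convex:
  fixes \<Omega> :: "'a::euclidean_space set"
  assumes \<Omega>: "open \<Omega>" and a: "a > 0"
    and par: "\<And>p. p \<in> frontier \<Omega> \<Longrightarrow> \<exists>e f. norm e = 1 \<and> norm f = 1 \<and> e \<bullet> f = 0 \<and>
        (\<forall>x\<in>\<Omega>. a * ((x - p) \<bullet> e)\<^sup>2 < (x - p) \<bullet> f)"
  shows "convex \<Omega>"
  unfolding convex_contains_segment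
proof (intro ballI subsetI)
  fix x y z assume x: "x \<in> \<Omega>" and y: "y \<in> \<Omega>" and z: "z \<in> closed_segment x y"
  show "z \<in> \<Omega>"
  proof (rule ccontr)
    assume "z \<notin> \<Omega>"
    have "closed_segment x y \<inter> frontier \<Omega> \<noteq> {}"
      by (rule connected_Int_frontier) (use x z \<open>z \<notin> \<Omega>\<close> in auto)
    then obtain p where p: "p \<in> closed_segment x y" "p \<in> frontier \<Omega>" by blast
    obtain e f where "\<forall>x\<in>\<Omega>. a * ((x - p) \<bullet> e)\<^sup>2 < (x - p) \<bullet> f" using par[OF p(2)] by blast
    then have pos: "(x - p) \<bullet> f > 0" "(y - p) \<bullet> f > 0"
      using x y a by (meson le_less_trans zero_le_power2 mult_nonneg_nonneg less_imp_le)+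
    obtain t where t: "0 \<le> t" "t \<le> 1" "p = (1 - t) *\<^sub>R x + t *\<^sub>R y" using p(1) by (auto simp: in_segment)
    have "0 = (1 - t) *\<^sub>R (x - p) + t *\<^sub>R (y - p)" using t(3) by (simp add: algebra_simps)
    then have "0 = ((1 - t) *\<^sub>R (x - p) + t *\<^sub>R (y - p)) \<bullet> f" by (metis inner_zero_left)
    then have "0 = (1 - t) * ((x - p) \<bullet> f) + t * ((y - p) \<bullet> f)" by (simp add: inner_add_left)
    moreover have "(1 - t) * ((x - p) \<bullet> f) + t * ((y - p) \<bullet> f) > 0"
    proof (cases "t = 0")
      case True then show ?thesis using pos by simp
    next
      case False
      then show ?thesis using pos t by (intro add_nonneg_pos mult_nonneg_nonneg mult_pos_pos) auto
    qed
    ultimately show False by simp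
  qed
qed

text \<open>Under the integral sign the derivative in direction \<open>I\<close> of the integrand
  is, by the hypothesis, the sum of \<open>h $ K\<close> times the \<open>K\<close>-th derivative of
  the \<open>I\<close>-th component of \<open>F\<close> at \<open>x + s *\<^sub>R h\<close>. This is
  the derivative in \<open>s\<close> of that component, and the fundamental theorem of calculus
  gives its increment.\<close>

lemma translation_potential:
  fixes F :: "real^'m::finite \<Rightarrow> real^'m" and f :: "'m \<Rightarrow> real^'m \<Rightarrow> real"
  assumes \<Omega>: "open \<Omega>" "convex \<Omega>"
    and F: "\<And>x. x \<in> \<Omega> \<Longrightarrow> F differentiable (at x)"
    and f: "\<And>K x. x \<in> \<Omega> \<Longrightarrow> f K differentiable (at x)" "\<And>K I. continuous_on \<Omega> (partial I (f K))"
    and curl: "\<And>I K x. x \<in> \<Omega> \<Longrightarrow> partial K (\<lambda>y. F y $ I) x = partial I (f K) x"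
    and x: "x \<in> \<Omega>" "x + h \<in> \<Omega>"
  shows "has_grad (\<lambda>x. integral {0..1} (\<lambda>s. \<Sum>K\<in>UNIV. h $ K * f K (x + s *\<^sub>R h))) x (F (x + h) - F x)"
  unfolding has_grad_def line_deriv_def
proof
  fix i
  let ?e = "axis i (1::real) :: real^'m"
  obtain \<delta>1 where \<delta>1: "\<delta>1 > 0" "cball x \<delta>1 \<subseteq> \<Omega>" using \<Omega>(1) x(1) open_contains_cball by blast
  obtain \<delta>2 where \<delta>2: "\<delta>2 > 0" "cball (x + h) \<delta>2 \<subseteq> \<Omega>" using \<Omega>(1) x(2) open_contains_cball by blast
  \<comment> \<open>Balls around both endpoints lie in \<Omega>; by convexity so does the strip
    swept by the segment when it moves by at most \<delta> along the axis.\<close>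
  define \<delta> where "\<delta> = min \<delta>1 \<delta>2"
  have \<delta>: "\<delta> > 0" using \<delta>1 \<delta>2 by (simp add: \<delta>_def)
  have mem: "x + t *\<^sub>R ?e + s *\<^sub>R h \<in> \<Omega>" if t: "t \<in> {-\<delta>..\<delta>}" and s: "s \<in> {0..1}" for t s
  proof -
    have "x + t *\<^sub>R ?e \<in> cball x \<delta>1" "(x + h) + t *\<^sub>R ?e \<in> cball (x + h) \<delta>2"
      using t by (auto simp: dist_norm norm_axis_1 \<delta>_def abs_le_iff)
    then have "x + t *\<^sub>R ?e \<in> \<Omega>" "(x + h) + t *\<^sub>R ?e \<in> \<Omega>" using \<delta>1 \<delta>2 by auto
    then have "(1 - s) *\<^sub>R (x + t *\<^sub>R ?e) + s *\<^sub>R ((x + h) + t *\<^sub>R ?e) \<in> \<Omega>"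
      using s by (intro convexD[OF \<Omega>(2)]) auto
    then show ?thesis by (simp add: algebra_simps)
  qed
  have fc: "continuous_on \<Omega> (f K)" for K
    using f(1) by (auto intro!: continuous_at_imp_continuous_on differentiable_imp_continuous_within)
  let ?fx = "\<lambda>t s. \<Sum>K\<in>UNIV. h $ K * partial i (f K) (x + t *\<^sub>R ?e + s *\<^sub>R h)"
  have "((\<lambda>t. integral (cbox 0 1) (\<lambda>s. \<Sum>K\<in>UNIV. h $ K * f K (x + t *\<^sub>R ?e + s *\<^sub>R h))) has_real_derivative
      integral (cbox 0 1) (?fx 0)) (at 0 within {-\<delta>..\<delta>})"
  proof (rule leibniz_rule_field_derivative)
    fix t s assume t: "t \<in> {-\<delta>..\<delta>}" and s: "s \<in> cbox 0 (1::real)"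
    have "((\<lambda>t. f K (x + t *\<^sub>R ?e + s *\<^sub>R h)) has_real_derivative partial i (f K) (x + t *\<^sub>R ?e + s *\<^sub>R h)) (at t within {-\<delta>..\<delta>})" for K
    proof -
      have "f K differentiable (at ((x + s *\<^sub>R h) + t *\<^sub>R ?e))"
        using f(1)[OF mem[OF t], of s K] s by (simp add: algebra_simps)
      from has_derivative_line[OF this[unfolded frechet_derivative_works]]
      have "((\<lambda>t. f K ((x + s *\<^sub>R h) + t *\<^sub>R ?e)) has_real_derivative partial i (f K) ((x + s *\<^sub>R h) + t *\<^sub>R ?e)) (at t)"
        by (simp add: partial_def has_real_derivative_iff_has_vector_derivative)
      then show ?thesis by (simp add: algebra_simps has_field_derivative_at_within)
    qed
    then show "((\<lambda>t. \<Sum>K\<in>UNIV. h $ K * f K (x + t *\<^sub>R ?e + s *\<^sub>R h)) has_real_derivative ?fx t s) (at t within {-\<delta>..\<delta>})"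
      by (intro DERIV_sum DERIV_cmult)
  next
    fix t assume t: "t \<in> {-\<delta>..\<delta>}"
    show "(\<lambda>s. \<Sum>K\<in>UNIV. h $ K * f K (x + t *\<^sub>R ?e + s *\<^sub>R h)) integrable_on cbox 0 1"
      by (intro integrable_continuous continuous_intros continuous_on_compose2[OF fc]) (use mem[OF t] in auto)
  next
    show "continuous_on ({-\<delta>..\<delta>} \<times> cbox 0 1) (\<lambda>(t, s). ?fx t s)"
      unfolding split_beta'
      by (intro continuous_intros continuous_on_compose2[OF f(2)]) (use mem in auto)
  qed (use \<delta> in auto)
  moreover have "at (0::real) within {-\<delta>..\<delta>} = at 0"
    by (rule at_within_interior) (use \<delta> in \<open>simp add: interior_atLeastAtMost_real\<close>)
  moreover have "integral (cbox 0 1) (?fx 0) = F (x + h) $ i - F x $ i"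
  proof (rule integral_unique)
    have "(?fx 0 has_integral F (x + 1 *\<^sub>R h) $ i - F (x + 0 *\<^sub>R h) $ i) {0..1}"
    proof (rule fundamental_theorem_of_calculus)
      fix s :: real assume s: "s \<in> {0..1}"
      have xs: "x + s *\<^sub>R h \<in> \<Omega>" using mem[of 0 s] s \<delta> by simp
      have "(\<lambda>y. F y $ i) differentiable (at (x + s *\<^sub>R h))"
        using bounded_linear.has_derivative[OF bounded_linear_vec_nth F[OF xs, unfolded frechet_derivative_works], of i]
        unfolding differentiable_def by blast
      from differentiable_line[OF this]
      have "((\<lambda>s. F (x + s *\<^sub>R h) $ i) has_vector_derivative (\<Sum>K\<in>UNIV. h $ K * partial K (\<lambda>y. F y $ i) (x + s *\<^sub>R h))) (at s)"
        by simp
      then show "((\<lambda>s. F (x + s *\<^sub>R h) $ i) has_vector_derivative ?fx 0 s) (at s within {0..1})"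
        using curl[OF xs] by (simp add: has_vector_derivative_at_within)
    qed simp
    then show "(?fx 0 has_integral F (x + h) $ i - F x $ i) (cbox 0 1)" by simp
  qed
  ultimately show "((\<lambda>t. integral {0..1} (\<lambda>s. \<Sum>K\<in>UNIV. h $ K * f K (x + t *\<^sub>R ?e + s *\<^sub>R h))) has_real_derivative (F (x + h) - F x) $ i) (at 0)"
    by simp
qed

lemma uniform_bound:
  fixes g :: "'i::finite \<Rightarrow> 'a \<Rightarrow> 'b::real_normed_vector"
  assumes "\<And>i. \<exists>B. \<forall>x\<in>S. norm (g i x) \<le> B"
  obtains B where "B \<ge> 0" "\<And>i x. x \<in> S \<Longrightarrow> norm (g i x) \<le> B"
proof -
  obtain b where b: "\<And>i x. x \<in> S \<Longrightarrow> norm (g i x) \<le> b i" using assms by metis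
  have "norm (g i x) \<le> (\<Sum>i\<in>UNIV. \<bar>b i\<bar>)" if "x \<in> S" for i x
    using b[OF that, of i] member_le_sum[of i UNIV "\<lambda>i. \<bar>b i\<bar>"] by simp
  moreover have "(\<Sum>i\<in>UNIV. \<bar>b i\<bar>) \<ge> 0" by (simp add: sum_nonneg)
  ultimately show ?thesis by (metis that)
qed

section \<open>Verification of the abstract hypotheses for the given data\<close>

theorem theoremA:
  fixes \<Omega> :: "(real^'m::finite) set"
    and \<alpha> :: real
    and \<phi> :: "real^'m \<Rightarrow> real"
    and F :: "real^'m \<Rightarrow> real^'m"
    and f :: "'m \<Rightarrow> real^'m \<Rightarrow> real"
  assumes "CARD('m) \<ge> 2"
    and "is_domain \<Omega>" and "bounded \<Omega>" and "p_convex \<Omega>"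
    and "0 < \<alpha>" and "\<alpha> < 1"
    and "C_holder_boundary 2 \<alpha> \<Omega>"
    and "C_holder_closure 2 \<alpha> \<Omega> \<phi>"
    and "C_holder_closure 1 \<alpha> \<Omega> F"
    and "\<And>K. C_holder 1 \<alpha> \<Omega> (f K)"
    and "\<And>K. bounded (f K ` \<Omega>)"
    and "\<And>I K x. x \<in> \<Omega> \<Longrightarrow> partial K (\<lambda>y. F y $ I) x = partial I (f K) x"
  shows "\<exists>u. (\<exists>L. L-lipschitz_on (closure \<Omega>) u) \<and> is_minimizer \<Omega> F u \<and>
             (\<forall>x\<in>frontier \<Omega>. u x = \<phi> x)"
proof -
  let ?m = "real CARD('m)"
  have op: "open \<Omega>" using assms(2) by (simp add: is_domain_def)
  note bdd = assms(3)
  obtain a where a: "a > 0" and par: "\<And>p. p \<in> frontier \<Omega> \<Longrightarrow> \<exists>e f. norm e = 1 \<and> norm f = 1 \<and> e \<bullet> f = 0 \<and>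
        (\<forall>x\<in>\<Omega>. a * ((x - p) \<bullet> e)\<^sup>2 < (x - p) \<bullet> f)"
    using p_convex_parabolas[OF assms(4)] by metis
  have conv: "convex \<Omega>" by (rule parabolas_imp_convex[OF op a par])
  have \<phi>C: "C_k_closure 2 \<Omega> \<phi>" using assms(8) by (simp add: C_holder_closure_def)
  have FC: "C_k_closure 1 \<Omega> F" using assms(9) by (simp add: C_holder_closure_def)
  have fC: "C_k 1 \<Omega> (f K)" for K using assms(10)[of K] by (simp add: C_holder_def)
  note \<phi>k = C_k_partials[of 2 \<Omega> \<phi>] and Fk = C_k_partials[of 1 \<Omega> F] and fk = C_k_partials[OF fC]
  have \<phi>2: "C_k 2 \<Omega> \<phi>" and F1: "C_k 1 \<Omega> F" using \<phi>C FC by (auto simp: C_k_closure_def)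
  have \<phi>d: "\<phi> differentiable (at x)" and d\<phi>d: "partial i \<phi> differentiable (at x)" if "x \<in> \<Omega>" for x i
    using \<phi>k(1)[OF \<phi>2 _ that, of "[]"] \<phi>k(1)[OF \<phi>2 _ that, of "[i]"] by (simp_all add: partials_def)
  have Fd: "F differentiable (at x)" if "x \<in> \<Omega>" for x
    using Fk(1)[OF F1 _ that, of "[]"] by (simp add: partials_def)
  have fd: "f K differentiable (at x)" if "x \<in> \<Omega>" for K x
    using fk(1)[OF _ that, of "[]" K] by (simp add: partials_def)
  have fc: "continuous_on \<Omega> (partial I (f K))" for I K
    using fk(2)[of "[I]" K] by (simp add: partials_def)
  note curl = assms(12)
  obtain B0 where B0: "\<And>x. x \<in> \<Omega> \<Longrightarrow> norm (\<phi> x) \<le> B0"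
    using C_k_closure_bounded[OF \<phi>C bdd, of "[]"] by (auto simp: partials_def)
  have "\<exists>B. \<forall>x\<in>\<Omega>. norm (partial i \<phi> x) \<le> B" for i
    by (rule C_k_closure_bounded[OF \<phi>C bdd, of "[i]"]) (auto simp: partials_def)
  then obtain B1 where B1: "B1 \<ge> 0" "\<And>i x. x \<in> \<Omega> \<Longrightarrow> norm (partial i \<phi> x) \<le> B1"
    using uniform_bound[of \<Omega> "\<lambda>i. partial i \<phi>"] by metis
  have "\<exists>B. \<forall>x\<in>\<Omega>. norm (partial i (partial j \<phi>) x) \<le> B" for i j
    by (rule C_k_closure_bounded[OF \<phi>C bdd, of "[i, j]"]) (auto simp: partials_def)
  \<comment> \<open>Indexing by pairs gives one bound for all second derivatives at once.\<close>
  then have "\<exists>B. \<forall>x\<in>\<Omega>. norm ((case p of (i, j) \<Rightarrow> partial i (partial j \<phi>)) x) \<le> B" for p :: "'m \<times> 'm"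
    by (cases p) simp
  then obtain B2 where B2: "B2 \<ge> 0" "\<And>p x. x \<in> \<Omega> \<Longrightarrow> norm ((case p of (i, j) \<Rightarrow> partial i (partial j \<phi>)) x) \<le> B2"
    by (rule uniform_bound[of \<Omega> "\<lambda>p. case p of (i, j) \<Rightarrow> partial i (partial j \<phi>)"]) blast
  obtain C0 where C0: "\<And>x. x \<in> \<Omega> \<Longrightarrow> norm (F x) \<le> C0"
    using C_k_closure_bounded[OF FC bdd, of "[]"] by (auto simp: partials_def)
  have "\<exists>B. \<forall>x\<in>\<Omega>. norm (partial i F x) \<le> B" for i
    by (rule C_k_closure_bounded[OF FC bdd, of "[i]"]) (auto simp: partials_def)
  then obtain C1 where C1: "C1 \<ge> 0" "\<And>i x. x \<in> \<Omega> \<Longrightarrow> norm (partial i F x) \<le> C1"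
    using uniform_bound[of \<Omega> "\<lambda>i. partial i F"] by metis
  have "\<exists>B. \<forall>x\<in>\<Omega>. norm (f K x) \<le> B" for K
    using assms(11)[of K] by (auto simp: bounded_iff)
  then obtain E where E: "E \<ge> 0" "\<And>K x. x \<in> \<Omega> \<Longrightarrow> norm (f K x) \<le> E"
    using uniform_bound[of \<Omega> f] by metis
  define \<Phi> where "\<Phi> x = (\<Sum>j\<in>UNIV. partial j \<phi> x *\<^sub>R axis j (1::real))" for x
  have \<Phi>_nth: "\<Phi> x $ i = partial i \<phi> x" for x i
    by (simp add: \<Phi>_def axis_def if_distrib cong: if_cong)
  have \<phi>_grad: "has_grad \<phi> x (\<Phi> x)" if "x \<in> \<Omega>" for x
    using differentiable_has_grad[OF \<phi>d[OF that]] by (simp add: has_grad_def \<Phi>_nth)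
  have \<Phi>_bd: "norm (\<Phi> x) \<le> ?m * B1" if "x \<in> \<Omega>" for x
  proof -
    have "norm (\<Phi> x) \<le> (\<Sum>j\<in>UNIV. \<bar>\<Phi> x $ j\<bar>)" by (rule norm_le_l1_cart)
    also have "\<dots> \<le> (\<Sum>j\<in>(UNIV::'m set). B1)" using B1(2)[OF that] by (intro sum_mono) (simp add: \<Phi>_nth)
    finally show ?thesis by simp
  qed
  \<comment> \<open>The gradient of the boundary datum is absorbed into the field; second
    derivatives of \<phi> thus enter the Lipschitz constant of the new field.\<close>
  define F' where "F' x = F x + \<Phi> x" for x
  have F'_der: "(F' has_derivative (\<lambda>v. frechet_derivative F (at x) v +
      (\<Sum>j\<in>UNIV. frechet_derivative (partial j \<phi>) (at x) v *\<^sub>R axis j 1))) (at x)" if "x \<in> \<Omega>" for x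
    unfolding F'_def[abs_def] \<Phi>_def
    using Fd[OF that] d\<phi>d[OF that] unfolding frechet_derivative_works
    by (intro has_derivative_add has_derivative_sum has_derivative_scaleR_left)
  have F'd: "F' differentiable (at x)" if "x \<in> \<Omega>" for x
    using F'_der[OF that] unfolding differentiable_def by blast
  define D where "D = C1 + ?m * B2"
  have D0: "D \<ge> 0" using C1(1) B2(1) by (simp add: D_def)
  have F'_part: "norm (partial i F' x) \<le> D" if x: "x \<in> \<Omega>" for i x
  proof -
    have "partial i F' x = partial i F x + (\<Sum>j\<in>UNIV. partial i (partial j \<phi>) x *\<^sub>R axis j 1)"
      unfolding partial_eq[OF F'_der[OF x]] by (simp add: partial_def)
    also have "norm \<dots> \<le> norm (partial i F x) + (\<Sum>j\<in>UNIV. norm (partial i (partial j \<phi>) x *\<^sub>R axis j (1::real)))"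
      by (intro norm_triangle_mono order_refl norm_sum)
    also have "\<dots> \<le> C1 + (\<Sum>j\<in>(UNIV::'m set). B2)"
      using B2(2)[OF x, of "(i, j)" for j] by (intro add_mono C1(2) x sum_mono) (simp add: norm_axis_1)
    finally show ?thesis by (simp add: D_def)
  qed
  \<comment> \<open>One constant above the bound of \<open>F'\<close>, its Lipschitz constant, its
    partial derivatives and the size of the correcting functions relative to
    \<open>norm h\<close>.\<close>
  define M where "M = 1 + \<bar>C0\<bar> + ?m * B1 + (?m + 1) * D + ?m * E"
  have M1: "M > 0" and M2: "\<bar>C0\<bar> + ?m * B1 \<le> M" and M3: "?m * D \<le> M" and M4: "D \<le> M" and M5: "?m * E + ?m * B1 \<le> M"
  proof -
    have "(?m + 1) * D = ?m * D + D" by (simp add: algebra_simps)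
    moreover have "?m * D \<ge> 0" "?m * E \<ge> 0" "?m * B1 \<ge> 0" using D0 E(1) B1(1) by auto
    ultimately show "M > 0" "\<bar>C0\<bar> + ?m * B1 \<le> M" "?m * D \<le> M" "D \<le> M" "?m * E + ?m * B1 \<le> M"
      using D0 unfolding M_def by linarith+
  qed
  have \<phi>_lip: "\<bar>\<phi> x - \<phi> y\<bar> \<le> ?m * B1 * norm (x - y)" if "x \<in> \<Omega>" "y \<in> \<Omega>" for x y
    using bounded_partials_lipschitz[OF conv \<phi>d B1(2) that] by simp
  have F'_lip: "norm (F' x - F' y) \<le> M * norm (x - y)" if "x \<in> \<Omega>" "y \<in> \<Omega>" for x y
    by (rule order_trans[OF bounded_partials_lipschitz[OF conv F'd F'_part that] mult_right_mono[OF M3]]) auto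
  have F_part: "partial K (\<lambda>y. F y $ I) x = partial K F x $ I" if "x \<in> \<Omega>" for K I x
    using partial_eq[OF bounded_linear.has_derivative[OF bounded_linear_vec_nth Fd[OF that, unfolded frechet_derivative_works], of I], of K]
    by (simp add: partial_def)
  \<comment> \<open>The regularity of \<open>f K\<close> is local in \<Omega>. The uniform bound for
    its derivatives comes from \<open>F\<close> through the hypothesis that links them.\<close>
  have f_lip: "\<bar>f K x - f K y\<bar> \<le> ?m * C1 * norm (x - y)" if xy: "x \<in> \<Omega>" "y \<in> \<Omega>" for K x y
  proof -
    have "norm (partial I (f K) x) \<le> C1" if "x \<in> \<Omega>" for I x
      using component_le_norm_cart[of "partial K F x" I] C1(2)[OF that, of K]
      unfolding curl[OF that, symmetric] F_part[OF that] by simp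
    from bounded_partials_lipschitz[OF conv fd this xy] show ?thesis by simp
  qed
  obtain R where R: "R > 0" "\<And>x. x \<in> closure \<Omega> \<Longrightarrow> norm x \<le> R"
    using bounded_closure[OF bdd] by (auto simp: bounded_pos)
  interpret haar_problem \<Omega> F' M "\<lambda>i x. partial i F' x" a "2 * R"
  proof unfold_locales
    show "open \<Omega>" "bounded \<Omega>" "0 < M" "0 < a" by (rule op bdd M1 a)+
    show "0 < 2 * R" using R(1) by simp
    show "norm (F' x - F' y) \<le> M * norm (x - y)" if "x \<in> \<Omega>" "y \<in> \<Omega>" for x y using that by (rule F'_lip)
    show "\<exists>e f. norm e = 1 \<and> norm f = 1 \<and> e \<bullet> f = 0 \<and> (\<forall>x\<in>\<Omega>. a * ((x - p) \<bullet> e)\<^sup>2 < (x - p) \<bullet> f)"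
      if "p \<in> frontier \<Omega>" for p using that by (rule par)
    show "norm (F' x) \<le> M" if "x \<in> \<Omega>" for x
      unfolding F'_def using norm_triangle_ineq[of "F x" "\<Phi> x"] C0[OF that] \<Phi>_bd[OF that] M2 by linarith
    show "((\<lambda>t. F' (x + t *\<^sub>R axis i 1)) has_vector_derivative partial i F' x) (at 0)" if "x \<in> \<Omega>" for x i
      by (rule differentiable_partial_line[OF F'd[OF that]])
    show "norm (partial i F' x) \<le> M" if "x \<in> \<Omega>" for x i
      using F'_part[OF that] M4 by (rule order_trans)
    show "norm (x - p) \<le> 2 * R" if "p \<in> frontier \<Omega>" "x \<in> \<Omega>" for p x
      using norm_triangle_ineq4[of x p] R(2)[of x] R(2)[of p] that closure_subset[of \<Omega>]
      by (auto simp: frontier_def)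
  next
    fix h
    define G where "G x = integral {0..1} (\<lambda>s. \<Sum>K\<in>UNIV. h $ K * f K (x + s *\<^sub>R h))" for x
    \<comment> \<open>\<open>G\<close> corrects for the given field, and the difference of \<phi>
      corrects for its gradient in \<open>F'\<close>.\<close>
    define g where "g x = G x + (\<phi> (x + h) - \<phi> x)" for x
    have seg: "x + s *\<^sub>R h \<in> \<Omega>" if "x \<in> \<Omega>" "x + h \<in> \<Omega>" "s \<in> {0..1}" for x s
    proof -
      have "(1 - s) *\<^sub>R x + s *\<^sub>R (x + h) \<in> \<Omega>" using that by (intro convexD[OF conv]) auto
      then show ?thesis by (simp add: algebra_simps)
    qed
    have fcont: "continuous_on \<Omega> (f K)" for K
      using fd by (auto intro!: continuous_at_imp_continuous_on differentiable_imp_continuous_within)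
    have Gcont: "continuous_on {0..1} (\<lambda>s. \<Sum>K\<in>UNIV. h $ K * f K (x + s *\<^sub>R h))" if "x \<in> \<Omega>" "x + h \<in> \<Omega>" for x
      by (intro continuous_intros continuous_on_compose2[OF fcont]) (use seg[OF that] in auto)
    have G_bd: "\<bar>G x\<bar> \<le> ?m * E * norm h" if x: "x \<in> \<Omega>" "x + h \<in> \<Omega>" for x
    proof -
      have "norm (G x) \<le> ?m * E * norm h * (1 - 0)"
        unfolding G_def
      proof (rule integral_bound[OF _ Gcont[OF x]])
        show "norm (\<Sum>K\<in>UNIV. h $ K * f K (x + s *\<^sub>R h)) \<le> ?m * E * norm h" if s: "s \<in> {0..1}" for s
        proof -
          have "norm (\<Sum>K\<in>UNIV. h $ K * f K (x + s *\<^sub>R h)) \<le> (\<Sum>K\<in>(UNIV::'m set). norm h * E)"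
            using E(2)[OF seg[OF x s]] component_le_norm_cart[of h]
            by (intro order_trans[OF norm_sum sum_mono]) (auto simp: abs_mult intro!: mult_mono)
          then show ?thesis by (simp add: mult_ac)
        qed
      qed simp
      then show ?thesis by simp
    qed
    have G_lip: "\<bar>G x - G y\<bar> \<le> ?m * norm h * (?m * C1) * norm (x - y)"
      if x: "x \<in> \<Omega>" "x + h \<in> \<Omega>" and y: "y \<in> \<Omega>" "y + h \<in> \<Omega>" for x y
    proof -
      have "G x - G y = integral {0..1} (\<lambda>s. (\<Sum>K\<in>UNIV. h $ K * f K (x + s *\<^sub>R h)) - (\<Sum>K\<in>UNIV. h $ K * f K (y + s *\<^sub>R h)))"
        unfolding G_def
        by (rule Henstock_Kurzweil_Integration.integral_diff[symmetric]; rule integrable_continuous_real; rule Gcont; rule x y)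
      also have "norm \<dots> \<le> ?m * norm h * (?m * C1) * norm (x - y) * (1 - 0)"
      proof (rule integral_bound)
        show "continuous_on {0..1} (\<lambda>s. (\<Sum>K\<in>UNIV. h $ K * f K (x + s *\<^sub>R h)) - (\<Sum>K\<in>UNIV. h $ K * f K (y + s *\<^sub>R h)))"
          by (intro continuous_on_diff Gcont x y)
        show "norm ((\<Sum>K\<in>UNIV. h $ K * f K (x + s *\<^sub>R h)) - (\<Sum>K\<in>UNIV. h $ K * f K (y + s *\<^sub>R h)))
            \<le> ?m * norm h * (?m * C1) * norm (x - y)" if s: "s \<in> {0..1}" for s
        proof -
          have "(\<Sum>K\<in>UNIV. h $ K * f K (x + s *\<^sub>R h)) - (\<Sum>K\<in>UNIV. h $ K * f K (y + s *\<^sub>R h)) =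
              (\<Sum>K\<in>UNIV. h $ K * (f K (x + s *\<^sub>R h) - f K (y + s *\<^sub>R h)))"
            by (simp add: sum_subtractf right_diff_distrib)
          also have "norm \<dots> \<le> (\<Sum>K\<in>(UNIV::'m set). norm h * (?m * C1 * norm (x - y)))"
          proof (intro order_trans[OF norm_sum sum_mono])
            fix K
            have "\<bar>f K (x + s *\<^sub>R h) - f K (y + s *\<^sub>R h)\<bar> \<le> ?m * C1 * norm (x - y)"
              using f_lip[OF seg[OF x s] seg[OF y s], of K] by simp
            then show "norm (h $ K * (f K (x + s *\<^sub>R h) - f K (y + s *\<^sub>R h))) \<le> norm h * (?m * C1 * norm (x - y))"
              unfolding real_norm_def abs_mult by (intro mult_mono component_le_norm_cart) auto
          qed
          finally show ?thesis by (simp add: mult_ac)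
        qed
      qed simp
      finally show ?thesis by simp
    qed
    have "\<bar>g x\<bar> \<le> M * norm h \<and> has_grad g x (F' (x + h) - F' x)" if x: "x \<in> \<Omega>" "x + h \<in> \<Omega>" for x
    proof
      have "\<bar>g x\<bar> \<le> ?m * E * norm h + ?m * B1 * norm h"
        using G_bd[OF x] \<phi>_lip[OF x(2,1)] by (simp add: g_def)
      also have "\<dots> \<le> M * norm h" using mult_right_mono[OF M5, of "norm h"] by (simp add: algebra_simps)
      finally show "\<bar>g x\<bar> \<le> M * norm h" .
      have "has_grad G x (F (x + h) - F x)"
        unfolding G_def by (rule translation_potential[OF op conv Fd fd fc curl x])
      moreover have "has_grad (\<lambda>x. \<phi> (x + h) - \<phi> x) x (\<Phi> (x + h) - \<Phi> x)"
        by (intro has_grad_diff \<phi>_grad x) (simp add: has_grad_translate \<phi>_grad x)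
      ultimately have "has_grad g x ((F (x + h) - F x) + (\<Phi> (x + h) - \<Phi> x))"
        unfolding g_def by (rule has_grad_add)
      then show "has_grad g x (F' (x + h) - F' x)" by (simp add: F'_def algebra_simps)
    qed
    moreover have "\<bar>g x - g y\<bar> \<le> (?m * norm h * (?m * C1) + 2 * (?m * B1)) * norm (x - y)"
      if x: "x \<in> \<Omega>" "x + h \<in> \<Omega>" and y: "y \<in> \<Omega>" "y + h \<in> \<Omega>" for x y
    proof -
      have "\<bar>g x - g y\<bar> \<le> \<bar>G x - G y\<bar> + \<bar>\<phi> (x + h) - \<phi> (y + h)\<bar> + \<bar>\<phi> x - \<phi> y\<bar>" by (simp add: g_def)
      also have "\<dots> \<le> ?m * norm h * (?m * C1) * norm (x - y) + ?m * B1 * norm (x - y) + ?m * B1 * norm (x - y)"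
        using G_lip[OF x y] \<phi>_lip[OF x(2) y(2)] \<phi>_lip[OF x(1) y(1)] unfolding add_diff_cancel_right by (intro add_mono)
      finally show ?thesis by (simp add: algebra_simps)
    qed
    ultimately show "\<exists>g C. (\<forall>x. x \<in> \<Omega> \<longrightarrow> x + h \<in> \<Omega> \<longrightarrow> \<bar>g x\<bar> \<le> M * norm h \<and> has_grad g x (F' (x + h) - F' x)) \<and>
        (\<forall>x y. x \<in> \<Omega> \<longrightarrow> x + h \<in> \<Omega> \<longrightarrow> y \<in> \<Omega> \<longrightarrow> y + h \<in> \<Omega> \<longrightarrow> \<bar>g x - g y\<bar> \<le> C * norm (x - y))"
      by (intro exI[of _ g] exI[of _ "?m * norm h * (?m * C1) + 2 * (?m * B1)"]) blast
  qed
  obtain w K where w: "\<And>x y. \<bar>w x - w y\<bar> \<le> K * norm (x - y)" "\<And>x. x \<notin> \<Omega> \<Longrightarrow> w x = 0"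
    and min: "\<And>\<zeta>. Lip \<zeta> \<Longrightarrow> (\<And>x. x \<notin> \<Omega> \<Longrightarrow> \<zeta> x = 0) \<Longrightarrow> energy norm w \<le> energy norm (\<lambda>x. w x + \<zeta> x)"
    by (rule lipschitz_minimizer) blast
  have wLip: "Lip w" using w(1) by (rule LipI)
  have F_int: "set_integrable lebesgue \<Omega> F"
    by (rule set_integrable_continuous_bounded[OF op bdd _ C0])
      (intro continuous_at_imp_continuous_on ballI differentiable_imp_continuous_within Fd)
  have \<Phi>_cont: "continuous_on \<Omega> \<Phi>"
    unfolding \<Phi>_def
    by (intro continuous_intros continuous_at_imp_continuous_on ballI differentiable_imp_continuous_within d\<phi>d)
  have "is_minimizer \<Omega> F (\<lambda>x. \<phi> x + w x)"
  proof (rule is_minimizer_if_energy_minimal[where C = "?m * B1" and B = "max B0 (?m * B1)" and \<Phi> = \<Phi>])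
    show "\<bar>\<phi> x\<bar> \<le> max B0 (?m * B1)" if "x \<in> \<Omega>" for x using B0[OF that] by simp
    show "norm (\<Phi> x) \<le> max B0 (?m * B1)" if "x \<in> \<Omega>" for x using \<Phi>_bd[OF that] by simp
    show "F' x = F x + \<Phi> x" for x by (rule F'_def)
  qed (use \<phi>_lip \<phi>_grad \<Phi>_cont F_int wLip w(2) min in auto)
  moreover have "\<exists>L. L-lipschitz_on (closure \<Omega>) (\<lambda>x. \<phi> x + w x)"
  proof -
    have "(?m * B1)-lipschitz_on \<Omega> \<phi>"
      using \<phi>_lip B1(1) by (intro lipschitz_onI) (auto simp: dist_norm)
    \<comment> \<open>The bound passes to the closure because \<open>C_k_closure\<close> requires
      \<phi> itself to be continuous there.\<close>
    then have "(?m * B1)-lipschitz_on (closure \<Omega>) \<phi>"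
      by (rule lipschitz_on_closure) (use \<phi>C in \<open>simp add: C_k_closure_def\<close>)
    moreover obtain L where "L-lipschitz_on UNIV w" using wLip Lip_lipschitz_on by blast
    then have "L-lipschitz_on (closure \<Omega>) w" by (rule lipschitz_on_subset) simp
    ultimately show ?thesis using lipschitz_on_add by blast
  qed
  \<comment> \<open>The frontier of an open set is disjoint from it, so \<open>w\<close> vanishes
    there.\<close>
  moreover have "\<phi> x + w x = \<phi> x" if "x \<in> frontier \<Omega>" for x
    using w(2)[of x] that op by (simp add: frontier_def interior_open)
  ultimately show ?thesis by blast
qed

end
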